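(* There is a universal constant $C>0$ such that the following holds. If $q>0$ and $\Phi\in F_q$, then for every adapted sequence $(f_n)_{n\ge1}$ of real-valued random variables with decoupled version $(\overline f_n)_{n\ge1}$, $$E\,\Phi\Big(\Big|\sum_i f_i\Big|\Big)\le C^{1+q}\,E\,\Phi\Big(\Big|\sum_i\overline f_i\Big|\Big).$$ (The constant $C$ does not depend on $q$, $\Phi$, the sequence, or the probability space.)
   Context: Setting. $(\mathcal F_n)_{n\ge0}$ is an increasing sequence of $\sigma$-algebras on a probability space $(\Omega,\mathcal F,P)$ with $\mathcal F_0=\{\emptyset,\Omega\}$. A sequence $(f_n)_{n\ge1}$ of random variables is adapted if $f_n$ is $\mathcal F_n$-measurable for each $n\ge1$. For a $\sigma$-algebra $\mathcal A\subset\mathcal F$, $\mathcal L(f|\mathcal A)$ denotes the conditional distribution of $f$ given $\mathcal A$; $\mathcal L(f|\mathcal A)=\mathcal L(g|\mathcal A)$ means $P(f>t|\mathcal A)=P(g>t|\mathcal A)$ a.s. for every real $t$. Two adapted sequences $(f_n)$, $(g_n)$ are tangent if $\mathcal L(f_n|\mathcal F_{n-1})=\mathcal L(g_n|\mathcal F_{n-1})$ for each $n\ge1$. An adapted sequence $(g_n)$ satisfies condition (CI) if there is a $\sigma$-algebra $\mathcal G\subset\mathcal F$ such that $\mathcal L(g_n|\mathcal F_{n-1})=\mathcal L(g_n|\mathcal G)$ for each $n\ge1$ and $(g_n)$ is a sequence of $\mathcal G$-conditionally independent random variables. Every adapted sequence $(f_n)$ admits, possibly on an enlarged probability space (with correspondingly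 enlarged $\sigma$-algebras), a tangent sequence satisfying (CI); such a sequence is denoted $(\overline f_n)$ and called a decoupled version of $(f_n)$. Moreover $\mathcal G$ can be chosen so that all $f_n$ are $\mathcal G$-measurable. The sums are finite sums, or series assumed to converge almost surely (both $\sum f_i$ and $\sum\overline f_i$). Class $F_q$ ($q>0$): all functions $\Phi:[0,\infty)\to[0,\infty)$ with $\Phi(0)=0$, $\Phi$ nondecreasing and continuous, and $\Phi(cx)\le c^q\Phi(x)$ for all $x\ge0$, $c\ge2$. *)

theory Defs
  imports "HOL-Probability.Probability"
begin

text \<open>
  Sub-sigma-algebras of a probability space \<open>M\<close> are represented, as in
  \<^theory>\<open>HOL-Probability.Conditional_Expectation\<close>, by measures \<open>A\<close> with \<open>subalgebra M A\<close>; only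
  the space and the sets of \<open>A\<close> matter. Sequences of random variables \<open>(f\<^sub>n)\<close> are indexed by
  \<open>n \<ge> 1\<close>; the value \<open>f 0\<close> is never used.
\<close>

definition filtered_prob_space :: "'a measure \<Rightarrow> (nat \<Rightarrow> 'a measure) \<Rightarrow> bool" where
  "filtered_prob_space M F \<longleftrightarrow>
     prob_space M \<and> filtration (space M) F \<and> (\<forall>n. subalgebra M (F n)) \<and>
     sets (F 0) = {{}, space M}"

definition adapted_seq :: "(nat \<Rightarrow> 'a measure) \<Rightarrow> (nat \<Rightarrow> 'a \<Rightarrow> real) \<Rightarrow> bool" where
  "adapted_seq F f \<longleftrightarrow> (\<forall>n\<ge>1. f n \<in> borel_measurable (F n))"

definition cond_prob_given :: "'a measure \<Rightarrow> 'a measure \<Rightarrow> 'a set \<Rightarrow> 'a \<Rightarrow> real" where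
  "cond_prob_given M A S = real_cond_exp M A (indicator S)"

text \<open>
  \<open>same_cond_law M f A g B\<close> is the equality \<open>L(f|A) = L(g|B)\<close>. The two sigma-algebras may differ,
  as they do in condition (CI).
\<close>

definition same_cond_law ::
  "'a measure \<Rightarrow> ('a \<Rightarrow> real) \<Rightarrow> 'a measure \<Rightarrow> ('a \<Rightarrow> real) \<Rightarrow> 'a measure \<Rightarrow> bool" where
  "same_cond_law M f A g B \<longleftrightarrow>
     (\<forall>t::real. AE x in M. cond_prob_given M A {y \<in> space M. f y > t} x
                         = cond_prob_given M B {y \<in> space M. g y > t} x)"

definition tangent_seqs ::
  "'a measure \<Rightarrow> (nat \<Rightarrow> 'a measure) \<Rightarrow> (nat \<Rightarrow> 'a \<Rightarrow> real) \<Rightarrow> (nat \<Rightarrow> 'a \<Rightarrow> real) \<Rightarrow> bool" where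
  "tangent_seqs M F f g \<longleftrightarrow>
     adapted_seq F f \<and> adapted_seq F g \<and>
     (\<forall>n\<ge>1. same_cond_law M (f n) (F (n - 1)) (g n) (F (n - 1)))"

definition cond_indep_seq :: "'a measure \<Rightarrow> 'a measure \<Rightarrow> (nat \<Rightarrow> 'a \<Rightarrow> real) \<Rightarrow> bool" where
  "cond_indep_seq M G g \<longleftrightarrow>
     (\<forall>J B. finite J \<and> J \<noteq> {} \<and> J \<subseteq> {1..} \<and> (\<forall>j\<in>J. B j \<in> sets borel) \<longrightarrow>
        (AE x in M. cond_prob_given M G {y \<in> space M. \<forall>j\<in>J. g j y \<in> B j} x
                  = (\<Prod>j\<in>J. cond_prob_given M G {y \<in> space M. g j y \<in> B j} x)))"

definition condition_CI :: "'a measure \<Rightarrow> (nat \<Rightarrow> 'a measure) \<Rightarrow> (nat \<Rightarrow> 'a \<Rightarrow> real) \<Rightarrow> bool" where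
  "condition_CI M F g \<longleftrightarrow>
     adapted_seq F g \<and>
     (\<exists>G. subalgebra M G \<and>
          (\<forall>n\<ge>1. same_cond_law M (g n) (F (n - 1)) (g n) G) \<and>
          cond_indep_seq M G g)"

text \<open>
  Here \<open>M\<close> and \<open>F\<close> are the probability space and filtration after the enlargement (if any) that is
  needed to accommodate \<open>g\<close>, so that \<open>f\<close> and \<open>g\<close> live on the same space.
\<close>

definition decoupled_version ::
  "'a measure \<Rightarrow> (nat \<Rightarrow> 'a measure) \<Rightarrow> (nat \<Rightarrow> 'a \<Rightarrow> real) \<Rightarrow> (nat \<Rightarrow> 'a \<Rightarrow> real) \<Rightarrow> bool" where
  "decoupled_version M F f g \<longleftrightarrow> tangent_seqs M F f g \<and> condition_CI M F g"

definition class_F :: "real \<Rightarrow> (real \<Rightarrow> real) set" where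
  "class_F q = {\<Phi>. \<Phi> 0 = 0 \<and> (\<forall>x\<ge>0. 0 \<le> \<Phi> x) \<and> mono_on {0..} \<Phi> \<and> continuous_on {0..} \<Phi> \<and>
                    (\<forall>x\<ge>0. \<forall>c\<ge>2. \<Phi> (c * x) \<le> c powr q * \<Phi> x)}"

text \<open>
  The inequality for all finite sums, and for the series whenever both converge almost surely.
  Expectations of nonnegative variables may be infinite.
\<close>

definition decoupling_ineq ::
  "real \<Rightarrow> real \<Rightarrow> (real \<Rightarrow> real) \<Rightarrow> 'a measure \<Rightarrow> (nat \<Rightarrow> 'a \<Rightarrow> real) \<Rightarrow> (nat \<Rightarrow> 'a \<Rightarrow> real) \<Rightarrow> bool" where
  "decoupling_ineq C q \<Phi> M f g \<longleftrightarrow>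
     (\<forall>N. (\<integral>\<^sup>+ x. ennreal (\<Phi> \<bar>\<Sum>i=1..N. f i x\<bar>) \<partial>M)
           \<le> ennreal (C powr (1 + q)) * (\<integral>\<^sup>+ x. ennreal (\<Phi> \<bar>\<Sum>i=1..N. g i x\<bar>) \<partial>M)) \<and>
     ((AE x in M. summable (\<lambda>i. f (Suc i) x)) \<and> (AE x in M. summable (\<lambda>i. g (Suc i) x)) \<longrightarrow>
       (\<integral>\<^sup>+ x. ennreal (\<Phi> \<bar>\<Sum>i. f (Suc i) x\<bar>) \<partial>M)
           \<le> ennreal (C powr (1 + q)) * (\<integral>\<^sup>+ x. ennreal (\<Phi> \<bar>\<Sum>i. g (Suc i) x\<bar>) \<partial>M))"

text \<open>
  HOL cannot quantify over types inside a formula: in a statement \<open>\<exists>C. \<forall>M :: 'a measure. \<dots>\<close> with a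
  type variable \<open>'a\<close>, the witness \<open>C\<close> may depend on \<open>'a\<close>. The constant below is a closed term
  without type variables. It is pinned down by the sample space type \<open>nat \<Rightarrow> real\<close> alone, and it is
  an arbitrary real number should no constant exist. Asserting that it is positive and satisfies
  the inequality for probability spaces on every type \<open>'a\<close> thus says that one and the same constant
  exists for all probability spaces.
\<close>

definition universal_const :: real where
  "universal_const = (SOME C. C > 0 \<and>
     (\<forall>q>0. \<forall>\<Phi>\<in>class_F q. \<forall>(M :: (nat \<Rightarrow> real) measure) F f g.
        filtered_prob_space M F \<longrightarrow> adapted_seq F f \<longrightarrow> decoupled_version M F f g \<longrightarrow>
        decoupling_ineq C q \<Phi> M f g))"

end

theory Submission
  imports Defs
begin

text \<open>
  Conditionally on \<open>\<G>\<close>, the decoupled sum is a sum of independent variables whose laws \<open>p\<^sub>i\<close>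
  are the conditional laws of the \<open>f\<^sub>i\<close>; these laws are predictable. Let \<open>D\<^sub>n\<close> be the median
  of the sum of \<open>n\<close> independent variables with laws \<open>p\<^sub>1, \<dots>, p\<^sub>n\<close>, and centre the
  \<open>f\<^sub>i\<close> by the predictable increments of \<open>D\<close>. Levy's inequality bounds the probability
  \<open>m\<^sub>n\<close> that the centred independent walk ever leaves \<open>[-a, a]\<close> by the tail of the decoupled sum.
  While \<open>m\<^sub>n\<close> is small, the product of the moment generating functions of the truncated steps over any
  time window is bounded, for both signs of the exponent. Dividing by this product gives an exponential
  martingale for the centred sum \<open>S\<close> of the \<open>f\<^sub>i\<close>, which shows that after passing \<open>\<lambda>\<close>
  it passes \<open>4\<lambda>\<close> with conditional probability at most \<open>4\<^sup>-\<^sup>q / 2\<close>, up to events whose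
  probability is at most a multiple of the tail of the decoupled sum. This good-\<open>\<lambda>\<close> inequality
  integrates to the theorem for finite-valued variables, with \<open>C = 4000\<close>, and approximation does the rest.
  Finally, a finite-valued sequence has a copy on \<open>nat \<Rightarrow> real\<close>, so that
  the constant chosen for that sample space serves for all of them.
\<close>

section \<open>Independent walks with finitely many step sizes\<close>

text \<open>Given \<open>G\<close> the \<open>f i\<close> need not be independent, so conditioning
  on \<open>G\<close> says nothing about their sum. What \<open>f\<close> and its decoupled version
  share are the laws \<open>p i\<close>, which are revealed one step at a time, and nothing used
  along the path may involve laws of the future. The conditional tail of the full decoupled sum
  does; the probability that the walk has left an interval by time n does not, and it only grows
  with n. Hence the detour through a maximal inequality. Centring at medians makes that inequality
  available without symmetry, and the n-th median depends on the first n laws alone. No moments are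
  assumed. The bound on the moment generating functions comes from confinement: a walk that is
  unlikely to leave \<open>[-a, a]\<close> cannot have a large exponential moment once its steps are
  truncated. The form \<open>C powr (1 + q)\<close> arises as follows. The good-\<lambda> inequality
  has to beat \<open>4 powr q\<close>, so \<open>exp (2 * k)\<close> is a multiple of
  \<open>4 powr q\<close>; the admissible exit probability \<epsilon> is then of the order
  \<open>exp (- (4 * k))\<close>, and all losses are exponential in q. Finitely many values turn
  conditional laws into finite vectors.\<close>

text \<open>
  A walk whose step at time \<open>i\<close> is \<open>v \<in> V\<close> with probability \<open>p i v\<close>:
  \<open>walk_mean V p s n \<phi> x\<close> is the expectation of \<open>\<phi>\<close> at time \<open>s + n\<close> when the walk is at
  \<open>x\<close> at time \<open>s\<close>, and \<open>exitp V p b a s n x\<close> is the probability that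
  the walk with steps \<open>v - b i\<close> is outside \<open>[-a, a]\<close> at some time in \<open>{s..s + n}\<close>.
\<close>

fun walk_mean :: "real set \<Rightarrow> (nat \<Rightarrow> real \<Rightarrow> real) \<Rightarrow> nat \<Rightarrow> nat \<Rightarrow> (real \<Rightarrow> real) \<Rightarrow> real \<Rightarrow> real" where
  "walk_mean V p s 0 \<phi> x = \<phi> x"
| "walk_mean V p s (Suc n) \<phi> x = (\<Sum>v\<in>V. p s v * walk_mean V p (Suc s) n \<phi> (x + v))"

fun exitp :: "real set \<Rightarrow> (nat \<Rightarrow> real \<Rightarrow> real) \<Rightarrow> (nat \<Rightarrow> real) \<Rightarrow> real \<Rightarrow> nat \<Rightarrow> nat \<Rightarrow> real \<Rightarrow> real" where
  "exitp V p b a s 0 x = of_bool (\<bar>x\<bar> > a)"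
| "exitp V p b a s (Suc n) x =
     (if \<bar>x\<bar> > a then 1 else \<Sum>v\<in>V. p s v * exitp V p b a (Suc s) n (x + v - b s))"

definition trunc :: "real \<Rightarrow> real \<Rightarrow> real" where
  "trunc c y = (if \<bar>y\<bar> \<le> c then y else 0)"

definition trunc_mgf :: "real set \<Rightarrow> (nat \<Rightarrow> real \<Rightarrow> real) \<Rightarrow> (nat \<Rightarrow> real) \<Rightarrow> real \<Rightarrow> real \<Rightarrow> nat \<Rightarrow> real" where
  "trunc_mgf V p b a \<theta> i = (\<Sum>v\<in>V. p i v * exp (\<theta> * trunc (2 * a) (v - b i)))"

definition jump :: "real set \<Rightarrow> (nat \<Rightarrow> real \<Rightarrow> real) \<Rightarrow> (nat \<Rightarrow> real) \<Rightarrow> real \<Rightarrow> nat \<Rightarrow> real" where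
  "jump V p b a i = (\<Sum>v\<in>V. p i v * of_bool (\<bar>v - b i\<bar> > 2 * a))"

fun sums_of :: "real set \<Rightarrow> nat \<Rightarrow> real set" where
  "sums_of V 0 = {0}"
| "sums_of V (Suc n) = (\<lambda>(v, u). v + u) ` (V \<times> sums_of V n)"

text \<open>The least attainable value at which the distribution function reaches one half. The
  minimum runs over all of \<open>sums_of V n\<close>, a set that does not depend on
  \<open>p\<close>, with the largest sum as default for unsuitable \<open>d\<close>; measurability
  in \<open>p\<close> thus reduces to finitely many two-valued functions.\<close>

definition med :: "real set \<Rightarrow> (nat \<Rightarrow> real \<Rightarrow> real) \<Rightarrow> nat \<Rightarrow> real" where
  "med V p n = Min ((\<lambda>d. if 1 / 2 \<le> walk_mean V p 0 n (\<lambda>z. of_bool (z \<le> d)) 0 then d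
                         else Max (sums_of V n)) ` sums_of V n)"

lemma finite_sums_of: "finite V \<Longrightarrow> finite (sums_of V n)"
  by (induction n) auto

section \<open>Averages over the steps of a walk\<close>

locale weights =
  fixes V :: "real set" and p :: "nat \<Rightarrow> real \<Rightarrow> real"
  assumes finV: "finite V" and p_nn: "\<And>i v. v \<in> V \<Longrightarrow> 0 \<le> p i v" and p_sum: "\<And>i. (\<Sum>v\<in>V. p i v) = 1"
begin

lemma average_mono:
  assumes "\<And>v. v \<in> V \<Longrightarrow> h v \<le> k v"
  shows "(\<Sum>v\<in>V. p i v * h v) \<le> (\<Sum>v\<in>V. p i v * k v)"
  by (intro sum_mono mult_left_mono assms p_nn)

lemma average_const: "(\<Sum>v\<in>V. p i v * c) = c"
  by (simp add: p_sum flip: sum_distrib_right)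

lemma average_le:
  assumes "\<And>v. v \<in> V \<Longrightarrow> h v \<le> c" shows "(\<Sum>v\<in>V. p i v * h v) \<le> c"
  using average_mono[of h "\<lambda>_. c" i] assms by (simp add: average_const)

lemma average_ge:
  assumes "\<And>v. v \<in> V \<Longrightarrow> c \<le> h v" shows "c \<le> (\<Sum>v\<in>V. p i v * h v)"
  using average_mono[of "\<lambda>_. c" h i] assms by (simp add: average_const)

text \<open>Some weight is positive, so an average of values above \<open>c\<close> would exceed
  \<open>c\<close>. This selects a successor state that is no worse than average.\<close>

lemma average_attained:
  assumes "(\<Sum>v\<in>V. p i v * h v) \<le> c"
  obtains v where "v \<in> V" "h v \<le> c"
proof -
  have "\<exists>v\<in>V. h v \<le> c"
  proof (rule ccontr)
    assume "\<not> (\<exists>v\<in>V. h v \<le> c)"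
    then have gt: "h v > c" if "v \<in> V" for v using that by (auto simp: not_le)
    have "0 < (\<Sum>v\<in>V. p i v * (h v - c))"
    proof -
      have "\<exists>v\<in>V. p i v \<noteq> 0"
      proof (rule ccontr)
        assume "\<not> (\<exists>v\<in>V. p i v \<noteq> 0)"
        then have "(\<Sum>v\<in>V. p i v) = 0" by (intro sum.neutral) auto
        then show False using p_sum[of i] by simp
      qed
      then obtain v where v: "v \<in> V" "p i v > 0" using p_nn[of _ i] by (auto simp: order_less_le)
      have "0 < p i v * (h v - c)" using v gt by simp
      also have "\<dots> \<le> (\<Sum>v\<in>V. p i v * (h v - c))"
      proof (rule member_le_sum[OF v(1) _ finV])
        fix u assume "u \<in> V - {v}"
        then show "0 \<le> p i u * (h u - c)" using gt[of u] p_nn[of u i] by simp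
      qed
      finally show ?thesis .
    qed
    then show False using assms average_const[of i c]
      by (simp add: right_diff_distrib sum_subtractf)
  qed
  then show thesis using that by blast
qed

text \<open>Coupling: both walks make the same steps, and the displacement after \<open>n\<close>
  steps lies in \<open>sums_of V n\<close>, so the test functions need to be compared only
  there.\<close>

lemma walk_mean_mono_shift:
  assumes "\<And>z. z \<in> sums_of V n \<Longrightarrow> \<phi> (x + z) \<le> \<psi> (y + z)"
  shows "walk_mean V p s n \<phi> x \<le> walk_mean V p s n \<psi> y"
  using assms
proof (induction n arbitrary: s x y)
  case (Suc n)
  have "walk_mean V p (Suc s) n \<phi> (x + v) \<le> walk_mean V p (Suc s) n \<psi> (y + v)" if "v \<in> V" for v
  proof (rule Suc.IH)
    fix z assume z: "z \<in> sums_of V n"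
    have "v + z \<in> sums_of V (Suc n)"
      unfolding sums_of.simps using that z by (intro image_eqI[of _ _ "(v, z)"]) simp_all
    from Suc.prems[OF this] show "\<phi> (x + v + z) \<le> \<psi> (y + v + z)" by (simp add: add.assoc)
  qed
  then show ?case unfolding walk_mean.simps by (rule average_mono)
qed simp

lemma walk_mean_mono: "(\<And>z. \<phi> z \<le> \<psi> z) \<Longrightarrow> walk_mean V p s n \<phi> x \<le> walk_mean V p s n \<psi> x"
  by (rule walk_mean_mono_shift) simp

lemma walk_mean_const: "walk_mean V p s n (\<lambda>_. c) x = c"
  by (induction n arbitrary: s x) (simp_all add: average_const)

lemma walk_mean_linear: "walk_mean V p s n (\<lambda>z. c * \<phi> z + d * \<psi> z) x = c * walk_mean V p s n \<phi> x + d * walk_mean V p s n \<psi> x"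
proof (induction n arbitrary: s x)
  case (Suc n)
  show ?case unfolding walk_mean.simps Suc.IH
    by (simp only: distrib_left sum.distrib sum_distrib_left mult.left_commute)
qed simp

lemma walk_mean_cmult: "walk_mean V p s n (\<lambda>z. c * \<phi> z) x = c * walk_mean V p s n \<phi> x"
  using walk_mean_linear[of s n c \<phi> 0 \<phi> x] by simp

lemma walk_mean_compl:
  "walk_mean V p s n (\<lambda>z. of_bool (\<not> P z)) x = 1 - walk_mean V p s n (\<lambda>z. of_bool (P z)) x"
proof -
  have "walk_mean V p s n (\<lambda>z. of_bool (\<not> P z)) x = walk_mean V p s n (\<lambda>z. 1 * 1 + (-1) * of_bool (P z)) x"
    by (rule arg_cong[where f = "\<lambda>\<phi>. walk_mean V p s n \<phi> x"]) (simp add: fun_eq_iff)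
  also have "\<dots> = 1 - walk_mean V p s n (\<lambda>z. of_bool (P z)) x"
    unfolding walk_mean_linear walk_mean_const by simp
  finally show ?thesis .
qed

text \<open>Chapman-Kolmogorov: run the walk for \<open>m\<close> steps and restart it from where it
  stands.\<close>

lemma walk_mean_append: "walk_mean V p s (m + n) \<phi> x = walk_mean V p s m (walk_mean V p (s + m) n \<phi>) x"
  by (induction m arbitrary: s x) simp_all

lemma V_nonempty: "V \<noteq> {}"
  using p_sum[of 0] by auto

lemma sums_of_nonempty: "sums_of V n \<noteq> {}"
  using V_nonempty by (induction n) auto

section \<open>Medians of the walk\<close>

lemma med_lower: "1 / 2 \<le> walk_mean V p 0 n (\<lambda>z. of_bool (z \<le> med V p n)) 0"
proof -
  let ?f = "\<lambda>d. if 1 / 2 \<le> walk_mean V p 0 n (\<lambda>z. of_bool (z \<le> d)) 0 then d else Max (sums_of V n)"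
  have max: "1 / 2 \<le> walk_mean V p 0 n (\<lambda>z. of_bool (z \<le> Max (sums_of V n))) 0"
  proof -
    have "walk_mean V p 0 n (\<lambda>z. 1 / 2) 0 \<le> walk_mean V p 0 n (\<lambda>z. of_bool (z \<le> Max (sums_of V n))) 0"
      using finite_sums_of[OF finV] by (intro walk_mean_mono_shift) auto
    then show ?thesis by (simp add: walk_mean_const)
  qed
  have "med V p n \<in> ?f ` sums_of V n"
    unfolding med_def by (rule Min_in) (simp_all only: finite_imageI finite_sums_of[OF finV] image_is_empty sums_of_nonempty not_False_eq_True)
  then show ?thesis using max by (auto split: if_splits)
qed

text \<open>Consider the largest attainable sum below the median. If the distribution function
  reached one half there, the minimum defining the median would be at most that sum. Hence at most
  half of the mass lies strictly below the median.\<close>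

lemma med_upper: "1 / 2 \<le> walk_mean V p 0 n (\<lambda>z. of_bool (med V p n \<le> z)) 0"
proof -
  let ?f = "\<lambda>d. if 1 / 2 \<le> walk_mean V p 0 n (\<lambda>z. of_bool (z \<le> d)) 0 then d else Max (sums_of V n)"
  let ?d = "med V p n"
  let ?L = "{u \<in> sums_of V n. u < ?d}"
  have "walk_mean V p 0 n (\<lambda>z. of_bool (\<not> ?d \<le> z)) 0 \<le> 1 / 2"
  proof (cases "?L = {}")
    case True
    have "walk_mean V p 0 n (\<lambda>z. of_bool (\<not> ?d \<le> z)) 0 \<le> walk_mean V p 0 n (\<lambda>z. 1 / 2) 0"
      using True by (intro walk_mean_mono_shift) auto
    then show ?thesis by (simp add: walk_mean_const)
  next
    case False
    let ?e = "Max ?L"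
    have fin: "finite ?L" using finite_sums_of[OF finV] by simp
    have e: "?e \<in> ?L" using Max_in[OF fin False] .
    have "\<not> 1 / 2 \<le> walk_mean V p 0 n (\<lambda>z. of_bool (z \<le> ?e)) 0"
    proof
      assume A: "1 / 2 \<le> walk_mean V p 0 n (\<lambda>z. of_bool (z \<le> ?e)) 0"
      have "?e \<in> sums_of V n" using e by blast
      then have "Min (?f ` sums_of V n) \<le> ?f ?e"
        by (intro Min_le finite_imageI imageI finite_sums_of[OF finV])
      then have "?d \<le> ?f ?e" unfolding med_def .
      then show False using A e by simp
    qed
    moreover have "walk_mean V p 0 n (\<lambda>z. of_bool (\<not> ?d \<le> z)) 0 \<le> walk_mean V p 0 n (\<lambda>z. of_bool (z \<le> ?e)) 0"
    proof (rule walk_mean_mono_shift)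
      fix z assume z: "z \<in> sums_of V n"
      show "of_bool (\<not> ?d \<le> 0 + z) \<le> (of_bool (0 + z \<le> ?e) :: real)"
        using Max_ge[OF fin, of z] z by auto
    qed
    ultimately show ?thesis by simp
  qed
  then show ?thesis by (simp only: walk_mean_compl)
qed

lemma tail_of_median:
  assumes "t < \<bar>med V p n\<bar>"
  shows "1 / 2 \<le> walk_mean V p 0 n (\<lambda>z. of_bool (t < \<bar>z\<bar>)) 0"
proof (cases "0 \<le> med V p n")
  case True
  have "walk_mean V p 0 n (\<lambda>z. of_bool (med V p n \<le> z)) 0 \<le> walk_mean V p 0 n (\<lambda>z. of_bool (t < \<bar>z\<bar>)) 0"
    using True assms by (intro walk_mean_mono) (auto simp: of_bool_def)
  then show ?thesis using med_upper[of n] by linarith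
next
  case False
  have "walk_mean V p 0 n (\<lambda>z. of_bool (z \<le> med V p n)) 0 \<le> walk_mean V p 0 n (\<lambda>z. of_bool (t < \<bar>z\<bar>)) 0"
    using False assms by (intro walk_mean_mono) (auto simp: of_bool_def)
  then show ?thesis using med_lower[of n] by linarith
qed

text \<open>If the median is at most \<open>t\<close> in absolute value, recentring moves the walk
  by at most \<open>t\<close>. Otherwise half of the mass lies beyond \<open>t\<close>, and the
  right side is at least one.\<close>

lemma tail_recentre:
  assumes "0 \<le> t"
  shows "walk_mean V p 0 n (\<lambda>z. of_bool (2 * t < \<bar>z - med V p n\<bar>)) 0 \<le> 2 * walk_mean V p 0 n (\<lambda>z. of_bool (t < \<bar>z\<bar>)) 0"
proof (cases "t < \<bar>med V p n\<bar>")
  case True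
  have "walk_mean V p 0 n (\<lambda>z. of_bool (2 * t < \<bar>z - med V p n\<bar>)) 0 \<le> walk_mean V p 0 n (\<lambda>z. 1) 0"
    by (intro walk_mean_mono) auto
  then show ?thesis using tail_of_median[OF True] by (simp add: walk_mean_const)
next
  case False
  have "walk_mean V p 0 n (\<lambda>z. of_bool (2 * t < \<bar>z - med V p n\<bar>)) 0 \<le> walk_mean V p 0 n (\<lambda>z. of_bool (t < \<bar>z\<bar>)) 0"
    using False by (intro walk_mean_mono) (auto simp: of_bool_def)
  moreover have "walk_mean V p 0 n (\<lambda>z. 0) 0 \<le> walk_mean V p 0 n (\<lambda>z. of_bool (t < \<bar>z\<bar>)) 0"
    by (intro walk_mean_mono) auto
  ultimately show ?thesis by (simp add: walk_mean_const)
qed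

text \<open>With probability at least one half, the position \<open>y\<close> at time
  \<open>k\<close> is on the side of its median where \<open>\<sigma> * y\<close> is not larger. A
  remainder that takes the median more than \<open>t\<close> below the final median, seen in
  direction \<sigma>, takes such a \<open>y\<close> there as well. So half of the probability of
  these remainders is part of a tail of at most 1/4.\<close>

lemma remainder_tail:
  fixes \<sigma> :: real
  assumes sgn: "\<sigma> = 1 \<or> \<sigma> = -1"
    and tail: "walk_mean V p 0 (k + n) (\<lambda>z. of_bool (t < \<bar>z - med V p (k + n)\<bar>)) 0 \<le> 1 / 4"
  shows "1 / 2 \<le> walk_mean V p k n (\<lambda>z. of_bool (- t \<le> \<sigma> * (z - med V p (k + n)))) (med V p k)"
proof -
  let ?N = "med V p (k + n)" and ?D = "med V p k"
  let ?q = "walk_mean V p k n (\<lambda>z. of_bool (\<not> - t \<le> \<sigma> * (z - ?N))) ?D"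
  have q0: "0 \<le> ?q"
  proof -
    have "walk_mean V p k n (\<lambda>z. 0) ?D \<le> ?q" by (intro walk_mean_mono) auto
    then show ?thesis by (simp add: walk_mean_const)
  qed
  have half: "1 / 2 \<le> walk_mean V p 0 k (\<lambda>y. of_bool (\<sigma> * y \<le> \<sigma> * ?D)) 0"
    using sgn med_lower[of k] med_upper[of k] by auto
  have "1 / 2 * ?q \<le> ?q * walk_mean V p 0 k (\<lambda>y. of_bool (\<sigma> * y \<le> \<sigma> * ?D)) 0"
    using mult_left_mono[OF half q0] by (simp add: mult.commute)
  also have "\<dots> = walk_mean V p 0 k (\<lambda>y. ?q * of_bool (\<sigma> * y \<le> \<sigma> * ?D)) 0"
    by (simp only: walk_mean_cmult)
  also have "\<dots> \<le> walk_mean V p 0 k (walk_mean V p (0 + k) n (\<lambda>z. of_bool (t < \<bar>z - ?N\<bar>))) 0"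
  proof (rule walk_mean_mono)
    fix y
    have nn: "0 \<le> walk_mean V p k n (\<lambda>z. of_bool (t < \<bar>z - ?N\<bar>)) y"
    proof -
      have "walk_mean V p k n (\<lambda>z. 0) y \<le> walk_mean V p k n (\<lambda>z. of_bool (t < \<bar>z - ?N\<bar>)) y" by (intro walk_mean_mono) auto
      then show ?thesis by (simp add: walk_mean_const)
    qed
    have "?q \<le> walk_mean V p k n (\<lambda>z. of_bool (t < \<bar>z - ?N\<bar>)) y" if "\<sigma> * y \<le> \<sigma> * ?D"
    proof (rule walk_mean_mono_shift)
      fix z
      have "t < \<bar>y + z - ?N\<bar>" if "\<not> - t \<le> \<sigma> * (?D + z - ?N)"
        using sgn that \<open>\<sigma> * y \<le> \<sigma> * ?D\<close> by (auto simp: algebra_simps)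
      then show "of_bool (\<not> - t \<le> \<sigma> * (?D + z - ?N)) \<le> (of_bool (t < \<bar>y + z - ?N\<bar>) :: real)"
        by auto
    qed
    then show "?q * of_bool (\<sigma> * y \<le> \<sigma> * ?D) \<le> walk_mean V p (0 + k) n (\<lambda>z. of_bool (t < \<bar>z - ?N\<bar>)) y"
      using nn by auto
  qed
  also have "\<dots> = walk_mean V p 0 (k + n) (\<lambda>z. of_bool (t < \<bar>z - ?N\<bar>)) 0"
    by (simp only: walk_mean_append)
  also have "\<dots> \<le> 1 / 4" by (rule tail)
  finally have "?q \<le> 1 / 2" by simp
  then show ?thesis by (simp only: walk_mean_compl)
qed

section \<open>Exit probabilities, the maximal inequality and large steps\<close>

lemma exitp_le_1: "exitp V p b a s n x \<le> 1"
  by (induction n arbitrary: s x) (auto intro: average_le)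

lemma exitp_nn: "0 \<le> exitp V p b a s n x"
  by (induction n arbitrary: s x) (auto intro: average_ge)

lemma exitp_out: "\<bar>x\<bar> > a \<Longrightarrow> exitp V p b a s n x = 1"
  by (cases n) auto

lemma exitp_mono_Suc: "exitp V p b a s n x \<le> exitp V p b a s (Suc n) x"
proof (induction n arbitrary: s x)
  case 0 show ?case using average_ge[of 0 "\<lambda>v. of_bool (a < \<bar>x + v - b s\<bar>)" s] by auto
next
  case (Suc n)
  have "(\<Sum>v\<in>V. p s v * exitp V p b a (Suc s) n (x + v - b s))
      \<le> (\<Sum>v\<in>V. p s v * exitp V p b a (Suc s) (Suc n) (x + v - b s))"
    by (rule average_mono) (rule Suc.IH)
  then show ?case by (simp del: exitp.simps add: exitp.simps(2)[of _ _ _ _ s])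
qed

lemma exitp_mono: "m \<le> n \<Longrightarrow> exitp V p b a s m x \<le> exitp V p b a s n x"
  by (rule lift_Suc_mono_le[of "\<lambda>n. exitp V p b a s n x"]) (rule exitp_mono_Suc)

text \<open>A Levy-type maximal inequality: once the recentred walk has left \<open>[-2t, 2t]\<close>, it ends
  outside \<open>[-t, t]\<close> with conditional probability at least one half.\<close>

lemma exit_le_tail_aux:
  assumes "walk_mean V p 0 N (\<lambda>z. of_bool (t < \<bar>z - med V p N\<bar>)) 0 \<le> 1 / 4" "k + n = N"
  shows "exitp V p (\<lambda>i. med V p (Suc i) - med V p i) (2 * t) k n x
      \<le> 2 * walk_mean V p k n (\<lambda>z. of_bool (t < \<bar>z - med V p N\<bar>)) (x + med V p k)"
  using assms(2)
proof (induction n arbitrary: k x)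
  case 0 
  show ?case using 0 exitp_out[of "2*t"] by (auto simp: of_bool_def)
next
  case (Suc n)
  let ?E = "\<lambda>z. of_bool (t < \<bar>z - med V p N\<bar>) :: real"
  show ?case
  proof (cases "\<bar>x\<bar> > 2 * t")
    case True
    define \<sigma> :: real where "\<sigma> = (if x > 0 then 1 else -1)"
    have "1 / 2 \<le> walk_mean V p k (Suc n) (\<lambda>z. of_bool (- t \<le> \<sigma> * (z - med V p N))) (med V p k)"
      using remainder_tail[of \<sigma> k "Suc n" t] assms(1) Suc.prems by (simp only: \<sigma>_def) auto
    also have "\<dots> \<le> walk_mean V p k (Suc n) ?E (x + med V p k)"
    proof (rule walk_mean_mono_shift)
      fix z
      have "t < \<bar>x + med V p k + z - med V p N\<bar>" if "- t \<le> \<sigma> * (med V p k + z - med V p N)"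
        using True that by (auto simp: \<sigma>_def split: if_splits)
      then show "of_bool (- t \<le> \<sigma> * (med V p k + z - med V p N)) \<le> ?E (x + med V p k + z)" by auto
    qed
    finally show ?thesis using exitp_le_1[of "\<lambda>i. med V p (Suc i) - med V p i" "2 * t" k "Suc n" x] by linarith
  next
    case False
    have "exitp V p (\<lambda>i. med V p (Suc i) - med V p i) (2 * t) (Suc k) n (x + v - (med V p (Suc k) - med V p k))
        \<le> 2 * walk_mean V p (Suc k) n ?E (x + med V p k + v)" for v
      using Suc.IH[of "Suc k" "x + v - (med V p (Suc k) - med V p k)"] Suc.prems
      by (simp add: algebra_simps)
    then have "exitp V p (\<lambda>i. med V p (Suc i) - med V p i) (2 * t) k (Suc n) x
        \<le> (\<Sum>v\<in>V. p k v * (2 * walk_mean V p (Suc k) n ?E (x + med V p k + v)))"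
      using False by (auto intro!: average_mono)
    then show ?thesis by (simp add: sum_distrib_left mult_ac)
  qed
qed

lemma med_0 [simp]: "med V p 0 = 0"
  by (simp add: med_def)

text \<open>The level is doubled once by the maximal inequality and once by recentring at the final
  median. The former needs a recentred tail of at most 1/4 and then costs a factor 2; for larger
  tails a factor 4 makes the bound trivial. Recentring costs another 2, which gives 8.\<close>

lemma exit_le_tail:
  assumes "0 \<le> t"
  shows "exitp V p (\<lambda>i. med V p (Suc i) - med V p i) (4 * t) 0 N 0
      \<le> 8 * walk_mean V p 0 N (\<lambda>z. of_bool (t < \<bar>z\<bar>)) 0"
proof -
  let ?P = "walk_mean V p 0 N (\<lambda>z. of_bool (2 * t < \<bar>z - med V p N\<bar>)) 0"
  have "exitp V p (\<lambda>i. med V p (Suc i) - med V p i) (4 * t) 0 N 0 \<le> 4 * ?P"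
  proof (cases "?P \<le> 1 / 4")
    case True
    have "0 \<le> ?P" using walk_mean_mono[of "\<lambda>_. 0" "\<lambda>z. of_bool (2 * t < \<bar>z - med V p N\<bar>)" 0 N 0] 
      by (simp add: walk_mean_const)
    then show ?thesis using exit_le_tail_aux[OF True, of 0 N 0] by simp
  next
    case False
    then show ?thesis using exitp_le_1[of "\<lambda>i. med V p (Suc i) - med V p i" "4 * t" 0 N 0] by linarith
  qed
  then show ?thesis using tail_recentre[OF assms, of N] by linarith
qed

text \<open>A step larger than \<open>2a\<close> leaves \<open>[-a, a]\<close>, so the exit probability \<open>e\<close> and the sum \<open>s\<close> of the
  jump probabilities satisfy \<open>1 - e \<le> \<Prod>(1 - jump) \<le> 1 / (1 + s)\<close>.\<close>

lemma exitp_ge_jumps: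
  assumes "\<bar>x\<bar> \<le> a"
  shows "(\<Sum>i\<in>{s..<s+n}. jump V p b a i) \<le> exitp V p b a s n x * (1 + (\<Sum>i\<in>{s..<s+n}. jump V p b a i))"
  using assms
proof (induction n arbitrary: s x)
  case (Suc n)
  have jnn: "0 \<le> jump V p b a i" for i unfolding jump_def by (intro sum_nonneg) (simp add: p_nn)
  define J where "J = jump V p b a s"
  define R where "R = (\<Sum>i\<in>{Suc s..<Suc s+n}. jump V p b a i)"
  have R0: "0 \<le> R" unfolding R_def by (intro sum_nonneg jnn)
  have J0: "0 \<le> J" by (simp add: J_def jnn)
  have sum: "(\<Sum>i\<in>{s..<s+Suc n}. jump V p b a i) = J + R"
    unfolding J_def R_def by (subst sum.atLeast_Suc_lessThan) auto
  have "R + J = (\<Sum>v\<in>V. p s v * (R + of_bool (\<bar>v - b s\<bar> > 2 * a)))"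
    unfolding J_def jump_def by (simp add: distrib_left sum.distrib average_const)
  also have "\<dots> \<le> (\<Sum>v\<in>V. p s v * (exitp V p b a (Suc s) n (x + v - b s) * (1 + R)))"
  proof (rule average_mono)
    fix v
    show "R + of_bool (\<bar>v - b s\<bar> > 2 * a) \<le> exitp V p b a (Suc s) n (x + v - b s) * (1 + R)"
    proof (cases "\<bar>x + v - b s\<bar> > a")
      case True
      then show ?thesis by (auto simp: exitp_out R0)
    next
      case False
      then have "R \<le> exitp V p b a (Suc s) n (x + v - b s) * (1 + R)"
        using Suc.IH[of "x + v - b s" "Suc s"] by (simp only: R_def)
      then show ?thesis using False Suc.prems by auto
    qed
  qed
  also have "\<dots> = exitp V p b a s (Suc n) x * (1 + R)"
    using Suc.prems by (simp add: sum_distrib_right mult.assoc)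
  also have "\<dots> \<le> exitp V p b a s (Suc n) x * (1 + (J + R))"
    using exitp_nn[of b a s "Suc n" x] J0 by (intro mult_left_mono) linarith+
  finally show ?case unfolding sum by simp
qed auto

text \<open>In \<open>s \<le> e * (1 + s)\<close> with \<open>e \<le> 1 / 2\<close> the term
  \<open>e * s\<close> is absorbed by half of \<open>s\<close>.\<close>

lemma jumps_le_exitp:
  assumes "0 \<le> a" "exitp V p b a 0 n 0 \<le> 1 / 2"
  shows "(\<Sum>i<n. jump V p b a i) \<le> 2 * exitp V p b a 0 n 0"
proof -
  define s where "s = (\<Sum>i<n. jump V p b a i)"
  have s0: "0 \<le> s" unfolding s_def jump_def by (intro sum_nonneg) (simp add: p_nn)
  have "s \<le> exitp V p b a 0 n 0 * (1 + s)"
    using exitp_ge_jumps[where x = 0 and s = 0 and n = n and a = a and b = b] assms(1) by (simp add: s_def atLeast0LessThan)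
  moreover have "exitp V p b a 0 n 0 * s \<le> 1 / 2 * s"
    using assms(2) s0 by (intro mult_right_mono)
  ultimately show ?thesis unfolding s_def[symmetric] by (simp add: distrib_left)
qed

text \<open>Inside the interval the exit probability of a state is the average of those of its
  successors, so some successor does not increase it. That successor is again inside, because
  outside the exit probability is 1, which exceeds \<epsilon>. This supplies a starting state for
  every window ending at \<open>r\<close>.\<close>

lemma exists_state_low_exit:
  assumes "0 \<le> a" "exitp V p b a 0 r 0 \<le> \<epsilon>" "\<epsilon> < 1" "s \<le> r"
  shows "\<exists>x. \<bar>x\<bar> \<le> a \<and> exitp V p b a s (r - s) x \<le> \<epsilon>"
  using assms(4)
proof (induction s)
  case 0 then show ?case using assms by (intro exI[of _ 0]) simp
next
  case (Suc s)
  then obtain x where x: "\<bar>x\<bar> \<le> a" "exitp V p b a s (r - s) x \<le> \<epsilon>" by auto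
  have "r - s = Suc (r - Suc s)" using Suc.prems by simp
  then have "(\<Sum>v\<in>V. p s v * exitp V p b a (Suc s) (r - Suc s) (x + v - b s)) \<le> \<epsilon>"
    using x by simp
  then obtain v where "exitp V p b a (Suc s) (r - Suc s) (x + v - b s) \<le> \<epsilon>"
    by (rule average_attained)
  moreover from this have "\<bar>x + v - b s\<bar> \<le> a"
    using exitp_out[of a "x + v - b s" b "Suc s" "r - Suc s"] assms(3) by (cases "a < \<bar>x + v - b s\<bar>") auto
  ultimately show ?case by blast
qed

section \<open>Moment generating functions over time windows\<close>

lemma trunc_mgf_pos: "0 < trunc_mgf V p b a \<theta> i"
proof -
  have "exp (- \<bar>\<theta>\<bar> * \<bar>2 * a\<bar>) \<le> trunc_mgf V p b a \<theta> i"
    unfolding trunc_mgf_def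
  proof (rule average_ge)
    fix v
    have "\<bar>\<theta> * trunc (2 * a) (v - b i)\<bar> \<le> \<bar>\<theta>\<bar> * \<bar>2 * a\<bar>"
      unfolding abs_mult by (intro mult_left_mono) (auto simp: trunc_def)
    then show "exp (- \<bar>\<theta>\<bar> * \<bar>2 * a\<bar>) \<le> exp (\<theta> * trunc (2 * a) (v - b i))" by (simp add: abs_le_iff)
  qed
  then show ?thesis by (rule less_le_trans[OF exp_gt_zero])
qed

text \<open>Before the exit the walk has moved by at most \<open>2a\<close>, and the exit step adds at most \<open>2a\<close> after truncation;
  from the exit on, only the uniform bound \<open>K\<close> for the remaining product is used.\<close>

lemma trunc_mgf_window_aux:
  assumes a: "0 \<le> a" "\<bar>\<theta>\<bar> * a = k" and K: "\<And>j. j \<le> r \<Longrightarrow> (\<Prod>i\<in>{j..<r}. trunc_mgf V p b a \<theta> i) \<le> K"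
    and x: "\<bar>x0\<bar> \<le> a" "\<bar>x\<bar> \<le> a" and j: "j + n = r"
  shows "exp (\<theta> * (x - x0)) * (\<Prod>i\<in>{j..<r}. trunc_mgf V p b a \<theta> i)
     \<le> exp (2 * k) + exp (4 * k) * K * exitp V p b a j n x"
  using x j
proof (induction n arbitrary: j x)
  have *: "\<theta> * z \<le> m * k" if "\<bar>z\<bar> \<le> m * a" for z m :: real
  proof -
    have "\<theta> * z \<le> \<bar>\<theta>\<bar> * \<bar>z\<bar>" by (metis abs_ge_self abs_mult)
    also have "\<dots> \<le> \<bar>\<theta>\<bar> * (m * a)" using that by (intro mult_left_mono) auto
    also have "\<dots> = m * (\<bar>\<theta>\<bar> * a)" by simp
    finally show ?thesis using a by simp
  qed
  have K0: "0 \<le> K" using K[of r] by simp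
  {
    case 0
    then show ?case using *[of "x - x0" 2] K0 by (auto intro!: add_increasing2)
  next
    case (Suc n)
    let ?R = "\<Prod>i\<in>{Suc j..<r}. trunc_mgf V p b a \<theta> i"
    have R0: "0 \<le> ?R" by (intro prod_nonneg) (simp add: trunc_mgf_pos less_imp_le)
    have "(\<Prod>i\<in>{j..<r}. trunc_mgf V p b a \<theta> i) = trunc_mgf V p b a \<theta> j * ?R"
      using Suc.prems by (subst prod.atLeast_Suc_lessThan) auto
    moreover have "exp (\<theta> * (x + y - x0)) = exp (\<theta> * (x - x0)) * exp (\<theta> * y)" for y
      by (simp add: algebra_simps flip: exp_add)
    ultimately have "exp (\<theta> * (x - x0)) * (\<Prod>i\<in>{j..<r}. trunc_mgf V p b a \<theta> i)
      = (\<Sum>v\<in>V. p j v * (exp (\<theta> * (x + trunc (2 * a) (v - b j) - x0)) * ?R))"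
      by (simp add: trunc_mgf_def sum_distrib_left sum_distrib_right mult.assoc mult.left_commute)
    also have "\<dots> \<le> (\<Sum>v\<in>V. p j v * (exp (2 * k) + exp (4 * k) * K * exitp V p b a (Suc j) n (x + v - b j)))"
    proof (rule average_mono)
      fix v
      show "exp (\<theta> * (x + trunc (2 * a) (v - b j) - x0)) * ?R
        \<le> exp (2 * k) + exp (4 * k) * K * exitp V p b a (Suc j) n (x + v - b j)"
      proof (cases "\<bar>x + v - b j\<bar> \<le> a")
        case True
        then have "x + trunc (2 * a) (v - b j) - x0 = x + v - b j - x0"
          using Suc.prems by (auto simp: trunc_def)
        then show ?thesis using Suc.IH[OF Suc.prems(1) True, of "Suc j"] Suc.prems
          by (simp only:)
      next
        case False
        have "\<bar>x + trunc (2 * a) (v - b j) - x0\<bar> \<le> 4 * a"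
          using Suc.prems a by (auto simp: trunc_def)
        then have "exp (\<theta> * (x + trunc (2 * a) (v - b j) - x0)) * ?R \<le> exp (4 * k) * K"
          using * K[of "Suc j"] Suc.prems R0 by (intro mult_mono) auto
        then show ?thesis using False by (simp add: exitp_out add_increasing)
      qed
    qed
    also have "\<dots> = exp (2 * k) + exp (4 * k) * K * exitp V p b a j (Suc n) x"
      using Suc.prems by (simp add: distrib_left sum.distrib average_const sum_distrib_left mult_ac)
    finally show ?case .
  }
qed

text \<open>Let \<open>K\<close> be the largest product over windows ending at \<open>r\<close>; it
  exists because there are finitely many. Started from a state of low exit probability, each product
  is at most \<open>exp (2 * k) + K / 2\<close>. For the window that attains \<open>K\<close>, the
  term \<open>K / 2\<close> is absorbed.\<close>

lemma trunc_mgf_window: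
  assumes a: "0 \<le> a" "\<bar>\<theta>\<bar> * a = k" and e: "exitp V p b a 0 r 0 \<le> \<epsilon>" "\<epsilon> < 1" "exp (4 * k) * \<epsilon> \<le> 1 / 2"
    and s: "s \<le> r"
  shows "(\<Prod>i\<in>{s..<r}. trunc_mgf V p b a \<theta> i) \<le> 2 * exp (2 * k)"
proof -
  let ?R = "\<lambda>j. \<Prod>i\<in>{j..<r}. trunc_mgf V p b a \<theta> i"
  define K where "K = Max (?R ` {..r})"
  have K: "?R j \<le> K" if "j \<le> r" for j unfolding K_def using that by (intro Max_ge) auto
  have K0: "0 \<le> K" using K[of r] by simp
  have "?R j \<le> exp (2 * k) + 1 / 2 * K" if j: "j \<le> r" for j
  proof -
    obtain x where x: "\<bar>x\<bar> \<le> a" "exitp V p b a j (r - j) x \<le> \<epsilon>"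
      using exists_state_low_exit[OF a(1) e(1,2) j] by blast
    \<comment> \<open>The choice \<open>x0 = x\<close> turns the exponential prefactor into
      1.\<close>
    have "?R j \<le> exp (2 * k) + exp (4 * k) * K * exitp V p b a j (r - j) x"
      using trunc_mgf_window_aux[OF a K x(1) x(1), of j "r - j"] j by simp
    also have "\<dots> \<le> exp (2 * k) + exp (4 * k) * K * \<epsilon>"
      using x K0 by (intro add_left_mono mult_left_mono) auto
    also have "\<dots> = exp (2 * k) + (exp (4 * k) * \<epsilon>) * K" by simp
    also have "\<dots> \<le> exp (2 * k) + 1 / 2 * K" using e K0 by (intro add_left_mono mult_right_mono) auto
    finally show ?thesis .
  qed
  moreover have "K \<in> ?R ` {..r}" unfolding K_def by (intro Max_in) auto
  ultimately have "K \<le> exp (2 * k) + 1 / 2 * K" by auto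
  then show ?thesis using K[OF s] by linarith
qed

end

section \<open>Predictable laws and the exponential martingale\<close>

lemma borel_measurable_walk_mean:
  assumes "finite V" "\<And>i v. s \<le> i \<Longrightarrow> i < s + n \<Longrightarrow> v \<in> V \<Longrightarrow> (\<lambda>w. p w i v) \<in> borel_measurable H"
  shows "(\<lambda>w. walk_mean V (p w) s n \<phi> x) \<in> borel_measurable H"
  using assms(2)
proof (induction n arbitrary: s x)
  case (Suc n)
  have "(\<lambda>w. walk_mean V (p w) (Suc s) n \<phi> (x + v)) \<in> borel_measurable H" for v
    by (rule Suc.IH) (auto intro: Suc.prems)
  moreover have "(\<lambda>w. p w s v) \<in> borel_measurable H" if "v \<in> V" for v
    using Suc.prems that by simp
  ultimately show ?case unfolding walk_mean.simps by (intro borel_measurable_sum borel_measurable_times)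
qed simp

lemma borel_measurable_exitp:
  assumes "finite V" "\<And>i v. s \<le> i \<Longrightarrow> i < s + n \<Longrightarrow> v \<in> V \<Longrightarrow> (\<lambda>w. p w i v) \<in> borel_measurable H"
    and "\<And>i. s \<le> i \<Longrightarrow> i < s + n \<Longrightarrow> (\<lambda>w. b w i) \<in> borel_measurable H"
    and "x \<in> borel_measurable H"
  shows "(\<lambda>w. exitp V (p w) (b w) a s n (x w)) \<in> borel_measurable H"
  using assms(2-)
proof (induction n arbitrary: s x)
  case 0
  note [measurable] = \<open>x \<in> borel_measurable H\<close>
  show ?case unfolding exitp.simps by measurable
next
  case (Suc n)
  note [measurable] = Suc.prems(3)
  have [measurable]: "(\<lambda>w. b w s) \<in> borel_measurable H" using Suc.prems(2) by simp
  have "(\<lambda>w. exitp V (p w) (b w) a (Suc s) n (x w + v - b w s)) \<in> borel_measurable H" for v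
    by (rule Suc.IH) (auto intro: Suc.prems(1,2))
  moreover have "(\<lambda>w. p w s v) \<in> borel_measurable H" if "v \<in> V" for v
    using Suc.prems(1) that by simp
  ultimately have [measurable]: "(\<lambda>w. \<Sum>v\<in>V. p w s v * exitp V (p w) (b w) a (Suc s) n (x w + v - b w s)) \<in> borel_measurable H"
    by (intro borel_measurable_sum borel_measurable_times)
  show ?case unfolding exitp.simps by measurable
qed

text \<open>Only the weights before time \<open>n\<close> enter. Therefore the increment of the
  median caused by step \<open>i\<close> is known as soon as the law of that step is, before the
  step is made.\<close>

lemma borel_measurable_med:
  assumes "finite V" "\<And>i v. i < n \<Longrightarrow> v \<in> V \<Longrightarrow> (\<lambda>w. p w i v) \<in> borel_measurable H"
  shows "(\<lambda>w. med V (p w) n) \<in> borel_measurable H"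
  unfolding med_def
proof (rule borel_measurable_Min[OF finite_sums_of[OF assms(1)]])
  fix d
  have [measurable]: "(\<lambda>w. walk_mean V (p w) 0 n (\<lambda>z. of_bool (z \<le> d)) 0) \<in> borel_measurable H"
    by (rule borel_measurable_walk_mean) (use assms in auto)
  show "(\<lambda>w. if 1 / 2 \<le> walk_mean V (p w) 0 n (\<lambda>z. of_bool (z \<le> d)) 0 then d else Max (sums_of V n))
      \<in> borel_measurable H" by measurable
qed

section \<open>Gated exponential factors along a path\<close>

context weights
begin

text \<open>\<open>S\<close> stands for the path of the centred sums; the gate depends only on what is known before step \<open>i\<close>.\<close>

definition gated_factor :: "(nat \<Rightarrow> real) \<Rightarrow> real \<Rightarrow> real \<Rightarrow> (nat \<Rightarrow> real) \<Rightarrow> real \<Rightarrow> nat \<Rightarrow> real \<Rightarrow> real" where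
  "gated_factor b a \<epsilon> S \<theta> i y =
     (if (\<exists>j\<le>i. \<bar>S j\<bar> > 2 * a) \<and> (\<forall>j\<le>i. \<bar>S j\<bar> \<le> 8 * a) \<and> exitp V p b a 0 (Suc i) 0 \<le> \<epsilon>
      then exp (\<theta> * trunc (2 * a) y) / trunc_mgf V p b a \<theta> i else 1)"

lemma gated_factor_nn: "0 \<le> gated_factor b a \<epsilon> S \<theta> i y"
  unfolding gated_factor_def by (simp add: trunc_mgf_pos less_imp_le)

text \<open>The gate does not look at the step, so the factor is either 1 for every step or an
  exponential divided by its own mean. This is the martingale property of a single step.\<close>

lemma gated_factor_average: "(\<Sum>v\<in>V. p i v * gated_factor b a \<epsilon> S \<theta> i (v - b i)) = 1"
proof (cases "(\<exists>j\<le>i. \<bar>S j\<bar> > 2 * a) \<and> (\<forall>j\<le>i. \<bar>S j\<bar> \<le> 8 * a) \<and> exitp V p b a 0 (Suc i) 0 \<le> \<epsilon>")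
  case True
  have "(\<Sum>v\<in>V. p i v * gated_factor b a \<epsilon> S \<theta> i (v - b i))
      = (\<Sum>v\<in>V. p i v * exp (\<theta> * trunc (2 * a) (v - b i))) / trunc_mgf V p b a \<theta> i"
    unfolding gated_factor_def using True by (simp add: sum_divide_distrib)
  also have "\<dots> = 1" using trunc_mgf_pos[of b a \<theta> i] by (simp add: trunc_mgf_def)
  finally show ?thesis .
next
  case False
  then show ?thesis unfolding gated_factor_def by (subst if_not_P) (simp_all add: p_sum)
qed

text \<open>The exit probability grows with time, so the times at which it is at most \<epsilon>
  form an initial segment. The large steps counted there are controlled by the exit probability at
  the end of that segment.\<close>

lemma gated_jumps_le:
  assumes "0 \<le> a" "\<epsilon> \<le> 1 / 2"
  shows "(\<Sum>i<n. of_bool (exitp V p b a 0 (Suc i) 0 \<le> \<epsilon>) * jump V p b a i) \<le> 2 * exitp V p b a 0 n 0"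
proof (induction n)
  case 0 then show ?case using exitp_nn[of b a 0 0 0] by simp
next
  case (Suc n)
  have jnn: "0 \<le> jump V p b a i" for i unfolding jump_def by (intro sum_nonneg) (simp add: p_nn)
  show ?case
  proof (cases "exitp V p b a 0 (Suc n) 0 \<le> \<epsilon>")
    case True
    have "(\<Sum>i<Suc n. of_bool (exitp V p b a 0 (Suc i) 0 \<le> \<epsilon>) * jump V p b a i) \<le> (\<Sum>i<Suc n. jump V p b a i)"
      using jnn by (intro sum_mono) (simp add: of_bool_def)
    also have "\<dots> \<le> 2 * exitp V p b a 0 (Suc n) 0"
      by (rule jumps_le_exitp) (use True assms in linarith)+
    finally show ?thesis .
  next
    case False
    then show ?thesis using Suc.IH exitp_mono_Suc[of b a 0 n 0]
      unfolding sum.lessThan_Suc by (simp del: exitp.simps)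
  qed
qed

text \<open>On a path without large jumps, the gate is open exactly between the first exit \<open>\<tau>\<close> from
  \<open>[-2a, 2a]\<close> and the first exit \<open>\<sigma>\<close> from \<open>[-8a, 8a]\<close>, so that the product telescopes.\<close>

lemma crossing_weight:
  assumes a: "0 < a" "0 \<le> k" and e: "exitp V p b a 0 N 0 \<le> \<epsilon>" "\<epsilon> < 1" "exp (4 * k) * \<epsilon> \<le> 1 / 2"
    and S: "S 0 = 0" "\<And>i. S (Suc i) = S i + y i" and y: "\<And>i. i < N \<Longrightarrow> \<bar>y i\<bar> \<le> 2 * a"
    and cross: "m \<le> N" "\<bar>S m\<bar> > 8 * a"
  shows "exp (2 * k) \<le> 2 * ((\<Prod>i<N. gated_factor b a \<epsilon> S (k / a) i (y i))
                         + (\<Prod>i<N. gated_factor b a \<epsilon> S (- (k / a)) i (y i)))"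
proof -
  define \<tau> where "\<tau> = (LEAST n. \<bar>S n\<bar> > 2 * a)"
  define \<sigma> where "\<sigma> = (LEAST n. \<bar>S n\<bar> > 8 * a)"
  have s: "\<bar>S \<sigma>\<bar> > 8 * a" unfolding \<sigma>_def by (rule LeastI[of _ m]) (rule cross)
  have sN: "\<sigma> \<le> N" using Least_le[of "\<lambda>n. \<bar>S n\<bar> > 8 * a" m] cross by (simp add: \<sigma>_def)
  have s_min: "\<bar>S j\<bar> \<le> 8 * a" if "j < \<sigma>" for j using not_less_Least[of j] that by (force simp: \<sigma>_def)
  have t: "\<bar>S \<tau>\<bar> > 2 * a" unfolding \<tau>_def by (rule LeastI[of _ \<sigma>]) (use s a in linarith)
  have ts: "\<tau> \<le> \<sigma>" unfolding \<tau>_def by (rule Least_le) (use s a in linarith)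
  have t_min: "\<bar>S j\<bar> \<le> 2 * a" if "j < \<tau>" for j using not_less_Least[of j] that by (force simp: \<tau>_def)
  have "\<tau> \<noteq> 0"
  proof
    assume "\<tau> = 0"
    then show False using t S(1) a by (simp only: abs_zero)
  qed
  then obtain t' where t': "\<tau> = Suc t'" by (cases \<tau>) auto
  \<comment> \<open>Just before \<tau> the path is within \<open>2 * a\<close>, and the next step is
    at most \<open>2 * a\<close>. As the path is beyond \<open>8 * a\<close> at \<sigma>, it travels
    at least \<open>4 * a\<close> in between.\<close>
  have St: "\<bar>S \<tau>\<bar> \<le> 4 * a" using S(2)[of t'] t_min[of t'] y[of t'] t' ts sN by auto
  have gate: "(\<exists>j\<le>i. \<bar>S j\<bar> > 2 * a) \<and> (\<forall>j\<le>i. \<bar>S j\<bar> \<le> 8 * a) \<and> exitp V p b a 0 (Suc i) 0 \<le> \<epsilon>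
      \<longleftrightarrow> \<tau> \<le> i \<and> i < \<sigma>" if "i < N" for i
  proof -
    have "exitp V p b a 0 (Suc i) 0 \<le> \<epsilon>"
      using exitp_mono[of "Suc i" N b a 0 0] e that by linarith
    moreover have "(\<exists>j\<le>i. \<bar>S j\<bar> > 2 * a) \<longleftrightarrow> \<tau> \<le> i"
    proof
      assume "\<exists>j\<le>i. \<bar>S j\<bar> > 2 * a"
      then obtain j where "j \<le> i" "\<bar>S j\<bar> > 2 * a" by blast
      then show "\<tau> \<le> i" using t_min[of j] by (cases "j < \<tau>") auto
    qed (use t in blast)
    moreover have "(\<forall>j\<le>i. \<bar>S j\<bar> \<le> 8 * a) \<longleftrightarrow> i < \<sigma>"
    proof
      assume "\<forall>j\<le>i. \<bar>S j\<bar> \<le> 8 * a"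
      then show "i < \<sigma>" using s by (cases "\<sigma> \<le> i") force+
    qed (auto intro: s_min)
    ultimately show ?thesis by blast
  qed
  have W: "(\<Prod>i<N. gated_factor b a \<epsilon> S \<theta> i (y i)) =
      exp (\<theta> * (S \<sigma> - S \<tau>)) / (\<Prod>i\<in>{\<tau>..<\<sigma>}. trunc_mgf V p b a \<theta> i)" for \<theta>
  proof -
    have "(\<Prod>i<N. gated_factor b a \<epsilon> S \<theta> i (y i)) = (\<Prod>i\<in>{\<tau>..<\<sigma>}. exp (\<theta> * y i) / trunc_mgf V p b a \<theta> i)"
    proof (rule prod.mono_neutral_cong_right)
      show "\<forall>i\<in>{..<N} - {\<tau>..<\<sigma>}. gated_factor b a \<epsilon> S \<theta> i (y i) = 1"
        unfolding gated_factor_def using gate by (auto simp del: exitp.simps)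
      show "gated_factor b a \<epsilon> S \<theta> i (y i) = exp (\<theta> * y i) / trunc_mgf V p b a \<theta> i" if "i \<in> {\<tau>..<\<sigma>}" for i
      proof -
        have "i < N" "\<tau> \<le> i \<and> i < \<sigma>" using that sN by auto
        then show ?thesis unfolding gated_factor_def using gate[of i] y[of i] by (simp add: trunc_def del: exitp.simps)
      qed
    qed (use sN in auto)
    also have "\<dots> = exp (\<theta> * (\<Sum>i\<in>{\<tau>..<\<sigma>}. y i)) / (\<Prod>i\<in>{\<tau>..<\<sigma>}. trunc_mgf V p b a \<theta> i)"
      by (simp add: prod_dividef sum_distrib_left exp_sum)
    also have "(\<Sum>i\<in>{\<tau>..<\<sigma>}. y i) = S \<sigma> - S \<tau>"
      using sum_Suc_diff'[OF ts, of S] S(2) by simp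
    finally show ?thesis .
  qed
  have W_nn: "0 \<le> (\<Prod>i<N. gated_factor b a \<epsilon> S \<theta> i (y i))" for \<theta>
    by (intro prod_nonneg gated_factor_nn)
  \<comment> \<open>The exponential gained over the window is at least \<open>exp (4 * k)\<close>,
    while the normalising product is at most \<open>2 * exp (2 * k)\<close>.\<close>
  have low: "exp (2 * k) \<le> 2 * (\<Prod>i<N. gated_factor b a \<epsilon> S \<theta> i (y i))"
    if "\<bar>\<theta>\<bar> = k / a" "4 * k \<le> \<theta> * (S \<sigma> - S \<tau>)" for \<theta>
  proof -
    have "(\<Prod>i\<in>{\<tau>..<\<sigma>}. trunc_mgf V p b a \<theta> i) \<le> 2 * exp (2 * k)"
      using that(1) a exitp_mono[OF sN, of b a 0 0] e ts by (intro trunc_mgf_window[of a \<theta> k b \<sigma> \<epsilon>]) auto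
    moreover have "0 < (\<Prod>i\<in>{\<tau>..<\<sigma>}. trunc_mgf V p b a \<theta> i)" by (intro prod_pos) (simp add: trunc_mgf_pos)
    moreover have "exp (2 * k) * exp (2 * k) \<le> exp (\<theta> * (S \<sigma> - S \<tau>))"
      unfolding exp_add[symmetric] using that(2) by simp
    moreover have "exp (2 * k) * (\<Prod>i\<in>{\<tau>..<\<sigma>}. trunc_mgf V p b a \<theta> i) \<le> exp (2 * k) * (2 * exp (2 * k))"
      by (rule mult_left_mono) (use calculation(1) in simp_all)
    ultimately have "exp (2 * k) * (\<Prod>i\<in>{\<tau>..<\<sigma>}. trunc_mgf V p b a \<theta> i) \<le> 2 * exp (\<theta> * (S \<sigma> - S \<tau>))"
      by linarith
    then show ?thesis unfolding W using \<open>0 < (\<Prod>i\<in>{\<tau>..<\<sigma>}. trunc_mgf V p b a \<theta> i)\<close>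
      by (simp add: field_simps)
  qed
  have far: "4 * a \<le> \<bar>S \<sigma> - S \<tau>\<bar>" using s St by linarith
  have ka: "0 \<le> k / a" using a by simp
  have k4: "4 * k = k / a * (4 * a)" using a by simp
  \<comment> \<open>The direction of the crossing is not known in advance, so both exponents are
    carried along; the weight with the wrong sign only contributes that it is nonnegative.\<close>
  show ?thesis
  proof (cases "0 \<le> S \<sigma> - S \<tau>")
    case True
    then have "4 * k \<le> k / a * (S \<sigma> - S \<tau>)" unfolding k4 using far ka by (intro mult_left_mono) auto
    then have "exp (2 * k) \<le> 2 * (\<Prod>i<N. gated_factor b a \<epsilon> S (k / a) i (y i))"
      by (rule low[rotated]) (rule abs_of_nonneg[OF ka])
    then show ?thesis using W_nn[of "- (k / a)"] by argo
  next
    case False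
    then have "4 * k \<le> k / a * - (S \<sigma> - S \<tau>)" unfolding k4 using far ka by (intro mult_left_mono) auto
    then have "4 * k \<le> - (k / a) * (S \<sigma> - S \<tau>)" by (simp only: mult_minus_left mult_minus_right)
    then have "exp (2 * k) \<le> 2 * (\<Prod>i<N. gated_factor b a \<epsilon> S (- (k / a)) i (y i))"
      by (rule low[rotated]) (simp only: abs_minus_cancel abs_of_nonneg[OF ka])
    then show ?thesis using W_nn[of "k / a"] by argo
  qed
qed

end

text \<open>Time is shifted: step \<open>i\<close> is known at time \<open>Suc i\<close>, its law
  \<open>p w i\<close> already at time \<open>i\<close>. \<open>X_law\<close> makes \<open>p\<close>
  the conditional law of the step given the past. \<open>g_law\<close> is what condition (CI) leaves
  after averaging over \<open>G\<close>: the joint law of \<open>g\<close> is the mixture of the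
  product laws.\<close>

locale decoupled_core = prob_space M for M :: "'a measure" +
  fixes F :: "nat \<Rightarrow> 'a measure" and X g :: "nat \<Rightarrow> 'a \<Rightarrow> real"
    and p :: "'a \<Rightarrow> nat \<Rightarrow> real \<Rightarrow> real" and V :: "real set"
  assumes sub: "\<And>n. subalgebra M (F n)"
    and F_mono: "\<And>m n. m \<le> n \<Longrightarrow> sets (F m) \<subseteq> sets (F n)"
    and weights_p: "\<And>w. weights V (p w)"
    and X_in: "\<And>i w. w \<in> space M \<Longrightarrow> X i w \<in> V"
    and X_meas: "\<And>i. X i \<in> borel_measurable (F (Suc i))"
    and p_meas: "\<And>i v. v \<in> V \<Longrightarrow> (\<lambda>w. p w i v) \<in> borel_measurable (F i)"
    and X_law: "\<And>i v A. v \<in> V \<Longrightarrow> A \<in> sets (F i) \<Longrightarrow>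
       emeasure M (A \<inter> {w \<in> space M. X i w = v}) = (\<integral>\<^sup>+ w. ennreal (p w i v) * indicator A w \<partial>M)"
    and g_in: "\<And>i w. w \<in> space M \<Longrightarrow> g i w \<in> V"
    and g_meas: "\<And>i. g i \<in> borel_measurable M"
    and g_law: "\<And>N u. (\<And>i. i < N \<Longrightarrow> u i \<in> V) \<Longrightarrow>
       emeasure M {w \<in> space M. \<forall>i<N. g i w = u i} = (\<integral>\<^sup>+ w. ennreal (\<Prod>i<N. p w i (u i)) \<partial>M)"
begin

lemma finite_V: "finite V"
  using weights_p weights.finV by blast

lemma p_nonneg: "v \<in> V \<Longrightarrow> 0 \<le> p w i v"
  using weights_p weights.p_nn by blast

lemma space_F: "space (F n) = space M"
  using sub[of n] by (simp add: subalgebra_def)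

lemma F_measurable_mono:
  assumes "h \<in> borel_measurable (F m)" "m \<le> n"
  shows "h \<in> borel_measurable (F n)"
  by (rule measurable_from_subalg[OF _ assms(1)]) (use F_mono[OF assms(2)] in \<open>simp add: subalgebra_def space_F\<close>)

lemma F_measurable_M: "h \<in> borel_measurable (F m) \<Longrightarrow> h \<in> borel_measurable M"
  by (rule measurable_from_subalg[OF sub])

lemma p_measurable: "v \<in> V \<Longrightarrow> i \<le> n \<Longrightarrow> (\<lambda>w. p w i v) \<in> borel_measurable (F n)"
  by (rule F_measurable_mono[OF p_meas])

lemma X_measurable: "i < n \<Longrightarrow> X i \<in> borel_measurable (F n)"
  by (rule F_measurable_mono[OF X_meas]) simp

lemma X_law_integral:
  assumes v: "v \<in> V" and h: "h \<in> borel_measurable (F i)"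
  shows "(\<integral>\<^sup>+ w. h w * indicator {w \<in> space M. X i w = v} w \<partial>M) = (\<integral>\<^sup>+ w. h w * ennreal (p w i v) \<partial>M)"
proof -
  note [measurable] = F_measurable_M[OF p_meas[OF v, of i]] F_measurable_M[OF X_meas[of i]]
  show ?thesis using h
  proof (induction rule: borel_measurable_induct)
    case (cong h k)
    have "(\<integral>\<^sup>+ w. h w * q w \<partial>M) = (\<integral>\<^sup>+ w. k w * q w \<partial>M)" for q :: "'a \<Rightarrow> ennreal"
      by (rule nn_integral_cong) (simp add: cong(3) space_F)
    then show ?case using cong(4) by simp
  next
    case (set A)
    then have [measurable]: "A \<in> sets M" using sub by (auto simp: subalgebra_def)
    have "(\<integral>\<^sup>+ w. indicator A w * indicator {w \<in> space M. X i w = v} w \<partial>M)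
        = emeasure M (A \<inter> {w \<in> space M. X i w = v})"
      by (simp flip: indicator_inter_arith)
    then show ?case using X_law[OF v set] by (simp add: mult.commute)
  next
    case (mult h c)
    have [measurable]: "h \<in> borel_measurable M" by (rule measurable_from_subalg[OF sub mult(2)])
    show ?case using mult(4) by (simp add: mult.assoc nn_integral_cmult)
  next
    case (add h k)
    have [measurable]: "h \<in> borel_measurable M" "k \<in> borel_measurable M"
      using measurable_from_subalg[OF sub add(1)] measurable_from_subalg[OF sub add(3)] by auto
    show ?case using add by (simp add: distrib_right nn_integral_add)
  next
    case (seq U)
    have [measurable]: "U j \<in> borel_measurable M" for j using measurable_from_subalg[OF sub seq(1)] .
    have "(\<integral>\<^sup>+ w. (SUP j. U j) w * q w \<partial>M) = (SUP j. \<integral>\<^sup>+ w. U j w * q w \<partial>M)"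
      if [measurable]: "q \<in> borel_measurable M" for q
    proof -
      have "(\<integral>\<^sup>+ w. (SUP j. U j) w * q w \<partial>M) = (\<integral>\<^sup>+ w. (SUP j. U j w * q w) \<partial>M)"
        by (simp add: SUP_mult_right_ennreal image_comp)
      also have "\<dots> = (SUP j. \<integral>\<^sup>+ w. U j w * q w \<partial>M)"
        using \<open>incseq U\<close> by (intro nn_integral_monotone_convergence_SUP)
          (auto simp: incseq_def le_fun_def intro!: mult_right_mono)
      finally show ?thesis .
    qed
    then show ?case using seq by simp
  qed
qed

text \<open>Freezing: given the past up to time \<open>i\<close>, everything in \<phi> except the
  step is known, so the step can be averaged out with its conditional law.\<close>

lemma X_average:
  assumes "\<And>v. v \<in> V \<Longrightarrow> \<phi> v \<in> borel_measurable (F i)" "\<And>v w. 0 \<le> \<phi> v w"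
  shows "(\<integral>\<^sup>+ w. ennreal (\<phi> (X i w) w) \<partial>M) = (\<integral>\<^sup>+ w. ennreal (\<Sum>v\<in>V. p w i v * \<phi> v w) \<partial>M)"
proof -
  note [measurable] = F_measurable_M[OF p_meas] F_measurable_M[OF X_meas[of i]] F_measurable_M[OF assms(1)]
  have "(\<integral>\<^sup>+ w. ennreal (\<phi> (X i w) w) \<partial>M)
      = (\<integral>\<^sup>+ w. (\<Sum>v\<in>V. ennreal (\<phi> v w) * indicator {w \<in> space M. X i w = v} w) \<partial>M)"
  proof (rule nn_integral_cong)
    fix w assume w: "w \<in> space M"
    have "(\<Sum>v\<in>V. ennreal (\<phi> v w) * indicator {w \<in> space M. X i w = v} w)
        = (\<Sum>v\<in>V. if v = X i w then ennreal (\<phi> v w) else 0)"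
      using w by (intro sum.cong) auto
    then show "ennreal (\<phi> (X i w) w) = (\<Sum>v\<in>V. ennreal (\<phi> v w) * indicator {w \<in> space M. X i w = v} w)"
      using finite_V X_in[OF w] by simp
  qed
  also have "\<dots> = (\<Sum>v\<in>V. \<integral>\<^sup>+ w. ennreal (\<phi> v w) * indicator {w \<in> space M. X i w = v} w \<partial>M)"
    by (rule nn_integral_sum) measurable
  also have "\<dots> = (\<Sum>v\<in>V. \<integral>\<^sup>+ w. ennreal (\<phi> v w) * ennreal (p w i v) \<partial>M)"
    by (intro sum.cong refl X_law_integral) (use assms(1) in measurable)
  also have "\<dots> = (\<integral>\<^sup>+ w. (\<Sum>v\<in>V. ennreal (\<phi> v w) * ennreal (p w i v)) \<partial>M)"
    by (rule nn_integral_sum[symmetric]) measurable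
  also have "\<dots> = (\<integral>\<^sup>+ w. ennreal (\<Sum>v\<in>V. p w i v * \<phi> v w) \<partial>M)"
    using assms(2) p_nonneg by (intro nn_integral_cong) (simp add: mult.commute flip: ennreal_mult sum_ennreal)
  finally show ?thesis .
qed

text \<open>Induction on the number of summands that are still free, the first \<open>k\<close>
  values being prescribed. Splitting by the value of \<open>g k\<close> turns one more summand into
  a prescribed value; when none is free, \<open>g_law\<close> applies.\<close>

lemma g_law_walk_mean_aux:
  assumes "k + n = N" "\<And>i. i < k \<Longrightarrow> u i \<in> V" "\<And>z. 0 \<le> \<phi> z"
    and [measurable]: "\<phi> \<in> borel_measurable borel"
  shows "(\<integral>\<^sup>+ w. indicator {w \<in> space M. \<forall>i<k. g i w = u i} w * ennreal (\<phi> (x + (\<Sum>i\<in>{k..<N}. g i w))) \<partial>M)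
      = (\<integral>\<^sup>+ w. ennreal ((\<Prod>i<k. p w i (u i)) * walk_mean V (p w) k n \<phi> x) \<partial>M)"
  using assms(1,2)
proof (induction n arbitrary: k u x)
  note [measurable] = g_meas F_measurable_M[OF p_meas]
  {
    case 0
    have [measurable]: "(\<lambda>w. \<Prod>i<k. p w i (u i)) \<in> borel_measurable M"
      using 0 by (intro borel_measurable_prod) measurable
    have "(\<integral>\<^sup>+ w. indicator {w \<in> space M. \<forall>i<k. g i w = u i} w * ennreal (\<phi> x) \<partial>M)
       = (\<integral>\<^sup>+ w. ennreal (\<Prod>i<k. p w i (u i)) \<partial>M) * ennreal (\<phi> x)"
      by (simp add: nn_integral_multc g_law[OF 0(2)])
    also have "\<dots> = (\<integral>\<^sup>+ w. ennreal ((\<Prod>i<k. p w i (u i)) * \<phi> x) \<partial>M)"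
      using 0(2) assms(3) p_nonneg
      by (subst nn_integral_multc[symmetric]) (auto intro!: nn_integral_cong simp: ennreal_mult'')
    finally show ?case using 0 by simp
  next
    case (Suc n)
    have ev_nn: "0 \<le> walk_mean V (p w) s m \<phi> z" for w s m z
      using weights.walk_mean_mono[OF weights_p, of "\<lambda>_. 0" \<phi> w s m z] assms(3)
      by (simp add: weights.walk_mean_const[OF weights_p])
    have [measurable]: "(\<lambda>w. walk_mean V (p w) s m \<phi> z) \<in> borel_measurable M" for s m z
      by (rule borel_measurable_walk_mean[OF finite_V]) measurable
    have [measurable]: "(\<lambda>w. \<Prod>i<j. p w i (t i)) \<in> borel_measurable M" if "\<And>i. i < j \<Longrightarrow> t i \<in> V" for j t
      using that by (intro borel_measurable_prod) measurable
    have u': "(u(k := v)) i \<in> V" if "i < Suc k" "v \<in> V" for i v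
      using Suc.prems that by (auto simp: less_Suc_eq)
    have "(\<integral>\<^sup>+ w. indicator {w \<in> space M. \<forall>i<k. g i w = u i} w * ennreal (\<phi> (x + (\<Sum>i\<in>{k..<N}. g i w))) \<partial>M)
      = (\<integral>\<^sup>+ w. (\<Sum>v\<in>V. indicator {w \<in> space M. \<forall>i<Suc k. g i w = (u(k := v)) i} w
             * ennreal (\<phi> (x + v + (\<Sum>i\<in>{Suc k..<N}. g i w)))) \<partial>M)"
    proof (rule nn_integral_cong)
      fix w assume w: "w \<in> space M"
      have "(\<Sum>v\<in>V. indicator {w \<in> space M. \<forall>i<Suc k. g i w = (u(k := v)) i} w
             * ennreal (\<phi> (x + v + (\<Sum>i\<in>{Suc k..<N}. g i w))))
        = (\<Sum>v\<in>V. if v = g k w then indicator {w \<in> space M. \<forall>i<k. g i w = u i} w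
             * ennreal (\<phi> (x + v + (\<Sum>i\<in>{Suc k..<N}. g i w))) else 0)"
        using w by (intro sum.cong) (auto simp: less_Suc_eq indicator_def)
      also have "\<dots> = indicator {w \<in> space M. \<forall>i<k. g i w = u i} w
             * ennreal (\<phi> (x + (g k w + (\<Sum>i\<in>{Suc k..<N}. g i w))))"
        using finite_V g_in[OF w] by (simp add: add.assoc)
      also have "g k w + (\<Sum>i\<in>{Suc k..<N}. g i w) = (\<Sum>i\<in>{k..<N}. g i w)"
        using Suc.prems by (subst (2) sum.atLeast_Suc_lessThan) auto
      finally show "indicator {w \<in> space M. \<forall>i<k. g i w = u i} w * ennreal (\<phi> (x + (\<Sum>i\<in>{k..<N}. g i w)))
         = (\<Sum>v\<in>V. indicator {w \<in> space M. \<forall>i<Suc k. g i w = (u(k := v)) i} w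
             * ennreal (\<phi> (x + v + (\<Sum>i\<in>{Suc k..<N}. g i w))))" by simp
    qed
    also have "\<dots> = (\<Sum>v\<in>V. \<integral>\<^sup>+ w. indicator {w \<in> space M. \<forall>i<Suc k. g i w = (u(k := v)) i} w
             * ennreal (\<phi> (x + v + (\<Sum>i\<in>{Suc k..<N}. g i w))) \<partial>M)"
      by (rule nn_integral_sum) measurable
    also have "\<dots> = (\<Sum>v\<in>V. \<integral>\<^sup>+ w. ennreal ((\<Prod>i<Suc k. p w i ((u(k := v)) i)) * walk_mean V (p w) (Suc k) n \<phi> (x + v)) \<partial>M)"
      using Suc.prems u' by (intro sum.cong refl Suc.IH) auto
    also have "\<dots> = (\<integral>\<^sup>+ w. (\<Sum>v\<in>V. ennreal ((\<Prod>i<Suc k. p w i ((u(k := v)) i)) * walk_mean V (p w) (Suc k) n \<phi> (x + v))) \<partial>M)"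
      using u' by (intro nn_integral_sum[symmetric]) measurable
    also have "\<dots> = (\<integral>\<^sup>+ w. ennreal ((\<Prod>i<k. p w i (u i)) * walk_mean V (p w) k (Suc n) \<phi> x) \<partial>M)"
    proof (rule nn_integral_cong)
      fix w
      have "(\<Sum>v\<in>V. ennreal ((\<Prod>i<Suc k. p w i ((u(k := v)) i)) * walk_mean V (p w) (Suc k) n \<phi> (x + v)))
        = ennreal (\<Sum>v\<in>V. (\<Prod>i<Suc k. p w i ((u(k := v)) i)) * walk_mean V (p w) (Suc k) n \<phi> (x + v))"
        using u' p_nonneg ev_nn by (intro sum_ennreal mult_nonneg_nonneg prod_nonneg) auto
      also have "(\<Sum>v\<in>V. (\<Prod>i<Suc k. p w i ((u(k := v)) i)) * walk_mean V (p w) (Suc k) n \<phi> (x + v))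
        = (\<Prod>i<k. p w i (u i)) * walk_mean V (p w) k (Suc n) \<phi> x"
        by (simp add: sum_distrib_left mult.assoc)
      finally show "(\<Sum>v\<in>V. ennreal ((\<Prod>i<Suc k. p w i ((u(k := v)) i)) * walk_mean V (p w) (Suc k) n \<phi> (x + v)))
        = ennreal ((\<Prod>i<k. p w i (u i)) * walk_mean V (p w) k (Suc n) \<phi> x)" .
    qed
    finally show ?case .
  }
qed

lemma g_law_walk_mean:
  assumes "\<And>z. 0 \<le> \<phi> z"
    and [measurable]: "\<phi> \<in> borel_measurable borel"
  shows "(\<integral>\<^sup>+ w. ennreal (\<phi> (\<Sum>i<N. g i w)) \<partial>M) = (\<integral>\<^sup>+ w. ennreal (walk_mean V (p w) 0 N \<phi> 0) \<partial>M)"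
proof -
  have "(\<integral>\<^sup>+ w. ennreal (\<phi> (\<Sum>i<N. g i w)) \<partial>M)
     = (\<integral>\<^sup>+ w. indicator {w \<in> space M. \<forall>i<0. g i w = 0} w * ennreal (\<phi> (0 + (\<Sum>i\<in>{0..<N}. g i w))) \<partial>M)"
    by (rule nn_integral_cong) (simp add: atLeast0LessThan)
  also have "\<dots> = (\<integral>\<^sup>+ w. ennreal (walk_mean V (p w) 0 N \<phi> 0) \<partial>M)"
    using g_law_walk_mean_aux[of 0 N N "\<lambda>_. 0" \<phi> 0] assms by simp
  finally show ?thesis .
qed

end

section \<open>The good-\<open>\<lambda>\<close> inequality\<close>

text \<open>The set where \<Phi> is at most \<open>t\<close> is closed and downward closed in the
  nonnegative reals, and \<open>l\<close> is its right end; \<open>0 < l\<close> because \<Phi>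
  starts at 0 and takes the value \<open>t\<close> at a positive point. So the layers of
  \<open>\<Phi> (A w)\<close> are tails of \<open>A\<close> at positive levels.\<close>

lemma class_F_superlevel:
  assumes \<Phi>: "\<Phi> \<in> class_F q" and t: "0 < t"
  shows "(\<forall>x\<ge>0. \<Phi> x \<le> t) \<or> (\<exists>l>0. \<forall>x\<ge>0. t < \<Phi> x \<longleftrightarrow> l < x)"
proof (cases "\<forall>x\<ge>0. \<Phi> x \<le> t")
  case False
  then obtain y where y: "0 \<le> y" "t < \<Phi> y" by (auto simp: not_le)
  have mono: "\<Phi> x \<le> \<Phi> z" if "0 \<le> x" "x \<le> z" for x z
    using \<Phi> that by (auto simp: class_F_def mono_on_def)
  have cont: "continuous_on {0..} \<Phi>" and zero: "\<Phi> 0 = 0" using \<Phi> by (auto simp: class_F_def)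
  let ?A = "{x \<in> {0..}. \<Phi> x \<le> t}"
  have closed: "closed ?A" using cont by (intro continuous_on_closed_Collect_le) auto
  have bdd: "bdd_above ?A"
  proof (rule bdd_aboveI)
    fix x assume "x \<in> ?A"
    then show "x \<le> y" using mono[of y x] y by (cases "x \<le> y") auto
  qed
  have ne: "?A \<noteq> {}" using zero t by force
  define l where "l = Sup ?A"
  have lA: "l \<in> ?A" unfolding l_def by (rule closed_contains_Sup[OF ne bdd closed])
  obtain x where x: "0 \<le> x" "x \<le> y" "\<Phi> x = t"
    using IVT'[of \<Phi> 0 t y] y t zero continuous_on_subset[OF cont, of "{0..y}"] by auto
  have "x \<noteq> 0" using x zero t by auto
  moreover have "x \<le> l" unfolding l_def using x by (intro cSup_upper bdd) auto
  ultimately have "0 < l" using x by auto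
  moreover have "t < \<Phi> x \<longleftrightarrow> l < x" if "0 \<le> x" for x
  proof
    assume "t < \<Phi> x"
    then show "l < x" using mono[of x l] that lA by (cases "l < x") auto
  next
    assume "l < x"
    then have "x \<notin> ?A" unfolding l_def using cSup_upper[OF _ bdd] by (meson leD)
    then show "t < \<Phi> x" using that by auto
  qed
  ultimately show ?thesis by blast
qed blast

lemma borel_measurable_class_F:
  assumes \<Phi>: "\<Phi> \<in> class_F q" and [measurable]: "A \<in> borel_measurable M" and A: "\<And>w. w \<in> space M \<Longrightarrow> 0 \<le> A w"
  shows "(\<lambda>w. \<Phi> (A w)) \<in> borel_measurable M"
proof -
  have "continuous_on {0..} \<Phi>" using \<Phi> by (simp add: class_F_def)
  \<comment> \<open>Continuity of \<Phi> is known on the nonnegative axis only, so it is replaced by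
    its extension that is constant on the negative axis.\<close>
  then have "continuous_on UNIV (\<lambda>x. \<Phi> (max 0 x))"
    by (rule continuous_on_compose2) (auto intro!: continuous_intros)
  then have [measurable]: "(\<lambda>x. \<Phi> (max 0 x)) \<in> borel_measurable borel"
    by (rule borel_measurable_continuous_onI)
  have "(\<lambda>w. \<Phi> (max 0 (A w))) \<in> borel_measurable M" by measurable
  then show ?thesis by (rule measurable_cong[THEN iffD1, rotated]) (simp add: A max_absorb2)
qed

lemma (in sigma_finite_measure) nn_integral_layer_cake:
  assumes [measurable]: "h \<in> borel_measurable M"
  shows "(\<integral>\<^sup>+ w. ennreal (h w) \<partial>M) = (\<integral>\<^sup>+ t. indicator {0<..} t * emeasure M {w \<in> space M. t < h w} \<partial>lborel)"
proof -
  interpret pair_sigma_finite M lborel ..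
  have "(\<integral>\<^sup>+ w. ennreal (h w) \<partial>M) = (\<integral>\<^sup>+ w. (\<integral>\<^sup>+ t. indicator {0<..} t * indicator {w \<in> space M. t < h w} w \<partial>lborel) \<partial>M)"
  proof (rule nn_integral_cong)
    fix w assume w: "w \<in> space M"
    have "(\<integral>\<^sup>+ t. indicator {0<..} t * indicator {w \<in> space M. t < h w} w \<partial>lborel)
        = (\<integral>\<^sup>+ t. indicator {0<..<h w} t \<partial>lborel)"
      using w by (intro nn_integral_cong) (auto simp: indicator_def)
    also have "\<dots> = ennreal (h w)"
      by (cases "0 \<le> h w") (auto simp: ennreal_neg)
    finally show "ennreal (h w) = (\<integral>\<^sup>+ t. indicator {0<..} t * indicator {w \<in> space M. t < h w} w \<partial>lborel)" ..
  qed
  also have "\<dots> = (\<integral>\<^sup>+ t. (\<integral>\<^sup>+ w. indicator {0<..} t * indicator {w \<in> space M. t < h w} w \<partial>M) \<partial>lborel)"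
    by (rule Fubini'[symmetric]) measurable
  also have "\<dots> = (\<integral>\<^sup>+ t. indicator {0<..} t * emeasure M {w \<in> space M. t < h w} \<partial>lborel)"
    by (simp add: nn_integral_cmult)
  finally show ?thesis .
qed

lemma (in sigma_finite_measure) tail_comparison:
  assumes \<Phi>: "\<Phi> \<in> class_F q"
    and meas [measurable]: "A \<in> borel_measurable M" "B \<in> borel_measurable M" "C \<in> borel_measurable M"
    and nn: "\<And>w. w \<in> space M \<Longrightarrow> 0 \<le> A w" "\<And>w. w \<in> space M \<Longrightarrow> 0 \<le> B w" "\<And>w. w \<in> space M \<Longrightarrow> 0 \<le> C w"
    and tail: "\<And>l. 0 < l \<Longrightarrow> emeasure M {w \<in> space M. l < A w}
        \<le> \<alpha> * emeasure M {w \<in> space M. l < B w} + \<beta> * emeasure M {w \<in> space M. l < C w}"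
  shows "(\<integral>\<^sup>+ w. ennreal (\<Phi> (A w)) \<partial>M)
      \<le> \<alpha> * (\<integral>\<^sup>+ w. ennreal (\<Phi> (B w)) \<partial>M) + \<beta> * (\<integral>\<^sup>+ w. ennreal (\<Phi> (C w)) \<partial>M)"
proof -
  note [measurable] = borel_measurable_class_F[OF \<Phi> meas(1) nn(1)] borel_measurable_class_F[OF \<Phi> meas(2) nn(2)]
     borel_measurable_class_F[OF \<Phi> meas(3) nn(3)]
  let ?I = "\<lambda>t Z. indicator {0<..} t * emeasure M {w \<in> space M. t < \<Phi> (Z w)}"
  have m: "(\<lambda>t. ?I t Z) \<in> borel_measurable lborel" if [measurable]: "(\<lambda>w. \<Phi> (Z w)) \<in> borel_measurable M" for Z
    by measurable
  have pt: "?I t A \<le> \<alpha> * ?I t B + \<beta> * ?I t C" for t :: real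
  proof (cases "0 < t")
    case True
    from class_F_superlevel[OF \<Phi> True] show ?thesis
    proof (elim disjE exE conjE)
      assume le: "\<forall>x\<ge>0. \<Phi> x \<le> t"
      then have "{w \<in> space M. t < \<Phi> (A w)} = {}" using nn(1) by (auto simp: not_less)
      then show ?thesis by (simp only: emeasure_empty mult_zero_right zero_le)
    next
      fix l assume l: "0 < l" "\<forall>x\<ge>0. (t < \<Phi> x) = (l < x)"
      have "{w \<in> space M. t < \<Phi> (Z w)} = {w \<in> space M. l < Z w}" if "\<And>w. w \<in> space M \<Longrightarrow> 0 \<le> Z w" for Z
        using l that by auto
      from this[OF nn(1)] this[OF nn(2)] this[OF nn(3)] show ?thesis using tail[OF l(1)] True by simp
    qed
  qed simp
  have "(\<integral>\<^sup>+ w. ennreal (\<Phi> (A w)) \<partial>M) = (\<integral>\<^sup>+ t. ?I t A \<partial>lborel)"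
    by (rule nn_integral_layer_cake) measurable
  also have "\<dots> \<le> (\<integral>\<^sup>+ t. \<alpha> * ?I t B + \<beta> * ?I t C \<partial>lborel)"
    by (rule nn_integral_mono) (rule pt)
  also have "\<dots> = \<alpha> * (\<integral>\<^sup>+ t. ?I t B \<partial>lborel) + \<beta> * (\<integral>\<^sup>+ t. ?I t C \<partial>lborel)"
    by (subst nn_integral_add) (auto intro!: borel_measurable_times_ennreal m simp: nn_integral_cmult m)
  also have "(\<integral>\<^sup>+ t. ?I t B \<partial>lborel) = (\<integral>\<^sup>+ w. ennreal (\<Phi> (B w)) \<partial>M)"
    by (rule nn_integral_layer_cake[symmetric]) measurable
  also have "(\<integral>\<^sup>+ t. ?I t C \<partial>lborel) = (\<integral>\<^sup>+ w. ennreal (\<Phi> (C w)) \<partial>M)"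
    by (rule nn_integral_layer_cake[symmetric]) measurable
  finally show ?thesis .
qed

section \<open>Martingale and exit estimates for the centred sum\<close>

context decoupled_core
begin

definition centre :: "'a \<Rightarrow> nat \<Rightarrow> real" where
  "centre w i = med V (p w) (Suc i) - med V (p w) i"

definition centred_sum :: "nat \<Rightarrow> 'a \<Rightarrow> real" where
  "centred_sum n w = (\<Sum>i<n. X i w - centre w i)"

definition exit_prob :: "real \<Rightarrow> nat \<Rightarrow> 'a \<Rightarrow> real" where
  "exit_prob a n w = exitp V (p w) (centre w) a 0 n 0"

definition factor :: "real \<Rightarrow> real \<Rightarrow> real \<Rightarrow> nat \<Rightarrow> 'a \<Rightarrow> real \<Rightarrow> real" where
  "factor a \<epsilon> \<theta> i w y = weights.gated_factor V (p w) (centre w) a \<epsilon> (\<lambda>j. centred_sum j w) \<theta> i y"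

definition weight :: "real \<Rightarrow> real \<Rightarrow> real \<Rightarrow> nat \<Rightarrow> 'a \<Rightarrow> real" where
  "weight a \<epsilon> \<theta> n w = (\<Prod>i<n. factor a \<epsilon> \<theta> i w (X i w - centre w i))"

lemma sum_X: "(\<Sum>i<n. X i w) = centred_sum n w + med V (p w) n"
  using sum_lessThan_telescope[of "med V (p w)" n] weights.med_0[OF weights_p, of w]
  by (simp add: centred_sum_def sum_subtractf centre_def)

lemma centre_measurable: "i \<le> n \<Longrightarrow> (\<lambda>w. centre w i) \<in> borel_measurable (F n)"
  unfolding centre_def
  by (intro borel_measurable_diff borel_measurable_med finite_V p_measurable) auto

lemma centred_sum_measurable: "m \<le> n \<Longrightarrow> centred_sum m \<in> borel_measurable (F n)"
  unfolding centred_sum_def[abs_def]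
  by (intro borel_measurable_sum borel_measurable_diff X_measurable centre_measurable) auto

text \<open>The exit probability up to time \<open>Suc n\<close> involves laws and centres with
  index at most \<open>n\<close>, so it is known at time \<open>n\<close>. This gain of one step is
  what allows the gate of step \<open>i\<close> to look at
  \<open>exit_prob a (Suc i)\<close>.\<close>

lemma exit_prob_measurable: "i \<le> Suc n \<Longrightarrow> exit_prob a i \<in> borel_measurable (F n)"
  unfolding exit_prob_def[abs_def]
  by (intro borel_measurable_exitp finite_V p_measurable centre_measurable) auto

lemma jump_measurable: "(\<lambda>w. jump V (p w) (centre w) a i) \<in> borel_measurable (F i)"
  unfolding jump_def
proof (rule borel_measurable_sum)
  fix v assume "v \<in> V"
  note [measurable] = p_meas[OF this, of i] centre_measurable[OF order.refl, of i]
  show "(\<lambda>w. p w i v * of_bool (2 * a < \<bar>v - centre w i\<bar>)) \<in> borel_measurable (F i)" by measurable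
qed

lemma trunc_mgf_measurable:
  assumes "i \<le> n" shows "(\<lambda>w. trunc_mgf V (p w) (centre w) a \<theta> i) \<in> borel_measurable (F n)"
  unfolding trunc_mgf_def trunc_def
proof (rule borel_measurable_sum)
  fix v assume "v \<in> V"
  note [measurable] = p_measurable[OF this assms] centre_measurable[OF assms]
  show "(\<lambda>w. p w i v * exp (\<theta> * (if \<bar>v - centre w i\<bar> \<le> 2 * a then v - centre w i else 0)))
      \<in> borel_measurable (F n)" by measurable
qed

lemma factor_measurable:
  assumes i: "i \<le> n" and [measurable]: "y \<in> borel_measurable (F n)"
  shows "(\<lambda>w. factor a \<epsilon> \<theta> i w (y w)) \<in> borel_measurable (F n)"
proof -
  have S [measurable]: "centred_sum j \<in> borel_measurable (F n)" if "j \<in> {..i}" for j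
    using that i by (intro centred_sum_measurable) auto
  have 1: "Measurable.pred (F n) (\<lambda>w. \<exists>j\<in>{..i}. \<bar>centred_sum j w\<bar> > 2 * a)"
    by (rule pred_intros_finite) (use S in measurable)
  have 2: "Measurable.pred (F n) (\<lambda>w. \<forall>j\<in>{..i}. \<bar>centred_sum j w\<bar> \<le> 8 * a)"
    by (rule pred_intros_finite) (use S in measurable)
  note [measurable] = 1[unfolded atMost_iff Bex_def] 2[unfolded atMost_iff Ball_def]
    exit_prob_measurable[of "Suc i" n a] trunc_mgf_measurable[OF i, of a \<theta>]
  have [measurable]: "exit_prob a (Suc i) \<in> borel_measurable (F n)" using i by (intro exit_prob_measurable) simp
  show ?thesis
    unfolding factor_def weights.gated_factor_def[OF weights_p] trunc_def exit_prob_def[symmetric] by measurable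
qed

lemma factor_nn: "0 \<le> factor a \<epsilon> \<theta> i w y"
  unfolding factor_def by (rule weights.gated_factor_nn[OF weights_p])

lemma weight_nn: "0 \<le> weight a \<epsilon> \<theta> n w"
  unfolding weight_def by (intro prod_nonneg factor_nn)

lemma weight_measurable: "weight a \<epsilon> \<theta> n \<in> borel_measurable (F n)"
  unfolding weight_def[abs_def]
  by (intro borel_measurable_prod factor_measurable borel_measurable_diff X_measurable centre_measurable) auto

text \<open>Gate, centre and normalisation of the last factor are known before its step, so
  averaging out that step leaves the weight of the earlier ones.\<close>

lemma weight_expectation: "(\<integral>\<^sup>+ w. ennreal (weight a \<epsilon> \<theta> n w) \<partial>M) = 1"
proof (induction n)
  case 0 then show ?case by (simp add: weight_def emeasure_space_1)
next
  case (Suc n)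
  let ?\<phi> = "\<lambda>v w. weight a \<epsilon> \<theta> n w * factor a \<epsilon> \<theta> n w (v - centre w n)"
  have "(\<integral>\<^sup>+ w. ennreal (weight a \<epsilon> \<theta> (Suc n) w) \<partial>M) = (\<integral>\<^sup>+ w. ennreal (?\<phi> (X n w) w) \<partial>M)"
    by (simp add: weight_def)
  also have "\<dots> = (\<integral>\<^sup>+ w. ennreal (\<Sum>v\<in>V. p w n v * ?\<phi> v w) \<partial>M)"
    by (intro X_average borel_measurable_times weight_measurable factor_measurable mult_nonneg_nonneg
         weight_nn factor_nn borel_measurable_diff centre_measurable borel_measurable_const) auto
  also have "\<dots> = (\<integral>\<^sup>+ w. ennreal (weight a \<epsilon> \<theta> n w) \<partial>M)"
  proof (rule nn_integral_cong)
    fix w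
    have "(\<Sum>v\<in>V. p w n v * ?\<phi> v w) = weight a \<epsilon> \<theta> n w * (\<Sum>v\<in>V. p w n v * factor a \<epsilon> \<theta> n w (v - centre w n))"
      by (simp add: sum_distrib_left mult.left_commute)
    then show "ennreal (\<Sum>v\<in>V. p w n v * ?\<phi> v w) = ennreal (weight a \<epsilon> \<theta> n w)"
      unfolding factor_def weights.gated_factor_average[OF weights_p] by simp
  qed
  finally show ?case using Suc.IH by simp
qed

lemma crossing_sets: "{w \<in> space M. \<exists>m\<le>N. \<bar>centred_sum m w\<bar> > c} \<in> sets M"
proof -
  note [measurable] = F_measurable_M[OF centred_sum_measurable[OF order.refl]]
  show ?thesis by measurable
qed

text \<open>As long as the sum has not passed \<open>2 * a\<close> every gate is closed, so off the
  event the weight is 1. Its total expectation is also 1, hence on the event it integrates exactly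
  to the probability of the event. This takes the place of conditioning on the first
  passage.\<close>

lemma weight_on_crossing:
  "(\<integral>\<^sup>+ w. ennreal (weight a \<epsilon> \<theta> N w * of_bool (\<exists>m\<le>N. \<bar>centred_sum m w\<bar> > 2 * a)) \<partial>M)
     = emeasure M {w \<in> space M. \<exists>m\<le>N. \<bar>centred_sum m w\<bar> > 2 * a}" (is "?I = emeasure M ?A")
proof -
  note [measurable] = F_measurable_M[OF centred_sum_measurable[OF order.refl]] F_measurable_M[OF weight_measurable]
  have "weight a \<epsilon> \<theta> N w = 1" if "\<not> (\<exists>m\<le>N. \<bar>centred_sum m w\<bar> > 2 * a)" for w
    unfolding weight_def factor_def weights.gated_factor_def[OF weights_p]
    using that by (intro prod.neutral ballI if_not_P) (meson lessThan_iff less_imp_le order_trans)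
  then have "ennreal (weight a \<epsilon> \<theta> N w) = ennreal (weight a \<epsilon> \<theta> N w * of_bool (\<exists>m\<le>N. \<bar>centred_sum m w\<bar> > 2 * a))
       + indicator (space M - ?A) w" if "w \<in> space M" for w
    using that by (cases "\<exists>m\<le>N. \<bar>centred_sum m w\<bar> > 2 * a") (simp_all add: indicator_def del: ex_simps)
  then have "(\<integral>\<^sup>+ w. ennreal (weight a \<epsilon> \<theta> N w) \<partial>M)
     = (\<integral>\<^sup>+ w. ennreal (weight a \<epsilon> \<theta> N w * of_bool (\<exists>m\<le>N. \<bar>centred_sum m w\<bar> > 2 * a))
         + indicator (space M - ?A) w \<partial>M)" by (rule nn_integral_cong)
  also have "\<dots> = ?I + emeasure M (space M - ?A)"
    by (subst nn_integral_add) auto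
  finally have "emeasure M (space M - ?A) + ?I = 1" by (simp add: weight_expectation add.commute)
  moreover have "emeasure M (space M - ?A) + emeasure M ?A = 1"
  proof -
    have "emeasure M (space M - ?A) + emeasure M ?A = emeasure M ((space M - ?A) \<union> ?A)"
      by (rule plus_emeasure) (use crossing_sets[of N "2 * a"] in auto)
    also have "(space M - ?A) \<union> ?A = space M" by blast
    finally show ?thesis by (simp only: emeasure_space_1)
  qed
  ultimately show ?thesis
    using ennreal_add_left_cancel[of "emeasure M (space M - ?A)" ?I "emeasure M ?A"] by simp
qed


text \<open>When the sum passes \<open>8 * a\<close>, either the exit probability exceeds
  \<epsilon>, or a large step occurs while it is still at most \<epsilon>, or the two weights add up
  to at least \<open>exp (2 * k) / 2\<close>. Each possibility makes one of the three terms at least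
  1.\<close>

lemma good_lambda_pointwise:
  assumes a: "0 < a" "0 \<le> k" and e: "0 < \<epsilon>" "\<epsilon> < 1" "exp (4 * k) * \<epsilon> \<le> 1 / 2"
  shows "of_bool (\<exists>m\<le>N. \<bar>centred_sum m w\<bar> > 8 * a)
    \<le> 1 / \<epsilon> * exit_prob a N w
      + (\<Sum>i<N. of_bool (exit_prob a (Suc i) w \<le> \<epsilon>) * of_bool (2 * a < \<bar>X i w - centre w i\<bar>))
      + 2 * exp (- (2 * k)) * (weight a \<epsilon> (k / a) N w * of_bool (\<exists>m\<le>N. \<bar>centred_sum m w\<bar> > 2 * a)
                           + weight a \<epsilon> (- (k / a)) N w * of_bool (\<exists>m\<le>N. \<bar>centred_sum m w\<bar> > 2 * a))"
    (is "?l \<le> ?E + ?J + ?W")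
proof -
  have E0: "0 \<le> ?E" using e weights.exitp_nn[OF weights_p] by (simp add: exit_prob_def)
  have J0: "0 \<le> ?J" by (intro sum_nonneg) auto
  have W0: "0 \<le> ?W" using weight_nn by simp
  consider "\<not> (\<exists>m\<le>N. \<bar>centred_sum m w\<bar> > 8 * a)" | "\<not> exit_prob a N w \<le> \<epsilon>"
    | "exit_prob a N w \<le> \<epsilon>" "\<not> (\<forall>i<N. \<bar>X i w - centre w i\<bar> \<le> 2 * a)"
    | "\<exists>m\<le>N. \<bar>centred_sum m w\<bar> > 8 * a" "exit_prob a N w \<le> \<epsilon>" "\<forall>i<N. \<bar>X i w - centre w i\<bar> \<le> 2 * a"
    by argo
  then show ?thesis
  proof cases
    case 1
    then have "?l = 0" by (simp only: of_bool_eq)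
    then show ?thesis using E0 J0 W0 by linarith
  next
    case 2
    then have "1 \<le> ?E" using e by (simp add: field_simps)
    moreover have "?l \<le> 1" by simp
    ultimately show ?thesis using J0 W0 by linarith
  next
    case 3
    then obtain i where i: "i < N" "2 * a < \<bar>X i w - centre w i\<bar>" by (auto simp: not_le)
    have "exit_prob a (Suc i) w \<le> \<epsilon>"
      using weights.exitp_mono[OF weights_p, of "Suc i" N w "centre w" a 0 0] 3(1) i(1) by (simp only: exit_prob_def) linarith
    then have "1 \<le> (of_bool (exit_prob a (Suc i) w \<le> \<epsilon>) * of_bool (2 * a < \<bar>X i w - centre w i\<bar>) :: real)"
      using i by simp
    also have "\<dots> \<le> ?J" using i by (intro member_le_sum) auto
    finally have "1 \<le> ?J" .
    moreover have "?l \<le> 1" by simp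
    ultimately show ?thesis using E0 W0 by linarith
  next
    case 4
    then obtain m where m: "m \<le> N" "\<bar>centred_sum m w\<bar> > 8 * a" by blast
    interpret weights V "p w" by (rule weights_p)
    have "exp (2 * k) \<le> 2 * (weight a \<epsilon> (k / a) N w + weight a \<epsilon> (- (k / a)) N w)"
      unfolding weight_def factor_def
      by (rule crossing_weight[where m = m]) (use 4(2,3) m a e in \<open>auto simp: exit_prob_def centred_sum_def\<close>)
    then have "exp (2 * k) * exp (- (2 * k)) \<le> 2 * (weight a \<epsilon> (k / a) N w + weight a \<epsilon> (- (k / a)) N w) * exp (- (2 * k))"
      by (rule mult_right_mono) simp
    moreover have "exp (2 * k) * exp (- (2 * k)) = 1" by (rule exp_minus_inverse)
    ultimately have "1 \<le> 2 * exp (- (2 * k)) * (weight a \<epsilon> (k / a) N w + weight a \<epsilon> (- (k / a)) N w)"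
      by (simp only: mult.commute mult.left_commute)
    moreover have "(\<exists>m\<le>N. \<bar>centred_sum m w\<bar> > 2 * a)" using m a by (intro exI[of _ m]) auto
    ultimately have "1 \<le> ?W" by simp
    moreover have "?l \<le> 1" by simp
    ultimately show ?thesis using E0 J0 by linarith
  qed
qed

text \<open>At level \<open>a / 4\<close> the maximal inequality bounds the exit probability by 8
  times the tail of the walk, for each choice of laws; averaging over the laws produces the tail of
  the decoupled sum.\<close>

lemma exit_prob_expectation:
  assumes "0 \<le> a"
  shows "(\<integral>\<^sup>+ w. ennreal (exit_prob a N w) \<partial>M) \<le> 8 * emeasure M {w \<in> space M. a / 4 < \<bar>\<Sum>i<N. g i w\<bar>}"
proof -
  note [measurable] = g_meas
  let ?e = "\<lambda>w. walk_mean V (p w) 0 N (\<lambda>z. of_bool (a / 4 < \<bar>z\<bar>)) 0"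
  have [measurable]: "?e \<in> borel_measurable M"
    by (rule borel_measurable_walk_mean[OF finite_V]) (rule F_measurable_M[OF p_meas])
  have "(\<integral>\<^sup>+ w. ennreal (exit_prob a N w) \<partial>M) \<le> (\<integral>\<^sup>+ w. 8 * ennreal (?e w) \<partial>M)"
  proof (rule nn_integral_mono)
    fix w
    have "exit_prob a N w \<le> 8 * ?e w"
      using weights.exit_le_tail[OF weights_p, of "a / 4" w N] assms
      by (simp add: exit_prob_def centre_def[abs_def])
    then have "ennreal (exit_prob a N w) \<le> ennreal (8 * ?e w)" by (rule ennreal_leI)
    then show "ennreal (exit_prob a N w) \<le> 8 * ennreal (?e w)" by (simp add: ennreal_mult')
  qed
  also have "\<dots> = 8 * (\<integral>\<^sup>+ w. ennreal (?e w) \<partial>M)" by (rule nn_integral_cmult) measurable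
  also have "(\<integral>\<^sup>+ w. ennreal (?e w) \<partial>M) = (\<integral>\<^sup>+ w. ennreal (of_bool (a / 4 < \<bar>\<Sum>i<N. g i w\<bar>)) \<partial>M)"
    by (rule g_law_walk_mean[symmetric]) auto
  also have "\<dots> = (\<integral>\<^sup>+ w. indicator {w \<in> space M. a / 4 < \<bar>\<Sum>i<N. g i w\<bar>} w \<partial>M)"
    by (rule nn_integral_cong) (simp add: indicator_def)
  also have "\<dots> = emeasure M {w \<in> space M. a / 4 < \<bar>\<Sum>i<N. g i w\<bar>}"
    by (rule nn_integral_indicator) measurable
  finally show ?thesis .
qed

text \<open>Whether the exit probability with index \<open>Suc i\<close> is small is known before
  step \<open>i\<close>, so the indicator of a large step may be replaced by its conditional
  probability.\<close>

lemma gated_jump_step: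
  "(\<integral>\<^sup>+ w. ennreal (of_bool (exit_prob a (Suc i) w \<le> \<epsilon>) * of_bool (2 * a < \<bar>X i w - centre w i\<bar>)) \<partial>M)
   = (\<integral>\<^sup>+ w. ennreal (of_bool (exit_prob a (Suc i) w \<le> \<epsilon>) * jump V (p w) (centre w) a i) \<partial>M)"
proof -
  let ?\<phi> = "\<lambda>v w. of_bool (exit_prob a (Suc i) w \<le> \<epsilon>) * of_bool (2 * a < \<bar>v - centre w i\<bar>) :: real"
  have [measurable]: "exit_prob a (Suc i) \<in> borel_measurable (F i)" by (rule exit_prob_measurable) simp
  have [measurable]: "(\<lambda>w. centre w i) \<in> borel_measurable (F i)" by (rule centre_measurable) simp
  have "?\<phi> v \<in> borel_measurable (F i)" for v by measurable
  then have "(\<integral>\<^sup>+ w. ennreal (?\<phi> (X i w) w) \<partial>M) = (\<integral>\<^sup>+ w. ennreal (\<Sum>v\<in>V. p w i v * ?\<phi> v w) \<partial>M)"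
    by (rule X_average) simp
  also have "(\<lambda>w. \<Sum>v\<in>V. p w i v * ?\<phi> v w) = (\<lambda>w. of_bool (exit_prob a (Suc i) w \<le> \<epsilon>) * jump V (p w) (centre w) a i)"
    by (rule ext) (simp add: jump_def sum_distrib_left mult.left_commute)
  finally show ?thesis .
qed

lemma gated_jump_expectation:
  assumes "0 \<le> a" "\<epsilon> \<le> 1 / 2"
  shows "(\<integral>\<^sup>+ w. ennreal (\<Sum>i<N. of_bool (exit_prob a (Suc i) w \<le> \<epsilon>) * of_bool (2 * a < \<bar>X i w - centre w i\<bar>)) \<partial>M)
    \<le> 2 * (\<integral>\<^sup>+ w. ennreal (exit_prob a N w) \<partial>M)"
proof -
  note [measurable] = F_measurable_M[OF exit_prob_measurable[OF order.refl]] F_measurable_M[OF X_meas]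
    F_measurable_M[OF centre_measurable[OF order.refl]] F_measurable_M[OF jump_measurable]
  have [measurable]: "exit_prob a N \<in> borel_measurable M"
    by (rule F_measurable_M[OF exit_prob_measurable[of N N]]) simp
  have "(\<integral>\<^sup>+ w. ennreal (\<Sum>i<N. of_bool (exit_prob a (Suc i) w \<le> \<epsilon>) * of_bool (2 * a < \<bar>X i w - centre w i\<bar>)) \<partial>M)
    = (\<integral>\<^sup>+ w. (\<Sum>i<N. ennreal (of_bool (exit_prob a (Suc i) w \<le> \<epsilon>) * of_bool (2 * a < \<bar>X i w - centre w i\<bar>))) \<partial>M)"
    by (intro nn_integral_cong sum_ennreal[symmetric]) auto
  also have "\<dots> = (\<Sum>i<N. \<integral>\<^sup>+ w. ennreal (of_bool (exit_prob a (Suc i) w \<le> \<epsilon>) * of_bool (2 * a < \<bar>X i w - centre w i\<bar>)) \<partial>M)"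
    by (rule nn_integral_sum) measurable
  also have "\<dots> = (\<Sum>i<N. \<integral>\<^sup>+ w. ennreal (of_bool (exit_prob a (Suc i) w \<le> \<epsilon>) * jump V (p w) (centre w) a i) \<partial>M)"
    by (rule sum.cong[OF refl]) (rule gated_jump_step)
  also have "\<dots> = (\<integral>\<^sup>+ w. (\<Sum>i<N. ennreal (of_bool (exit_prob a (Suc i) w \<le> \<epsilon>) * jump V (p w) (centre w) a i)) \<partial>M)"
    by (rule nn_integral_sum[symmetric]) measurable
  also have "\<dots> \<le> (\<integral>\<^sup>+ w. 2 * ennreal (exit_prob a N w) \<partial>M)"
  proof (rule nn_integral_mono)
    fix w
    interpret weights V "p w" by (rule weights_p)
    have jnn: "0 \<le> jump V (p w) (centre w) a i" for i unfolding jump_def by (intro sum_nonneg) (simp add: p_nn)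
    have "(\<Sum>i<N. ennreal (of_bool (exit_prob a (Suc i) w \<le> \<epsilon>) * jump V (p w) (centre w) a i))
       = ennreal (\<Sum>i<N. of_bool (exit_prob a (Suc i) w \<le> \<epsilon>) * jump V (p w) (centre w) a i)"
      using jnn by (intro sum_ennreal) auto
    also have "\<dots> \<le> ennreal (2 * exit_prob a N w)"
      unfolding exit_prob_def by (intro ennreal_leI gated_jumps_le assms)
    finally show "(\<Sum>i<N. ennreal (of_bool (exit_prob a (Suc i) w \<le> \<epsilon>) * jump V (p w) (centre w) a i))
       \<le> 2 * ennreal (exit_prob a N w)" by (simp add: ennreal_mult')
  qed
  also have "\<dots> = 2 * (\<integral>\<^sup>+ w. ennreal (exit_prob a N w) \<partial>M)" by (rule nn_integral_cmult) measurable
  finally show ?thesis .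
qed

text \<open>The expected exit probability is used \<open>1 / \<epsilon>\<close> times for its own
  largeness and twice for the large steps, each time at the price of a factor 8. The two weights,
  with coefficient \<open>2 * exp (- (2 * k))\<close> each, give
  \<open>4 * exp (- (2 * k))\<close>.\<close>

lemma good_lambda:
  assumes a: "0 < a" "0 \<le> k" and e: "0 < \<epsilon>" "\<epsilon> \<le> 1 / 2" "exp (4 * k) * \<epsilon> \<le> 1 / 2"
  shows "emeasure M {w \<in> space M. \<exists>m\<le>N. \<bar>centred_sum m w\<bar> > 8 * a}
    \<le> ennreal (4 * exp (- (2 * k))) * emeasure M {w \<in> space M. \<exists>m\<le>N. \<bar>centred_sum m w\<bar> > 2 * a}
      + ennreal (8 * (2 + 1 / \<epsilon>)) * emeasure M {w \<in> space M. a / 4 < \<bar>\<Sum>i<N. g i w\<bar>}"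
proof -
  note [measurable] = F_measurable_M[OF exit_prob_measurable[OF order.refl]] F_measurable_M[OF X_meas]
    F_measurable_M[OF centre_measurable[OF order.refl]]
    F_measurable_M[OF centred_sum_measurable[OF order.refl]] F_measurable_M[OF weight_measurable]
  have [measurable]: "exit_prob a N \<in> borel_measurable M"
    by (rule F_measurable_M[OF exit_prob_measurable[of N N]]) simp
  let ?J = "\<lambda>w. \<Sum>i<N. of_bool (exit_prob a (Suc i) w \<le> \<epsilon>) * of_bool (2 * a < \<bar>X i w - centre w i\<bar>) :: real"
  let ?W = "\<lambda>\<theta> w. weight a \<epsilon> \<theta> N w * of_bool (\<exists>m\<le>N. \<bar>centred_sum m w\<bar> > 2 * a)"
  let ?P2 = "emeasure M {w \<in> space M. \<exists>m\<le>N. \<bar>centred_sum m w\<bar> > 2 * a}"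
  let ?E = "\<integral>\<^sup>+ w. ennreal (exit_prob a N w) \<partial>M"
  let ?c = "2 * exp (- (2 * k))"
  have "emeasure M {w \<in> space M. \<exists>m\<le>N. \<bar>centred_sum m w\<bar> > 8 * a}
      = (\<integral>\<^sup>+ w. indicator {w \<in> space M. \<exists>m\<le>N. \<bar>centred_sum m w\<bar> > 8 * a} w \<partial>M)"
    by (rule nn_integral_indicator[symmetric]) measurable
  also have "\<dots> \<le> (\<integral>\<^sup>+ w. ennreal (1 / \<epsilon>) * ennreal (exit_prob a N w) + ennreal (?J w)
       + ennreal ?c * (ennreal (?W (k / a) w) + ennreal (?W (- (k / a)) w)) \<partial>M)"
  proof (rule nn_integral_mono)
    fix w assume "w \<in> space M"
    have nn: "0 \<le> exit_prob a N w" "0 \<le> ?J w" "\<And>\<theta>. 0 \<le> ?W \<theta> w"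
      using weights.exitp_nn[OF weights_p] weight_nn by (auto simp: exit_prob_def intro!: sum_nonneg)
    have "indicator {w \<in> space M. \<exists>m\<le>N. \<bar>centred_sum m w\<bar> > 8 * a} w \<le> ennreal (of_bool (\<exists>m\<le>N. \<bar>centred_sum m w\<bar> > 8 * a))"
      by (auto simp: indicator_def)
    also have "\<dots> \<le> ennreal (1 / \<epsilon> * exit_prob a N w + ?J w + ?c * (?W (k / a) w + ?W (- (k / a)) w))"
      by (intro ennreal_leI good_lambda_pointwise[OF a e(1) _ e(3)]) (use e(2) in simp)
    also have "\<dots> = ennreal (1 / \<epsilon>) * ennreal (exit_prob a N w) + ennreal (?J w)
       + ennreal ?c * (ennreal (?W (k / a) w) + ennreal (?W (- (k / a)) w))"
    proof -
      have "ennreal (c * x + y + d * (u + v)) = ennreal c * ennreal x + ennreal y + ennreal d * (ennreal u + ennreal v)"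
        if "0 \<le> c" "0 \<le> x" "0 \<le> y" "0 \<le> d" "0 \<le> u" "0 \<le> v" for c x y d u v :: real
        using that by (simp add: ennreal_mult)
      note split = this show ?thesis by (rule split) (use e(1) nn in simp_all)
    qed
    finally show "indicator {w \<in> space M. \<exists>m\<le>N. \<bar>centred_sum m w\<bar> > 8 * a} w \<le> ennreal (1 / \<epsilon>) * ennreal (exit_prob a N w) + ennreal (?J w)
       + ennreal ?c * (ennreal (?W (k / a) w) + ennreal (?W (- (k / a)) w))" .
  qed
  also have "\<dots> = ennreal (1 / \<epsilon>) * ?E + (\<integral>\<^sup>+ w. ennreal (?J w) \<partial>M)
       + ennreal ?c * ((\<integral>\<^sup>+ w. ennreal (?W (k / a) w) \<partial>M) + (\<integral>\<^sup>+ w. ennreal (?W (- (k / a)) w) \<partial>M))"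
    by (simp add: nn_integral_add nn_integral_cmult del: of_bool_eq_1_iff)
  also have "\<dots> \<le> ennreal (1 / \<epsilon>) * ?E + 2 * ?E + ennreal ?c * (?P2 + ?P2)"
    unfolding weight_on_crossing using gated_jump_expectation[of a \<epsilon> N] a e
    by (intro add_mono order.refl) auto
  also have "\<dots> = ennreal (2 + 1 / \<epsilon>) * ?E + ennreal (4 * exp (- (2 * k))) * ?P2"
  proof -
    have "ennreal (2 + 1 / \<epsilon>) = 2 + ennreal (1 / \<epsilon>)" using e(1) by (subst ennreal_plus) auto
    moreover have "ennreal ?c * (?P2 + ?P2) = ennreal (4 * exp (- (2 * k))) * ?P2"
    proof -
      have "ennreal (4 * exp (- (2 * k))) = ennreal (?c + ?c)" by simp
      also have "\<dots> = ennreal ?c + ennreal ?c" by (subst ennreal_plus) auto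
      finally show ?thesis by (simp only: distrib_left distrib_right)
    qed
    ultimately show ?thesis by (simp add: distrib_left distrib_right add_ac)
  qed
  also have "\<dots> \<le> ennreal (2 + 1 / \<epsilon>) * (8 * emeasure M {w \<in> space M. a / 4 < \<bar>\<Sum>i<N. g i w\<bar>})
      + ennreal (4 * exp (- (2 * k))) * ?P2"
    using exit_prob_expectation[of a N] a by (intro add_mono mult_left_mono) auto
  also have "\<dots> = ennreal (4 * exp (- (2 * k))) * ?P2
      + ennreal (8 * (2 + 1 / \<epsilon>)) * emeasure M {w \<in> space M. a / 4 < \<bar>\<Sum>i<N. g i w\<bar>}"
  proof -
    have "ennreal (8 * (2 + 1 / \<epsilon>)) = ennreal (2 + 1 / \<epsilon>) * 8"
    proof -
      have "ennreal (8 * x) = ennreal x * 8" for x :: real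
        using ennreal_mult''[of 8 x] by (simp add: mult.commute)
      then show ?thesis .
    qed
    then show ?thesis by (simp only: mult.assoc add.commute)
  qed
  finally show ?thesis .
qed

end

section \<open>Growth of functions in the class and the numerical constant\<close>

lemma class_F_mono: "\<Phi> \<in> class_F q \<Longrightarrow> 0 \<le> x \<Longrightarrow> x \<le> y \<Longrightarrow> \<Phi> x \<le> \<Phi> y"
  by (auto simp: class_F_def mono_on_def)

lemma class_F_nn: "\<Phi> \<in> class_F q \<Longrightarrow> 0 \<le> x \<Longrightarrow> 0 \<le> \<Phi> x"
  by (auto simp: class_F_def)

lemma class_F_scale: "\<Phi> \<in> class_F q \<Longrightarrow> 0 \<le> x \<Longrightarrow> 2 \<le> c \<Longrightarrow> \<Phi> (c * x) \<le> c powr q * \<Phi> x"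
  by (auto simp: class_F_def)

lemma class_F_add:
  assumes \<Phi>: "\<Phi> \<in> class_F q" and "0 \<le> x" "0 \<le> y"
  shows "\<Phi> (x + y) \<le> 2 powr q * (\<Phi> x + \<Phi> y)"
proof -
  have "\<Phi> (x + y) \<le> \<Phi> (2 * max x y)" using assms by (intro class_F_mono[OF \<Phi>]) auto
  also have "\<dots> \<le> 2 powr q * \<Phi> (max x y)" using assms by (intro class_F_scale[OF \<Phi>]) auto
  also have "\<dots> \<le> 2 powr q * (\<Phi> x + \<Phi> y)"
    using class_F_nn[OF \<Phi>] assms by (intro mult_left_mono) (auto simp: max_def)
  finally show ?thesis .
qed

text \<open>After expansion the largest base is \<open>2 * 4 * 8 * 4 * 4 = 1024\<close>, and the
  coefficients add up to \<open>32 + 2048 + 2 = 2082\<close>; 4000 dominates both.\<close>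

lemma constant_bound:
  fixes q :: real
  assumes "0 < q"
  shows "2 powr q * (4 powr q * (2 * (8 * (2 + 2 * (8 * 4 powr q)^2))) * 8 powr q + 2) \<le> 4000 powr (1 + q)"
proof -
  have 1: "2 powr q * 4 powr q * 8 powr q = 64 powr q" by (simp flip: powr_mult)
  have 2: "2 powr q * 4 powr q * 8 powr q * (4 powr q * 4 powr q) = 1024 powr q" by (simp flip: powr_mult)
  have "2 powr q * (4 powr q * (2 * (8 * (2 + 2 * (8 * 4 powr q)^2))) * 8 powr q + 2)
      = 32 * (2 powr q * 4 powr q * 8 powr q) + 2048 * (2 powr q * 4 powr q * 8 powr q * (4 powr q * 4 powr q)) + 2 * 2 powr q"
    by (simp add: power2_eq_square algebra_simps)
  also have "\<dots> = 32 * 64 powr q + 2048 * 1024 powr q + 2 * 2 powr q" unfolding 2 unfolding 1 ..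
  also have "\<dots> \<le> 32 * 4000 powr q + 2048 * 4000 powr q + 2 * 4000 powr q"
    using assms by (intro add_mono mult_left_mono powr_mono2) auto
  also have "\<dots> \<le> 4000 * 4000 powr q" by simp
  also have "\<dots> = 4000 powr (1 + q)" by (simp add: powr_add)
  finally show ?thesis .
qed

section \<open>Integration of the good-\<lambda> inequality\<close>

context decoupled_core
begin

text \<open>Where the median of a walk exceeds \<open>l\<close> in absolute value, so does the walk
  with probability at least one half; this is averaged over the laws.\<close>

lemma median_tail:
  assumes "0 < l"
  shows "emeasure M {w \<in> space M. l < \<bar>med V (p w) N\<bar>} \<le> 2 * emeasure M {w \<in> space M. l < \<bar>\<Sum>i<N. g i w\<bar>}"
proof -
  note g_meas[measurable]
  let ?e = "\<lambda>w. walk_mean V (p w) 0 N (\<lambda>z. of_bool (l < \<bar>z\<bar>)) 0"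
  have pm: "(\<lambda>w. p w i v) \<in> borel_measurable M" if "v \<in> V" for i v
    by (rule F_measurable_M[OF p_meas[OF that]])
  have [measurable]: "?e \<in> borel_measurable M"
    by (rule borel_measurable_walk_mean[OF finite_V]) (rule pm)
  have [measurable]: "(\<lambda>w. med V (p w) N) \<in> borel_measurable M"
    by (rule borel_measurable_med[OF finite_V]) (rule pm)
  have "emeasure M {w \<in> space M. l < \<bar>med V (p w) N\<bar>} = (\<integral>\<^sup>+ w. indicator {w \<in> space M. l < \<bar>med V (p w) N\<bar>} w \<partial>M)"
    by (rule nn_integral_indicator[symmetric]) measurable
  also have "\<dots> \<le> (\<integral>\<^sup>+ w. 2 * ennreal (?e w) \<partial>M)"
  proof (rule nn_integral_mono)
    fix w
    have "1 \<le> 2 * ennreal (?e w)" if "l < \<bar>med V (p w) N\<bar>"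
    proof -
      have "1 \<le> 2 * ?e w" using weights.tail_of_median[OF weights_p that] by simp
      then have "ennreal 1 \<le> ennreal (2 * ?e w)" by (rule ennreal_leI)
      then show ?thesis by (simp add: ennreal_mult')
    qed
    then show "indicator {w \<in> space M. l < \<bar>med V (p w) N\<bar>} w \<le> 2 * ennreal (?e w)"
      by (simp add: indicator_def)
  qed
  also have "\<dots> = 2 * (\<integral>\<^sup>+ w. ennreal (?e w) \<partial>M)" by (rule nn_integral_cmult) measurable
  also have "(\<integral>\<^sup>+ w. ennreal (?e w) \<partial>M) = (\<integral>\<^sup>+ w. ennreal (of_bool (l < \<bar>\<Sum>i<N. g i w\<bar>)) \<partial>M)"
    by (rule g_law_walk_mean[symmetric]) auto
  also have "\<dots> = (\<integral>\<^sup>+ w. indicator {w \<in> space M. l < \<bar>\<Sum>i<N. g i w\<bar>} w \<partial>M)"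
    by (rule nn_integral_cong) (simp add: indicator_def)
  also have "\<dots> = emeasure M {w \<in> space M. l < \<bar>\<Sum>i<N. g i w\<bar>}"
    by (rule nn_integral_indicator) measurable
  finally show ?thesis .
qed

definition smax :: "nat \<Rightarrow> 'a \<Rightarrow> real" where
  "smax N w = Max ((\<lambda>m. \<bar>centred_sum m w\<bar>) ` {..N})"

lemma smax_gt: "c < smax N w \<longleftrightarrow> (\<exists>m\<le>N. c < \<bar>centred_sum m w\<bar>)"
  unfolding smax_def by (subst Max_gr_iff) auto

lemma centred_sum_le_smax: "\<bar>centred_sum N w\<bar> \<le> smax N w"
  unfolding smax_def by (intro Max_ge) auto

lemma smax_tail:
  assumes "0 < l" "0 < q"
  shows "emeasure M {w \<in> space M. l < smax N w / 4}
    \<le> ennreal (1 / (2 * 4 powr q)) * emeasure M {w \<in> space M. l < smax N w}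
      + ennreal (8 * (2 + 2 * (8 * 4 powr q)^2)) * emeasure M {w \<in> space M. l < 8 * \<bar>\<Sum>i<N. g i w\<bar>}"
proof -
  \<comment> \<open>\<open>u\<close> is chosen so that the coefficient
    \<open>4 * exp (- (2 * k)) = 4 / u\<close> is half of what the growth factor
    \<open>4 powr q\<close> allows; \<epsilon> is then the largest number with
    \<open>exp (4 * k) * \<epsilon> \<le> 1 / 2\<close>.\<close>
  define u where "u = 8 * 4 powr q"
  define k where "k = ln u / 2"
  define \<epsilon> where "\<epsilon> = 1 / (2 * u^2)"
  have "1 \<le> 4 powr q" using assms by (intro ge_one_powr_ge_zero) auto
  then have u: "1 \<le> u" by (simp add: u_def)
  have k0: "0 \<le> k" using u by (simp add: k_def)
  have e2: "exp (2 * k) = u" using u by (simp add: k_def)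
  have "exp (4 * k) = exp (2 * k) * exp (2 * k)" by (simp flip: exp_add)
  then have e4: "exp (4 * k) = u^2" by (simp add: e2 power2_eq_square)
  have u2: "1 \<le> u^2" using u by simp
  have eps: "0 < \<epsilon>" "\<epsilon> \<le> 1 / 2" "exp (4 * k) * \<epsilon> \<le> 1 / 2"
  proof -
    have "1 / u^2 \<le> 1 / 1" using u2 by (intro divide_left_mono) auto
    then show "\<epsilon> \<le> 1 / 2" by (simp add: \<epsilon>_def)
    show "0 < \<epsilon>" using u by (simp add: \<epsilon>_def)
    show "exp (4 * k) * \<epsilon> \<le> 1 / 2" using u by (simp add: e4 \<epsilon>_def)
  qed
  have c1: "4 * exp (- (2 * k)) = 1 / (2 * 4 powr q)" 
  proof -
    have "exp (- (2 * k)) = inverse u" by (simp only: exp_minus e2)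
    then show ?thesis by (simp add: u_def field_simps)
  qed
  have c2: "1 / \<epsilon> = 2 * (8 * 4 powr q)^2" by (simp add: \<epsilon>_def u_def)
  \<comment> \<open>With \<open>a = l / 2\<close> the three thresholds are
    \<open>8 * a = 4 * l\<close>, \<open>2 * a = l\<close> and \<open>a / 4 = l / 8\<close>.\<close>
  have s1: "{w \<in> space M. l < smax N w / 4} = {w \<in> space M. \<exists>m\<le>N. 8 * (l / 2) < \<bar>centred_sum m w\<bar>}"
    by (simp only: smax_gt[symmetric]) auto
  have s2: "{w \<in> space M. l < smax N w} = {w \<in> space M. \<exists>m\<le>N. 2 * (l / 2) < \<bar>centred_sum m w\<bar>}"
    by (simp only: smax_gt[symmetric]) simp
  have s3: "{w \<in> space M. l < 8 * \<bar>\<Sum>i<N. g i w\<bar>} = {w \<in> space M. l / 2 / 4 < \<bar>\<Sum>i<N. g i w\<bar>}"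
    by auto
  have "emeasure M {w \<in> space M. l < smax N w / 4}
    \<le> ennreal (4 * exp (- (2 * k))) * emeasure M {w \<in> space M. l < smax N w}
      + ennreal (8 * (2 + 1 / \<epsilon>)) * emeasure M {w \<in> space M. l < 8 * \<bar>\<Sum>i<N. g i w\<bar>}"
    unfolding s1 s2 s3 by (rule good_lambda) (use assms k0 eps in auto)
  then show ?thesis unfolding c1 c2 .
qed

lemma bounded_integral_finite:
  assumes "\<And>w. w \<in> space M \<Longrightarrow> h w \<le> R"
  shows "(\<integral>\<^sup>+ w. ennreal (h w) \<partial>M) < \<top>"
proof -
  have "(\<integral>\<^sup>+ w. ennreal (h w) \<partial>M) \<le> (\<integral>\<^sup>+ w. ennreal R \<partial>M)"
    using assms by (intro nn_integral_mono ennreal_leI)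
  also have "\<dots> < \<top>" by (simp add: emeasure_space_1)
  finally show ?thesis .
qed

text \<open>Let \<open>x\<close>, \<open>y\<close>, \<open>z\<close> be the integrals for
  \<open>smax / 4\<close>, \<open>smax\<close> and 8 times the decoupled sum. Growth of \<Phi> gives
  \<open>y \<le> u * x\<close> and the tail inequality gives
  \<open>x \<le> y / (2 * u) + \<beta> * z\<close>, so \<open>x \<le> x / 2 + \<beta> * z\<close>.
  Absorbing \<open>x / 2\<close> requires \<open>x\<close> to be finite, which the bound
  \<open>R\<close> on \<Phi> ensures.\<close>

lemma smax_integral:
  assumes q: "0 < q" and \<Phi>: "\<Phi> \<in> class_F q" and bdd: "\<And>x. 0 \<le> x \<Longrightarrow> \<Phi> x \<le> R"
  shows "(\<integral>\<^sup>+ w. ennreal (\<Phi> (smax N w)) \<partial>M)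
    \<le> ennreal (4 powr q * (2 * (8 * (2 + 2 * (8 * 4 powr q)^2))) * 8 powr q)
        * (\<integral>\<^sup>+ w. ennreal (\<Phi> \<bar>\<Sum>i<N. g i w\<bar>) \<partial>M)"
proof -
  define \<beta> where "\<beta> = 8 * (2 + 2 * (8 * 4 powr q)^2)"
  define u where "u = 4 powr q"
  have u: "0 < u" by (simp add: u_def)
  have \<beta>: "0 \<le> \<beta>" by (simp add: \<beta>_def)
  note [measurable] = g_meas
  have dm: "centred_sum m \<in> borel_measurable M" for m by (rule F_measurable_M[OF centred_sum_measurable[OF order.refl]])
  have sm [measurable]: "smax N \<in> borel_measurable M"
    unfolding smax_def[abs_def] by (rule borel_measurable_Max) (auto intro!: borel_measurable_abs dm)
  have s0: "0 \<le> smax N w" for w using centred_sum_le_smax[of N w] by linarith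
  let ?T = "\<lambda>w. \<bar>\<Sum>i<N. g i w\<bar>"
  let ?I = "\<lambda>Z. \<integral>\<^sup>+ w. ennreal (\<Phi> (Z w)) \<partial>M"
  have pow: "?I (\<lambda>w. c * Z w) \<le> ennreal (c powr q) * ?I Z"
    if c: "2 \<le> c" and [measurable]: "Z \<in> borel_measurable M" and Z: "\<And>w. 0 \<le> Z w" for c Z
  proof -
    note [measurable] = borel_measurable_class_F[OF \<Phi>, of Z M]
    have "?I (\<lambda>w. c * Z w) \<le> (\<integral>\<^sup>+ w. ennreal (c powr q) * ennreal (\<Phi> (Z w)) \<partial>M)"
    proof (rule nn_integral_mono)
      fix w
      have "ennreal (\<Phi> (c * Z w)) \<le> ennreal (c powr q * \<Phi> (Z w))"
        by (rule ennreal_leI) (rule class_F_scale[OF \<Phi> Z c])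
      then show "ennreal (\<Phi> (c * Z w)) \<le> ennreal (c powr q) * ennreal (\<Phi> (Z w))" by (simp add: ennreal_mult')
    qed
    also have "\<dots> = ennreal (c powr q) * ?I Z" using Z by (intro nn_integral_cmult) measurable
    finally show ?thesis .
  qed
  have I1: "?I (smax N) \<le> ennreal u * ?I (\<lambda>w. smax N w / 4)"
    using pow[of 4 "\<lambda>w. smax N w / 4"] s0 by (simp add: u_def)
  have J8: "?I (\<lambda>w. 8 * ?T w) \<le> ennreal (8 powr q) * ?I ?T"
    by (rule pow) auto
  have tail: "?I (\<lambda>w. smax N w / 4) \<le> ennreal (1 / (2 * u)) * ?I (smax N) + ennreal \<beta> * ?I (\<lambda>w. 8 * ?T w)"
    unfolding u_def \<beta>_def by (rule tail_comparison[OF \<Phi>]) (use s0 smax_tail[OF _ q] in auto)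
  have fin: "?I Z < \<top>" if "\<And>w. 0 \<le> Z w" for Z
    by (rule bounded_integral_finite[where R = R]) (use that bdd in auto)
  obtain x where x: "?I (\<lambda>w. smax N w / 4) = ennreal x" "0 \<le> x"
    using fin[of "\<lambda>w. smax N w / 4"] s0 by (cases "?I (\<lambda>w. smax N w / 4)") auto
  obtain y where y: "?I (smax N) = ennreal y" "0 \<le> y"
    using fin[of "smax N"] s0 by (cases "?I (smax N)") auto
  obtain z where z: "?I (\<lambda>w. 8 * ?T w) = ennreal z" "0 \<le> z"
    using fin[of "\<lambda>w. 8 * ?T w"] by (cases "?I (\<lambda>w. 8 * ?T w)") auto
  have "ennreal y \<le> ennreal (u * x)" using I1 x y u by (simp add: ennreal_mult)
  then have yx: "y \<le> u * x" using u x by (simp add: ennreal_le_iff)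
  have "ennreal x \<le> ennreal (1 / (2 * u) * y + \<beta> * z)"
  proof -
    have "ennreal (a * y + b * z) = ennreal a * ennreal y + ennreal b * ennreal z" if "0 \<le> a" "0 \<le> b" for a b
      using that y z by (simp add: ennreal_mult)
    from this[of "1 / (2 * u)" \<beta>] show ?thesis using tail u \<beta> unfolding x y z by simp
  qed
  then have "x \<le> 1 / (2 * u) * y + \<beta> * z" 
    by (subst (asm) ennreal_le_iff) (use u y z \<beta> in auto)
  also have "1 / (2 * u) * y \<le> 1 / (2 * u) * (u * x)" using u yx by (intro mult_left_mono) auto
  also have "1 / (2 * u) * (u * x) = x / 2" using u by simp
  finally have "x \<le> 2 * \<beta> * z" by simp
  then have "u * x \<le> u * (2 * \<beta> * z)" using u by (intro mult_left_mono) auto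
  with yx have "y \<le> u * (2 * \<beta>) * z" by simp
  then have "?I (smax N) \<le> ennreal (u * (2 * \<beta>) * z)" unfolding y by (rule ennreal_leI)
  also have "\<dots> = ennreal (u * (2 * \<beta>)) * ?I (\<lambda>w. 8 * ?T w)" using z u \<beta> by (subst ennreal_mult) auto
  also have "\<dots> \<le> ennreal (u * (2 * \<beta>)) * (ennreal (8 powr q) * ?I ?T)" by (rule mult_left_mono[OF J8]) simp
  also have "\<dots> = ennreal (u * (2 * \<beta>) * 8 powr q) * ?I ?T" using u \<beta> by (subst ennreal_mult) (auto simp: mult.assoc)
  finally show ?thesis unfolding u_def \<beta>_def .
qed

text \<open>The sum is the centred sum plus a median. The former is at most its running maximum, the
  latter is compared with the decoupled sum directly, and joining them costs
  \<open>2 powr q\<close>.\<close>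

theorem core_inequality:
  assumes q: "0 < q" and \<Phi>: "\<Phi> \<in> class_F q" and bdd: "\<And>x. 0 \<le> x \<Longrightarrow> \<Phi> x \<le> R"
  shows "(\<integral>\<^sup>+ w. ennreal (\<Phi> \<bar>\<Sum>i<N. X i w\<bar>) \<partial>M)
    \<le> ennreal (4000 powr (1 + q)) * (\<integral>\<^sup>+ w. ennreal (\<Phi> \<bar>\<Sum>i<N. g i w\<bar>) \<partial>M)"
proof -
  let ?A = "4 powr q * (2 * (8 * (2 + 2 * (8 * 4 powr q)^2))) * 8 powr q"
  note [measurable] = g_meas
  have dm: "centred_sum m \<in> borel_measurable M" for m by (rule F_measurable_M[OF centred_sum_measurable[OF order.refl]])
  have [measurable]: "smax N \<in> borel_measurable M"
    unfolding smax_def[abs_def] by (rule borel_measurable_Max) (auto intro!: borel_measurable_abs dm)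
  have [measurable]: "(\<lambda>w. med V (p w) N) \<in> borel_measurable M"
    by (rule borel_measurable_med[OF finite_V]) (rule F_measurable_M[OF p_meas])
  have s0: "0 \<le> smax N w" for w using centred_sum_le_smax[of N w] by linarith
  let ?I = "\<lambda>Z. \<integral>\<^sup>+ w. ennreal (\<Phi> (Z w)) \<partial>M"
  let ?T = "\<lambda>w. \<bar>\<Sum>i<N. g i w\<bar>" and ?D = "\<lambda>w. \<bar>med V (p w) N\<bar>"
  note [measurable] = borel_measurable_class_F[OF \<Phi>, of "smax N" M] borel_measurable_class_F[OF \<Phi>, of ?D M]
  have D: "?I ?D \<le> 2 * ?I ?T"
    using tail_comparison[OF \<Phi>, of ?D ?T ?T 0 2] median_tail by simp
  have "?I (\<lambda>w. \<bar>\<Sum>i<N. X i w\<bar>) \<le> (\<integral>\<^sup>+ w. ennreal (2 powr q) * (ennreal (\<Phi> (smax N w)) + ennreal (\<Phi> (?D w))) \<partial>M)"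
  proof (rule nn_integral_mono)
    fix w
    have "\<Phi> \<bar>\<Sum>i<N. X i w\<bar> \<le> \<Phi> (smax N w + ?D w)"
      unfolding sum_X using centred_sum_le_smax[of N w] by (intro class_F_mono[OF \<Phi>]) auto
    also have "\<dots> \<le> 2 powr q * (\<Phi> (smax N w) + \<Phi> (?D w))"
      using s0 by (intro class_F_add[OF \<Phi>]) auto
    finally have "ennreal (\<Phi> \<bar>\<Sum>i<N. X i w\<bar>) \<le> ennreal (2 powr q * (\<Phi> (smax N w) + \<Phi> (?D w)))"
      by (rule ennreal_leI)
    then show "ennreal (\<Phi> \<bar>\<Sum>i<N. X i w\<bar>) \<le> ennreal (2 powr q) * (ennreal (\<Phi> (smax N w)) + ennreal (\<Phi> (?D w)))"
      using class_F_nn[OF \<Phi>] s0 by (simp add: ennreal_mult')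
  qed
  also have "\<dots> = ennreal (2 powr q) * (?I (smax N) + ?I ?D)"
    using s0 by (simp add: nn_integral_cmult nn_integral_add)
  also have "\<dots> \<le> ennreal (2 powr q) * (ennreal ?A * ?I ?T + 2 * ?I ?T)"
    using smax_integral[OF q \<Phi> bdd, of N] D by (intro mult_left_mono add_mono) auto
  also have "\<dots> = ennreal (2 powr q * (?A + 2)) * ?I ?T"
  proof -
    have "ennreal c * (ennreal A * J + 2 * J) = ennreal (c * (A + 2)) * J" if "0 \<le> A" "0 \<le> c" for A c J
      using that by (simp add: ennreal_mult distrib_right mult.assoc)
    then show ?thesis by simp
  qed
  also have "\<dots> \<le> ennreal (4000 powr (1 + q)) * ?I ?T"
    by (intro mult_right_mono ennreal_leI constant_bound[OF q]) auto
  finally show ?thesis .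
qed

end

section \<open>Reduction to finitely many values\<close>

lemma (in prob_space) sigma_finite_subalgebraI: "subalgebra M A \<Longrightarrow> sigma_finite_subalgebra M A"
  using finite_measure_axioms finite_measure_subalgebra_is_sigma_finite[of M A]
  by (simp add: finite_measure_subalgebra_def finite_measure_subalgebra_axioms_def)

lemma (in prob_space) cond_prob_measurable [measurable]:
  "cond_prob_given M A S \<in> borel_measurable A"
  unfolding cond_prob_given_def by simp

lemma (in prob_space) integrable_indicator': "S \<in> sets M \<Longrightarrow> integrable M (indicator S :: 'a \<Rightarrow> real)"
  by (simp add: emeasure_eq_measure)

lemma (in prob_space) cond_prob_diff:
  assumes A: "subalgebra M A" and S: "S \<in> sets M" "T \<in> sets M" "T \<subseteq> S"
  shows "AE w in M. cond_prob_given M A (S - T) w = cond_prob_given M A S w - cond_prob_given M A T w"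
proof -
  interpret A: sigma_finite_subalgebra M A using sigma_finite_subalgebraI[OF A] .
  have "indicator (S - T) = (\<lambda>w. indicator S w - indicator T w :: real)"
    using S(3) by (auto simp: fun_eq_iff indicator_def)
  then show ?thesis unfolding cond_prob_given_def
    using A.real_cond_exp_diff[OF integrable_indicator'[OF S(1)] integrable_indicator'[OF S(2)]] by simp
qed

lemma (in prob_space) cond_prob_const:
  assumes A: "subalgebra M A" and S: "S \<in> sets A"
  shows "AE w in M. cond_prob_given M A S w = indicator S w"
proof -
  interpret A: sigma_finite_subalgebra M A using sigma_finite_subalgebraI[OF A] .
  have "S \<in> sets M" using A S by (auto simp: subalgebra_def)
  then show ?thesis unfolding cond_prob_given_def
    using S by (intro A.real_cond_exp_F_meas integrable_indicator') auto
qed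

lemma (in prob_space) cond_prob_nonneg:
  assumes A: "subalgebra M A" and S: "S \<in> sets M"
  shows "AE w in M. 0 \<le> cond_prob_given M A S w"
proof -
  interpret A: sigma_finite_subalgebra M A using sigma_finite_subalgebraI[OF A] .
  show ?thesis unfolding cond_prob_given_def using S by (intro A.real_cond_exp_pos) auto
qed

text \<open>For a version \<open>u\<close> that is nonnegative everywhere, the identity that defines
  conditional probabilities can be read as one between nonnegative integrals.\<close>

lemma (in prob_space) emeasure_cond_prob:
  assumes A: "subalgebra M A" and S: "S \<in> sets M" and E: "E \<in> sets A"
    and u: "AE w in M. u w = cond_prob_given M A S w" and u0: "\<And>w. 0 \<le> u w" and [measurable]: "u \<in> borel_measurable M"
  shows "emeasure M (E \<inter> S) = (\<integral>\<^sup>+ w. ennreal (u w) * indicator E w \<partial>M)"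
proof -
  interpret A: sigma_finite_subalgebra M A using sigma_finite_subalgebraI[OF A] .
  have [measurable]: "E \<in> sets M" using A E by (auto simp: subalgebra_def)
  note [measurable] = S
  have [measurable]: "cond_prob_given M A S \<in> borel_measurable M" by (rule measurable_from_subalg[OF A]) measurable
  have int: "integrable M (\<lambda>w. u w * indicator E w)"
  proof -
    have "integrable M (\<lambda>w. cond_prob_given M A S w * indicator E w)"
      unfolding cond_prob_given_def
      by (intro integrable_real_mult_indicator A.real_cond_exp_int integrable_indicator') measurable
    moreover have "AE w in M. cond_prob_given M A S w * indicator E w = u w * indicator E w"
      using u by eventually_elim simp
    ultimately show ?thesis by (subst integrable_cong_AE[where g = "\<lambda>w. cond_prob_given M A S w * indicator E w"]) auto
  qed
  have "(\<integral> w. u w * indicator E w \<partial>M) = (\<integral> w. cond_prob_given M A S w * indicator E w \<partial>M)"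
    by (rule integral_cong_AE) (use u in auto)
  also have "\<dots> = (\<integral> w\<in>E. real_cond_exp M A (indicator S) w \<partial>M)"
    by (simp add: cond_prob_given_def set_lebesgue_integral_def mult.commute)
  also have "\<dots> = (\<integral> w\<in>E. indicator S w \<partial>M)"
    by (rule A.real_cond_exp_intA[symmetric]) (use E S in \<open>auto intro!: integrable_indicator'\<close>)
  also have "\<dots> = measure M (E \<inter> S)"
    by (simp add: set_lebesgue_integral_def flip: indicator_inter_arith)
  finally have "measure M (E \<inter> S) = (\<integral> w. u w * indicator E w \<partial>M)" ..
  then have "emeasure M (E \<inter> S) = ennreal (\<integral> w. u w * indicator E w \<partial>M)"
    by (simp add: emeasure_eq_measure)
  also have "\<dots> = (\<integral>\<^sup>+ w. ennreal (u w * indicator E w) \<partial>M)"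
    using u0 by (intro nn_integral_eq_integral[symmetric] int) auto
  also have "\<dots> = (\<integral>\<^sup>+ w. ennreal (u w) * indicator E w \<partial>M)"
    by (rule nn_integral_cong) (simp add: indicator_def)
  finally show ?thesis .
qed

text \<open>Conditional laws are compared on half-lines only. As \<open>V\<close> is finite, there
  is a level \<open>a < v\<close> with no value of \<open>V\<close> strictly between, and the point
  \<open>v\<close> is the difference of the half-lines at \<open>a\<close> and at
  \<open>v\<close>.\<close>

lemma (in prob_space) same_cond_law_point:
  assumes law: "same_cond_law M f A g B" and A: "subalgebra M A" and B: "subalgebra M B"
    and [measurable]: "f \<in> borel_measurable M" "g \<in> borel_measurable M" and V: "finite V"
    and f: "\<And>w. w \<in> space M \<Longrightarrow> f w \<in> V" and g: "\<And>w. w \<in> space M \<Longrightarrow> g w \<in> V"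
  shows "AE w in M. cond_prob_given M A {y \<in> space M. f y = v} w = cond_prob_given M B {y \<in> space M. g y = v} w"
proof -
  \<comment> \<open>\<open>v - 1\<close> keeps the maximum meaningful when no value of
    \<open>V\<close> lies below \<open>v\<close>.\<close>
  define a where "a = Max (insert (v - 1) {u \<in> V. u < v})"
  have fin: "finite (insert (v - 1) {u \<in> V. u < v})" using V by simp
  have "a \<in> insert (v - 1) {u \<in> V. u < v}" unfolding a_def by (rule Max_in[OF fin]) simp
  then have av: "a < v" by auto
  have gap: "u \<le> a" if "u \<in> V" "u < v" for u
    unfolding a_def by (rule Max_ge[OF fin]) (use that in simp)
  have eq: "{y \<in> space M. h y = v} = {y \<in> space M. h y > a} - {y \<in> space M. h y > v}"
    if "\<And>w. w \<in> space M \<Longrightarrow> h w \<in> V" for h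
  proof (intro set_eqI iffI)
    fix y assume y: "y \<in> {y \<in> space M. h y > a} - {y \<in> space M. h y > v}"
    then have "\<not> h y < v" using gap[of "h y"] that[of y] by auto
    then show "y \<in> {y \<in> space M. h y = v}" using y by auto
  qed (use av in auto)
  have e: "{y \<in> space M. f y = v} = {y \<in> space M. f y > a} - {y \<in> space M. f y > v}"
    "{y \<in> space M. g y = v} = {y \<in> space M. g y > a} - {y \<in> space M. g y > v}"
    using eq f g by auto
  have "AE w in M. cond_prob_given M A {y \<in> space M. f y > a} w = cond_prob_given M B {y \<in> space M. g y > a} w"
    "AE w in M. cond_prob_given M A {y \<in> space M. f y > v} w = cond_prob_given M B {y \<in> space M. g y > v} w"
    using law by (auto simp: same_cond_law_def)
  moreover have "AE w in M. cond_prob_given M A ({y \<in> space M. f y > a} - {y \<in> space M. f y > v}) w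
     = cond_prob_given M A {y \<in> space M. f y > a} w - cond_prob_given M A {y \<in> space M. f y > v} w"
    by (rule cond_prob_diff[OF A]) (use av in auto)
  moreover have "AE w in M. cond_prob_given M B ({y \<in> space M. g y > a} - {y \<in> space M. g y > v}) w
     = cond_prob_given M B {y \<in> space M. g y > a} w - cond_prob_given M B {y \<in> space M. g y > v} w"
    by (rule cond_prob_diff[OF B]) (use av in auto)
  ultimately show ?thesis unfolding e by eventually_elim simp
qed

lemma (in prob_space) cond_prob_total:
  fixes f :: "'a \<Rightarrow> real"
  assumes A: "subalgebra M A" and [measurable]: "f \<in> borel_measurable M" and V: "finite V"
    and f: "\<And>w. w \<in> space M \<Longrightarrow> f w \<in> V"
  shows "AE w in M. (\<Sum>v\<in>V. cond_prob_given M A {y \<in> space M. f y = v} w) = 1"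
proof -
  interpret A: sigma_finite_subalgebra M A using sigma_finite_subalgebraI[OF A] .
  have fv: "{y \<in> space M. f y = v} \<in> sets M" for v
    by (rule borel_measurable_eq[of f M "\<lambda>_. v"]) auto
  have "AE w in M. real_cond_exp M A (\<lambda>w. \<Sum>v\<in>V. indicator {y \<in> space M. f y = v} w) w
      = (\<Sum>v\<in>V. real_cond_exp M A (indicator {y \<in> space M. f y = v}) w)"
    by (intro A.real_cond_exp_sum integrable_indicator' fv)
  moreover have "AE w in M. real_cond_exp M A (\<lambda>w. \<Sum>v\<in>V. indicator {y \<in> space M. f y = v} w) w
      = real_cond_exp M A (\<lambda>w. 1) w"
  proof (rule A.real_cond_exp_cong)
    show "AE w in M. (\<Sum>v\<in>V. indicator {y \<in> space M. f y = v} w) = (1::real)"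
    proof (rule AE_I2)
      fix w assume w: "w \<in> space M"
      have "(\<Sum>v\<in>V. indicator {y \<in> space M. f y = v} w) = (\<Sum>v\<in>V. if v = f w then 1 else 0 :: real)"
        using w by (intro sum.cong) auto
      then show "(\<Sum>v\<in>V. indicator {y \<in> space M. f y = v} w) = (1::real)" using V f[OF w] by simp
    qed
  qed auto
  moreover have "AE w in M. real_cond_exp M A (\<lambda>w. 1) w = 1"
    by (rule A.real_cond_exp_F_meas) auto
  ultimately show ?thesis unfolding cond_prob_given_def by eventually_elim simp
qed

lemma decoupled_versionE:
  assumes "decoupled_version M F f g"
  obtains G where "\<And>n. f (Suc n) \<in> borel_measurable (F (Suc n))" "\<And>n. g (Suc n) \<in> borel_measurable (F (Suc n))"
    "\<And>n. same_cond_law M (f (Suc n)) (F n) (g (Suc n)) (F n)"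
    "subalgebra M G" "\<And>n. same_cond_law M (g (Suc n)) (F n) (g (Suc n)) G" "cond_indep_seq M G g"
proof -
  have c: "(\<forall>n\<ge>1. f n \<in> borel_measurable (F n)) \<and> (\<forall>n\<ge>1. g n \<in> borel_measurable (F n)) \<and>
      (\<forall>n\<ge>1. same_cond_law M (f n) (F (n - 1)) (g n) (F (n - 1)))"
    using assms unfolding decoupled_version_def tangent_seqs_def adapted_seq_def by (rule conjunct1)
  have 1: "f (Suc n) \<in> borel_measurable (F (Suc n))" and 2: "g (Suc n) \<in> borel_measurable (F (Suc n))" for n
    using c[THEN conjunct1] c[THEN conjunct2, THEN conjunct1] by simp_all
  note 3 = c[THEN conjunct2, THEN conjunct2]
  obtain G where G: "subalgebra M G" "\<forall>n\<ge>1. same_cond_law M (g n) (F (n - 1)) (g n) G" "cond_indep_seq M G g"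
    using assms unfolding decoupled_version_def condition_CI_def by (elim conjE exE)
  show thesis
    by (rule that[OF 1 2 _ G(1) _ G(3)])
      (use 3[rule_format, of "Suc _"] G(2)[rule_format, of "Suc _"] in simp_all)
qed

lemma decoupled_versionI:
  assumes "\<And>n. f (Suc n) \<in> borel_measurable (F (Suc n))" "\<And>n. g (Suc n) \<in> borel_measurable (F (Suc n))"
    "\<And>n. same_cond_law M (f (Suc n)) (F n) (g (Suc n)) (F n)"
    "subalgebra M G" "\<And>n. same_cond_law M (g (Suc n)) (F n) (g (Suc n)) G" "cond_indep_seq M G g"
  shows "decoupled_version M F f g"
proof -
  have "\<forall>n\<ge>1. P n" if "\<And>n. P (Suc n)" for P :: "nat \<Rightarrow> bool"
  proof (intro allI impI)
    fix n :: nat assume "1 \<le> n"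
    then show "P n" using that[of "n - 1"] by simp
  qed
  note all = this
  have "adapted_seq F f" "adapted_seq F g" unfolding adapted_seq_def by (rule all, rule assms)+
  moreover have "\<forall>n\<ge>1. same_cond_law M (f n) (F (n - 1)) (g n) (F (n - 1))"
    by (rule all) (simp only: diff_Suc_1 assms)
  moreover have "\<forall>n\<ge>1. same_cond_law M (g n) (F (n - 1)) (g n) G"
    by (rule all) (simp only: diff_Suc_1 assms)
  ultimately show ?thesis
    unfolding decoupled_version_def tangent_seqs_def condition_CI_def using assms(4,6)
    by (intro conjI exI[of _ G])
qed

text \<open>Tangency equates the law of \<open>f\<close> given the past with that of
  \<open>g\<close> given the past, and condition (CI) equates the latter with the law of
  \<open>g\<close> given \<open>G\<close>. So a single \<open>p\<close> is both the predictable law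
  of \<open>f\<close> and the law of the conditionally independent \<open>g\<close>.\<close>

lemma finite_valued_inequality:
  fixes M :: "'a measure"
  assumes filt: "filtered_prob_space M F" and dec: "decoupled_version M F f g" and V: "finite V"
    and f: "\<And>n w. 1 \<le> n \<Longrightarrow> w \<in> space M \<Longrightarrow> f n w \<in> V"
    and g: "\<And>n w. 1 \<le> n \<Longrightarrow> w \<in> space M \<Longrightarrow> g n w \<in> V"
    and \<Phi>: "0 < q" "\<Phi> \<in> class_F q" "\<And>x. 0 \<le> x \<Longrightarrow> \<Phi> x \<le> R"
  shows "(\<integral>\<^sup>+ w. ennreal (\<Phi> \<bar>\<Sum>i=1..N. f i w\<bar>) \<partial>M)
    \<le> ennreal (4000 powr (1 + q)) * (\<integral>\<^sup>+ w. ennreal (\<Phi> \<bar>\<Sum>i=1..N. g i w\<bar>) \<partial>M)"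
proof -
  interpret prob_space M using filt by (simp add: filtered_prob_space_def)
  have sub: "subalgebra M (F n)" for n using filt by (simp add: filtered_prob_space_def)
  have "filtration (space M) F" using filt by (simp add: filtered_prob_space_def)
  then have mono: "sets (F m) \<subseteq> sets (F n)" if "m \<le> n" for m n
    using that by (rule filtration.sets_F_mono)
  obtain G where fF: "\<And>n. f (Suc n) \<in> borel_measurable (F (Suc n))" and gF: "\<And>n. g (Suc n) \<in> borel_measurable (F (Suc n))"
    and tang: "\<And>n. same_cond_law M (f (Suc n)) (F n) (g (Suc n)) (F n)"
    and G: "subalgebra M G" "\<And>n. same_cond_law M (g (Suc n)) (F n) (g (Suc n)) G" "cond_indep_seq M G g"
    using dec by (rule decoupled_versionE) blast
  have [measurable]: "f (Suc n) \<in> borel_measurable M" "g (Suc n) \<in> borel_measurable M" for n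
    by (rule measurable_from_subalg[OF sub fF], rule measurable_from_subalg[OF sub gF])
  obtain w0 where "w0 \<in> space M" using not_empty by blast
  then obtain v0 where v0: "v0 \<in> V" using f[of 1 w0] by blast
  define P where "P i v = cond_prob_given M (F i) {y \<in> space M. f (Suc i) y = v}" for i v
  define good where "good i w \<longleftrightarrow> (\<forall>v\<in>V. 0 \<le> P i v w) \<and> (\<Sum>v\<in>V. P i v w) = 1" for i w
  \<comment> \<open>A version of the conditional law that is a probability vector everywhere, not only almost surely.\<close>
  define p where "p w i v = (if good i w then P i v w else of_bool (v = v0))" for w i v
  have [measurable]: "P i v \<in> borel_measurable (F i)" for i v unfolding P_def by measurable
  have goodm: "Measurable.pred (F i) (good i)" for i
    unfolding good_def[abs_def] by (intro pred_intros_logic pred_intros_finite V) measurable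
  have pm: "(\<lambda>w. p w i v) \<in> borel_measurable (F i)" for i v
    unfolding p_def using goodm[of i] by measurable
  have [measurable]: "(\<lambda>w. p w i v) \<in> borel_measurable M" for i v
    by (rule measurable_from_subalg[OF sub pm])
  have AE_good: "AE w in M. good i w" for i
  proof -
    have "AE w in M. \<forall>v\<in>V. 0 \<le> P i v w"
      unfolding P_def by (intro AE_finite_allI V cond_prob_nonneg sub) measurable
    moreover have "AE w in M. (\<Sum>v\<in>V. P i v w) = 1"
      unfolding P_def by (rule cond_prob_total[OF sub _ V]) (use f in auto)
    ultimately show ?thesis unfolding good_def by eventually_elim simp
  qed
  have pP: "AE w in M. p w i v = P i v w" for i v
    using AE_good[of i] by eventually_elim (simp add: p_def)
  have w: "weights V (p w)" for w
  proof
    show "finite V" by (rule V)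
    show "0 \<le> p w i v" if "v \<in> V" for i v using that by (auto simp: p_def good_def)
    show "(\<Sum>v\<in>V. p w i v) = 1" for i
    proof (cases "good i w")
      case True
      then have "(\<Sum>v\<in>V. p w i v) = (\<Sum>v\<in>V. P i v w)" by (simp add: p_def)
      then show ?thesis using True by (simp add: good_def)
    next
      case False
      then have "(\<Sum>v\<in>V. p w i v) = (\<Sum>v\<in>V. if v = v0 then 1 else 0)" by (simp add: p_def of_bool_def)
      then show ?thesis using V v0 by simp
    qed
  qed
  have pnn: "0 \<le> p w i v" if "v \<in> V" for w i v using weights.p_nn[OF w that] .
  have pG: "AE w in M. cond_prob_given M G {y \<in> space M. g (Suc i) y = v} w = p w i v" for i v
  proof -
    have "AE w in M. P i v w = cond_prob_given M (F i) {y \<in> space M. g (Suc i) y = v} w"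
      unfolding P_def by (rule same_cond_law_point[OF tang sub sub _ _ V]) (use f g in auto)
    moreover have "AE w in M. cond_prob_given M (F i) {y \<in> space M. g (Suc i) y = v} w
       = cond_prob_given M G {y \<in> space M. g (Suc i) y = v} w"
      by (rule same_cond_law_point[OF G(2) sub G(1) _ _ V]) (use g in auto)
    ultimately show ?thesis using pP[of i v] by eventually_elim simp
  qed
  interpret decoupled_core M F "\<lambda>i. f (Suc i)" "\<lambda>i. g (Suc i)" p V
  proof
    fix i v A assume v: "v \<in> V" and A: "A \<in> sets (F i)"
    show "emeasure M (A \<inter> {w \<in> space M. f (Suc i) w = v}) = (\<integral>\<^sup>+ w. ennreal (p w i v) * indicator A w \<partial>M)"
    proof (rule emeasure_cond_prob[OF sub _ A])
      show "AE w in M. p w i v = cond_prob_given M (F i) {w \<in> space M. f (Suc i) w = v} w"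
        using pP[of i v] unfolding P_def .
      show "0 \<le> p w i v" for w by (rule pnn[OF v])
    qed measurable
  next
    fix N and u :: "nat \<Rightarrow> real" assume u: "\<And>i. i < N \<Longrightarrow> u i \<in> V"
    \<comment> \<open>Clipping at 0 makes the product nonnegative at every point; it changes nothing
      because \<open>u i \<in> V\<close> for \<open>i < N\<close>.\<close>
    have ae: "AE w in M. (\<Prod>i<N. max 0 (p w i (u i))) = cond_prob_given M G {y \<in> space M. \<forall>i<N. g (Suc i) y = u i} w"
    proof (cases "N = 0")
      \<comment> \<open>Conditional independence is formulated for nonempty index sets; the empty
        product is matched with the conditional probability of the whole space.\<close>
      case True
      have "AE w in M. cond_prob_given M G (space G) w = indicator (space G) w"
        by (rule cond_prob_const[OF G(1) sets.top])
      moreover have "space G = space M" using G(1) by (simp add: subalgebra_def)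
      ultimately have "AE w in M. cond_prob_given M G (space M) w = indicator (space M) w" by simp
      then show ?thesis using AE_space by eventually_elim (simp add: True)
    next
      case False
      have "AE w in M. cond_prob_given M G {y \<in> space M. \<forall>j\<in>Suc ` {..<N}. g j y \<in> {u (j - 1)}} w
                  = (\<Prod>j\<in>Suc ` {..<N}. cond_prob_given M G {y \<in> space M. g j y \<in> {u (j - 1)}} w)"
        by (rule G(3)[unfolded cond_indep_seq_def, rule_format]) (use False in auto)
      moreover have "AE w in M. \<forall>i\<in>{..<N}. cond_prob_given M G {y \<in> space M. g (Suc i) y = u i} w = p w i (u i)"
        by (intro AE_finite_allI pG) simp
      ultimately show ?thesis
      proof eventually_elim
        case (elim w)
        have "{y \<in> space M. \<forall>j\<in>Suc ` {..<N}. g j y \<in> {u (j - 1)}} = {y \<in> space M. \<forall>i<N. g (Suc i) y = u i}" by auto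
        moreover have "(\<Prod>j\<in>Suc ` {..<N}. cond_prob_given M G {y \<in> space M. g j y \<in> {u (j - 1)}} w)
           = (\<Prod>i<N. cond_prob_given M G {y \<in> space M. g (Suc i) y = u i} w)"
          by (subst prod.reindex) auto
        moreover have "\<dots> = (\<Prod>i<N. max 0 (p w i (u i)))"
          using elim(2) pnn[OF u] by (intro prod.cong) auto
        ultimately show ?case using elim(1) by simp
      qed
    qed
    have sG: "space G = space M" using G(1) by (simp add: subalgebra_def)
    have sp: "space M \<in> sets G" unfolding sG[symmetric] by (rule sets.top)
    have "emeasure M (space M \<inter> {y \<in> space M. \<forall>i<N. g (Suc i) y = u i})
       = (\<integral>\<^sup>+ w. ennreal (\<Prod>i<N. max 0 (p w i (u i))) * indicator (space M) w \<partial>M)"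
      by (rule emeasure_cond_prob[OF G(1) _ sp ae]) (auto intro!: prod_nonneg)
    also have "\<dots> = (\<integral>\<^sup>+ w. ennreal (\<Prod>i<N. p w i (u i)) \<partial>M)"
    proof (rule nn_integral_cong)
      fix w assume "w \<in> space M"
      have "(\<Prod>i<N. max 0 (p w i (u i))) = (\<Prod>i<N. p w i (u i))"
        by (intro prod.cong refl max_absorb2 pnn u) simp
      then show "ennreal (\<Prod>i<N. max 0 (p w i (u i))) * indicator (space M) w = ennreal (\<Prod>i<N. p w i (u i))"
        using \<open>w \<in> space M\<close> by simp
    qed
    finally show "emeasure M {w \<in> space M. \<forall>i<N. g (Suc i) w = u i} = (\<integral>\<^sup>+ w. ennreal (\<Prod>i<N. p w i (u i)) \<partial>M)"
      by (simp add: Int_absorb1)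
  qed (simp_all add: sub mono V pnn weights.p_sum[OF w] fF pm f g del: One_nat_def)
  have shift: "(\<Sum>i=1..N. h i) = (\<Sum>i<N. h (Suc i))" for h :: "nat \<Rightarrow> real"
    by (simp add: sum.atLeast1_atMost_eq)
  show ?thesis unfolding shift by (rule core_inequality[OF \<Phi>])
qed

text \<open>Every superlevel set of \<open>rnd m\<close> is a half-line \<open>{t<..}\<close> or trivial; therefore rounding preserves
  \<open>same_cond_law\<close>, which is stated through such half-lines.\<close>

definition rnd :: "nat \<Rightarrow> real \<Rightarrow> real" where
  "rnd m x = max (- real m) (min (real m) (of_int \<lceil>real (Suc m) * x\<rceil> / real (Suc m)))"

lemma rnd_threshold:
  "(\<forall>x. u < rnd m x) \<or> (\<forall>x. \<not> u < rnd m x) \<or> (\<exists>t. \<forall>x. u < rnd m x \<longleftrightarrow> t < x)"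
proof -
  consider "u < - real m" | "real m \<le> u" | "- real m \<le> u" "u < real m" by linarith
  then show ?thesis
  proof cases
    case 1
    then have "\<forall>x. u < rnd m x" by (simp add: rnd_def less_max_iff_disj)
    then show ?thesis ..
  next
    case 2
    have "rnd m x \<le> real m" for x unfolding rnd_def by simp
    then have "\<forall>x. \<not> u < rnd m x" using 2 by (meson leD order_trans)
    then show ?thesis by (intro disjI2 disjI1)
  next
    case 3
    have pos: "0 < real (Suc m)" by simp
    \<comment> \<open>A ceiling exceeds a number exactly when its argument exceeds the floor of that
      number. Rounding upwards therefore gives half-lines that are open on the left, as in
      \<open>same_cond_law\<close>.\<close>
    have "u < rnd m x \<longleftrightarrow> of_int \<lfloor>real (Suc m) * u\<rfloor> / real (Suc m) < x" for x
    proof -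
      have "u < rnd m x \<longleftrightarrow> u < of_int \<lceil>real (Suc m) * x\<rceil> / real (Suc m)"
        using 3 by (simp add: rnd_def less_max_iff_disj)
      also have "\<dots> \<longleftrightarrow> real (Suc m) * u < of_int \<lceil>real (Suc m) * x\<rceil>"
        by (simp only: pos_less_divide_eq[OF pos] mult.commute)
      also have "\<dots> \<longleftrightarrow> of_int \<lfloor>real (Suc m) * u\<rfloor> < real (Suc m) * x"
        by (simp only: floor_less_iff[symmetric] less_ceiling_iff)
      also have "\<dots> \<longleftrightarrow> of_int \<lfloor>real (Suc m) * u\<rfloor> / real (Suc m) < x"
        by (simp only: pos_divide_less_eq[OF pos] mult.commute)
      finally show ?thesis .
    qed
    then show ?thesis by (intro disjI2 exI allI)
  qed
qed

lemma borel_measurable_rnd [measurable]: "rnd m \<in> borel_measurable borel"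
  unfolding rnd_def[abs_def] by measurable

lemma finite_range_rnd: "finite (range (rnd m))"
proof (rule finite_subset)
  let ?k = "int m * int (Suc m)"
  show "range (rnd m) \<subseteq> (\<lambda>j. of_int j / real (Suc m)) ` {- ?k..?k}"
  proof
    fix y assume "y \<in> range (rnd m)"
    then obtain x where x: "y = rnd m x" by blast
    define c where "c = \<lceil>real (Suc m) * x\<rceil>"
    \<comment> \<open>The clipping bounds are themselves multiples of
      \<open>1 / real (Suc m)\<close>, so clipping can be carried out on the integer
      numerators.\<close>
    have m: "real m = of_int ?k / real (Suc m)" by (simp add: field_simps)
    have mono: "mono (\<lambda>j. of_int j / real (Suc m))" by (intro monoI divide_right_mono) auto
    have "y = of_int (max (- ?k) (min ?k c)) / real (Suc m)"
      unfolding x rnd_def c_def[symmetric]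
      by (subst (1 2) m) (simp only: max_of_mono[OF mono] min_of_mono[OF mono] of_int_minus[symmetric] minus_divide_left)
    moreover have "max (- ?k) (min ?k c) \<in> {- ?k..?k}" by auto
    ultimately show "y \<in> (\<lambda>j. of_int j / real (Suc m)) ` {- ?k..?k}" by blast
  qed
qed simp

text \<open>From \<open>\<bar>x\<bar> + 1 \<le> real m\<close> on, clipping is inactive and only a
  rounding error of at most \<open>1 / real (Suc m)\<close> remains.\<close>

lemma rnd_tendsto: "(\<lambda>m. rnd m x) \<longlonglongrightarrow> x"
proof (rule real_tendsto_sandwich)
  have large: "eventually (\<lambda>m. \<bar>x\<bar> + 1 \<le> real m) sequentially"
    by (rule eventually_compose_filterlim[OF eventually_ge_at_top filterlim_real_sequentially])
  have c: "x \<le> rnd m x \<and> rnd m x \<le> x + 1 / real (Suc m)" if "\<bar>x\<bar> + 1 \<le> real m" for m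
  proof -
    define c where "c = of_int \<lceil>real (Suc m) * x\<rceil> / real (Suc m)"
    have pos: "0 < real (Suc m)" by simp
    have "x \<le> c" unfolding c_def pos_le_divide_eq[OF pos] using le_of_int_ceiling[of "real (Suc m) * x"] by (simp only: mult.commute)
    moreover have "c \<le> x + 1 / real (Suc m)"
    proof -
      have "of_int \<lceil>real (Suc m) * x\<rceil> \<le> real (Suc m) * x + 1" by (rule of_int_ceiling_le_add_one)
      then have "c \<le> (real (Suc m) * x + 1) / real (Suc m)" unfolding c_def by (rule divide_right_mono) simp
      also have "\<dots> = x + 1 / real (Suc m)" by (simp add: add_divide_distrib)
      finally show ?thesis .
    qed
    moreover have "1 / real (Suc m) \<le> 1" by simp
    ultimately have "rnd m x = c" unfolding rnd_def c_def[symmetric] using that by linarith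
    then show ?thesis using \<open>x \<le> c\<close> \<open>c \<le> x + 1 / real (Suc m)\<close> by simp
  qed
  show "eventually (\<lambda>m. x \<le> rnd m x) sequentially" using large by eventually_elim (rule c[THEN conjunct1])
  show "eventually (\<lambda>m. rnd m x \<le> x + 1 / real (Suc m)) sequentially" using large by eventually_elim (rule c[THEN conjunct2])
  show "(\<lambda>m. x) \<longlonglongrightarrow> x" by simp
  have "(\<lambda>m. x + 1 / real (Suc m)) \<longlonglongrightarrow> x + 0"
    by (intro tendsto_add tendsto_const LIMSEQ_Suc lim_1_over_n)
  then show "(\<lambda>m. x + 1 / real (Suc m)) \<longlonglongrightarrow> x" by simp
qed

lemma (in prob_space) same_cond_law_rnd:
  assumes law: "same_cond_law M f A g B" and A: "subalgebra M A" and B: "subalgebra M B"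
  shows "same_cond_law M (\<lambda>w. rnd m (f w)) A (\<lambda>w. rnd m (g w)) B"
  unfolding same_cond_law_def
proof
  fix u
  have spc: "space A = space M" "space B = space M" using A B by (simp_all add: subalgebra_def)
  have sp: "space M \<in> sets A" "space M \<in> sets B"
    using sets.top[of A] sets.top[of B] by (simp_all only: spc)
  consider "\<forall>x. u < rnd m x" | "\<forall>x. \<not> u < rnd m x" | t where "\<forall>x. u < rnd m x \<longleftrightarrow> t < x"
    using rnd_threshold[of u m] by blast
  then show "AE x in M. cond_prob_given M A {y \<in> space M. u < rnd m (f y)} x
       = cond_prob_given M B {y \<in> space M. u < rnd m (g y)} x"
  proof cases
    case 1
    then show ?thesis using cond_prob_const[OF A sp(1)] cond_prob_const[OF B sp(2)]
      by (simp add: Collect_mem_eq) (elim AE_mp, auto)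
  next
    case 2
    then show ?thesis using cond_prob_const[OF A sets.empty_sets] cond_prob_const[OF B sets.empty_sets]
      by simp (elim AE_mp, auto)
  next
    case 3
    then show ?thesis using law by (simp add: same_cond_law_def)
  qed
qed

text \<open>Rounding acts on each variable separately, so the same \<open>G\<close> serves:
  preimages of Borel sets under \<open>rnd m\<close> are Borel, and independence passes to
  them.\<close>

lemma decoupled_version_rnd:
  assumes filt: "filtered_prob_space M F" and dec: "decoupled_version M F f g"
  shows "decoupled_version M F (\<lambda>n w. rnd m (f n w)) (\<lambda>n w. rnd m (g n w))"
proof -
  interpret prob_space M using filt by (simp add: filtered_prob_space_def)
  have sub: "subalgebra M (F n)" for n using filt by (simp add: filtered_prob_space_def)
  obtain G where fF: "\<And>n. f (Suc n) \<in> borel_measurable (F (Suc n))" and gF: "\<And>n. g (Suc n) \<in> borel_measurable (F (Suc n))"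
    and tang: "\<And>n. same_cond_law M (f (Suc n)) (F n) (g (Suc n)) (F n)"
    and G: "subalgebra M G" "\<And>n. same_cond_law M (g (Suc n)) (F n) (g (Suc n)) G" "cond_indep_seq M G g"
    using dec by (rule decoupled_versionE) blast
  have ci: "cond_indep_seq M G (\<lambda>n w. rnd m (g n w))"
    unfolding cond_indep_seq_def
  proof (intro allI impI)
    fix J :: "nat set" and B :: "nat \<Rightarrow> real set"
    assume J: "finite J \<and> J \<noteq> {} \<and> J \<subseteq> {1..} \<and> (\<forall>j\<in>J. B j \<in> sets borel)"
    have "rnd m -` B j \<in> sets borel" if "j \<in> J" for j
      using measurable_sets[OF borel_measurable_rnd, of "B j" m] J that by simp
    then have "AE x in M. cond_prob_given M G {y \<in> space M. \<forall>j\<in>J. g j y \<in> rnd m -` B j} x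
       = (\<Prod>j\<in>J. cond_prob_given M G {y \<in> space M. g j y \<in> rnd m -` B j} x)"
      using J by (intro G(3)[unfolded cond_indep_seq_def, rule_format]) simp
    then show "AE x in M. cond_prob_given M G {y \<in> space M. \<forall>j\<in>J. rnd m (g j y) \<in> B j} x
       = (\<Prod>j\<in>J. cond_prob_given M G {y \<in> space M. rnd m (g j y) \<in> B j} x)" by simp
  qed
  show ?thesis
    by (rule decoupled_versionI[where G = G])
      (use fF gF tang G ci sub in \<open>auto intro!: measurable_compose[OF _ borel_measurable_rnd] same_cond_law_rnd\<close>)
qed

section \<open>Limits in the rounding, the number of terms and the truncation level\<close>

lemma class_F_truncate:
  assumes \<Phi>: "\<Phi> \<in> class_F q" and "0 < q" "0 \<le> R"
  shows "(\<lambda>x. min (\<Phi> x) R) \<in> class_F q"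
proof -
  have "min (\<Phi> (c * x)) R \<le> c powr q * min (\<Phi> x) R" if "0 \<le> x" "2 \<le> c" for x c
  proof -
    \<comment> \<open>This is where \<open>0 < q\<close> enters: scaling does not lower the
      truncation level.\<close>
    have "1 \<le> c powr q" using that assms by (intro ge_one_powr_ge_zero) auto
    then have "R \<le> c powr q * R" using assms by (simp add: mult_le_cancel_right1)
    moreover have "\<Phi> (c * x) \<le> c powr q * \<Phi> x" using that by (intro class_F_scale[OF \<Phi>])
    ultimately show ?thesis by (auto simp: min_def)
  qed
  moreover have "continuous_on {0..} (\<lambda>x. min (\<Phi> x) R)"
    using \<Phi> by (intro continuous_intros) (simp add: class_F_def)
  moreover have "mono_on {0..} (\<lambda>x. min (\<Phi> x) R)"
    using class_F_mono[OF \<Phi>] by (intro mono_onI min.mono) auto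
  ultimately show ?thesis using \<Phi> assms by (auto simp: class_F_def)
qed

lemma (in prob_space) class_F_dominated_convergence:
  assumes \<Phi>: "\<Phi> \<in> class_F q" "\<And>x. 0 \<le> x \<Longrightarrow> \<Phi> x \<le> R"
    and [measurable]: "\<And>m. Z m \<in> borel_measurable M" "Y \<in> borel_measurable M"
    and lim: "AE w in M. (\<lambda>m. Z m w) \<longlonglongrightarrow> Y w"
  shows "(\<lambda>m. \<integral>\<^sup>+ w. ennreal (\<Phi> \<bar>Z m w\<bar>) \<partial>M) \<longlonglongrightarrow> (\<integral>\<^sup>+ w. ennreal (\<Phi> \<bar>Y w\<bar>) \<partial>M)"
proof (rule nn_integral_dominated_convergence[where w = "\<lambda>_. ennreal R"])
  have *: "(\<lambda>w. \<Phi> \<bar>h w\<bar>) \<in> borel_measurable M" if [measurable]: "h \<in> borel_measurable M" for h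
    by (rule borel_measurable_class_F[OF \<Phi>(1)]) auto
  show "(\<lambda>w. ennreal (\<Phi> \<bar>Z m w\<bar>)) \<in> borel_measurable M" for m using *[of "Z m"] by simp
  show "(\<lambda>w. ennreal (\<Phi> \<bar>Y w\<bar>)) \<in> borel_measurable M" using *[of Y] by simp
  show "AE w in M. ennreal (\<Phi> \<bar>Z m w\<bar>) \<le> ennreal R" for m using \<Phi>(2) by (intro AE_I2 ennreal_leI) simp
  show "(\<integral>\<^sup>+ w. ennreal R \<partial>M) < \<infinity>" by (simp add: emeasure_space_1)
  have cont: "continuous_on {0..} \<Phi>" using \<Phi>(1) by (simp add: class_F_def)
  show "AE w in M. (\<lambda>m. ennreal (\<Phi> \<bar>Z m w\<bar>)) \<longlonglongrightarrow> ennreal (\<Phi> \<bar>Y w\<bar>)"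
    using lim
  proof eventually_elim
    case (elim w)
    show ?case
      by (intro tendsto_ennrealI continuous_on_tendsto_compose[OF cont] tendsto_rabs elim) auto
  qed
qed auto

lemma nn_integral_truncate_SUP:
  assumes [measurable]: "h \<in> borel_measurable M"
  shows "(\<integral>\<^sup>+ w. ennreal (h w) \<partial>M) = (SUP k. \<integral>\<^sup>+ w. ennreal (min (h w) (real k)) \<partial>M)"
proof -
  have "(SUP k. ennreal (min x (real k))) = ennreal x" for x
  proof (rule antisym)
    show "(SUP k. ennreal (min x (real k))) \<le> ennreal x" by (intro SUP_least ennreal_leI) simp
    obtain k where "x \<le> real k" using real_arch_simple by blast
    then have "ennreal x = ennreal (min x (real k))" by simp
    also have "\<dots> \<le> (SUP k. ennreal (min x (real k)))" by (rule SUP_upper) simp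
    finally show "ennreal x \<le> (SUP k. ennreal (min x (real k)))" .
  qed
  then have "(\<integral>\<^sup>+ w. ennreal (h w) \<partial>M) = (\<integral>\<^sup>+ w. (SUP k. ennreal (min (h w) (real k))) \<partial>M)" by simp
  also have "\<dots> = (SUP k. \<integral>\<^sup>+ w. ennreal (min (h w) (real k)) \<partial>M)"
    by (rule nn_integral_monotone_convergence_SUP) (auto simp: incseq_def le_fun_def intro!: ennreal_leI min.mono)
  finally show ?thesis .
qed

text \<open>The finite-valued inequality is a hypothesis with a free \<open>C\<close>, since the
  reduction is applied twice: to the direct estimate on \<open>nat \<Rightarrow> real\<close> and to
  the transferred one on any sample space. For bounded functions, dominated convergence removes the
  rounding and yields the series. The truncation is released last, by monotone convergence, which
  also covers infinite expectations.\<close>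

lemma reduction_to_finite_valued:
  fixes M :: "'a measure"
  assumes filt: "filtered_prob_space M F" and dec: "decoupled_version M F f g"
    and \<Phi>: "0 < q" "\<Phi> \<in> class_F q"
    and fin: "\<And>V R \<Psi> N f' g'. decoupled_version M F f' g' \<Longrightarrow> finite V \<Longrightarrow>
        (\<And>n w. f' n w \<in> V) \<Longrightarrow> (\<And>n w. g' n w \<in> V) \<Longrightarrow> \<Psi> \<in> class_F q \<Longrightarrow> (\<And>x. 0 \<le> x \<Longrightarrow> \<Psi> x \<le> R) \<Longrightarrow>
        (\<integral>\<^sup>+ w. ennreal (\<Psi> \<bar>\<Sum>i=1..N. f' i w\<bar>) \<partial>M)
          \<le> ennreal (C powr (1 + q)) * (\<integral>\<^sup>+ w. ennreal (\<Psi> \<bar>\<Sum>i=1..N. g' i w\<bar>) \<partial>M)"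
  shows "decoupling_ineq C q \<Phi> M f g"
proof -
  interpret prob_space M using filt by (simp add: filtered_prob_space_def)
  have sub: "subalgebra M (F n)" for n using filt by (simp add: filtered_prob_space_def)
  let ?K = "ennreal (C powr (1 + q))"
  obtain G where fF: "\<And>n. f (Suc n) \<in> borel_measurable (F (Suc n))" and gF: "\<And>n. g (Suc n) \<in> borel_measurable (F (Suc n))"
    using dec by (rule decoupled_versionE) blast
  have meas: "f (Suc n) \<in> borel_measurable M" "g (Suc n) \<in> borel_measurable M" for n
    by (rule measurable_from_subalg[OF sub fF], rule measurable_from_subalg[OF sub gF])
  have f [measurable]: "f i \<in> borel_measurable M" and g [measurable]: "g i \<in> borel_measurable M" if "1 \<le> i" for i
    using meas[of "i - 1"] that by simp_all
  have shift: "(\<Sum>i=1..N. h i) = (\<Sum>i<N. h (Suc i))" for N and h :: "nat \<Rightarrow> real"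
    by (simp add: sum.atLeast1_atMost_eq)
  have sum_meas: "(\<lambda>w. \<Sum>i=1..N. f i w) \<in> borel_measurable M" "(\<lambda>w. \<Sum>i=1..N. g i w) \<in> borel_measurable M" for N
    by (rule borel_measurable_sum; simp add: f g)+
  have bounded: "(\<integral>\<^sup>+ w. ennreal (\<Psi> \<bar>\<Sum>i=1..N. f i w\<bar>) \<partial>M) \<le> ?K * (\<integral>\<^sup>+ w. ennreal (\<Psi> \<bar>\<Sum>i=1..N. g i w\<bar>) \<partial>M)"
    if \<Psi>: "\<Psi> \<in> class_F q" "\<And>x. 0 \<le> x \<Longrightarrow> \<Psi> x \<le> R" for \<Psi> R N
  proof (rule LIMSEQ_le)
    show "(\<lambda>m. \<integral>\<^sup>+ w. ennreal (\<Psi> \<bar>\<Sum>i=1..N. rnd m (f i w)\<bar>) \<partial>M) \<longlonglongrightarrow> (\<integral>\<^sup>+ w. ennreal (\<Psi> \<bar>\<Sum>i=1..N. f i w\<bar>) \<partial>M)"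
    proof (rule class_F_dominated_convergence[OF \<Psi>])
      show "(\<lambda>w. \<Sum>i=1..N. rnd m (f i w)) \<in> borel_measurable M" for m
        by (intro borel_measurable_sum measurable_compose[OF _ borel_measurable_rnd] f) simp
    qed (use sum_meas in \<open>auto intro!: tendsto_sum rnd_tendsto\<close>)
    have "(\<lambda>m. \<integral>\<^sup>+ w. ennreal (\<Psi> \<bar>\<Sum>i=1..N. rnd m (g i w)\<bar>) \<partial>M) \<longlonglongrightarrow> (\<integral>\<^sup>+ w. ennreal (\<Psi> \<bar>\<Sum>i=1..N. g i w\<bar>) \<partial>M)"
    proof (rule class_F_dominated_convergence[OF \<Psi>])
      show "(\<lambda>w. \<Sum>i=1..N. rnd m (g i w)) \<in> borel_measurable M" for m
        by (intro borel_measurable_sum measurable_compose[OF _ borel_measurable_rnd] g) simp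
    qed (use sum_meas in \<open>auto intro!: tendsto_sum rnd_tendsto\<close>)
    then show "(\<lambda>m. ?K * (\<integral>\<^sup>+ w. ennreal (\<Psi> \<bar>\<Sum>i=1..N. rnd m (g i w)\<bar>) \<partial>M)) \<longlonglongrightarrow> ?K * (\<integral>\<^sup>+ w. ennreal (\<Psi> \<bar>\<Sum>i=1..N. g i w\<bar>) \<partial>M)"
      by (intro ennreal_tendsto_cmult) simp_all
    show "\<exists>n0. \<forall>m\<ge>n0. (\<integral>\<^sup>+ w. ennreal (\<Psi> \<bar>\<Sum>i=1..N. rnd m (f i w)\<bar>) \<partial>M)
        \<le> ?K * (\<integral>\<^sup>+ w. ennreal (\<Psi> \<bar>\<Sum>i=1..N. rnd m (g i w)\<bar>) \<partial>M)"
      by (intro exI allI impI fin[OF decoupled_version_rnd[OF filt dec] finite_range_rnd _ _ \<Psi>]) auto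
  qed
  have series: "(\<integral>\<^sup>+ w. ennreal (\<Psi> \<bar>\<Sum>i. f (Suc i) w\<bar>) \<partial>M) \<le> ?K * (\<integral>\<^sup>+ w. ennreal (\<Psi> \<bar>\<Sum>i. g (Suc i) w\<bar>) \<partial>M)"
    if \<Psi>: "\<Psi> \<in> class_F q" "\<And>x. 0 \<le> x \<Longrightarrow> \<Psi> x \<le> R"
      and sf: "AE w in M. summable (\<lambda>i. f (Suc i) w)" and sg: "AE w in M. summable (\<lambda>i. g (Suc i) w)" for \<Psi> R
  proof (rule LIMSEQ_le)
    have lim: "(\<lambda>N. \<integral>\<^sup>+ w. ennreal (\<Psi> \<bar>\<Sum>i=1..N. h i w\<bar>) \<partial>M) \<longlonglongrightarrow> (\<integral>\<^sup>+ w. ennreal (\<Psi> \<bar>\<Sum>i. h (Suc i) w\<bar>) \<partial>M)"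
      if sh: "AE w in M. summable (\<lambda>i. h (Suc i) w)" and hm [measurable]: "\<And>n. h (Suc n) \<in> borel_measurable M" for h
      unfolding shift
    proof (rule class_F_dominated_convergence[OF \<Psi>])
      show "AE w in M. (\<lambda>N. \<Sum>i<N. h (Suc i) w) \<longlonglongrightarrow> (\<Sum>i. h (Suc i) w)"
        using sh by eventually_elim (rule summable_LIMSEQ)
    qed measurable
    show "(\<lambda>N. \<integral>\<^sup>+ w. ennreal (\<Psi> \<bar>\<Sum>i=1..N. f i w\<bar>) \<partial>M) \<longlonglongrightarrow> (\<integral>\<^sup>+ w. ennreal (\<Psi> \<bar>\<Sum>i. f (Suc i) w\<bar>) \<partial>M)"
      by (rule lim[OF sf meas(1)])
    show "(\<lambda>N. ?K * (\<integral>\<^sup>+ w. ennreal (\<Psi> \<bar>\<Sum>i=1..N. g i w\<bar>) \<partial>M)) \<longlonglongrightarrow> ?K * (\<integral>\<^sup>+ w. ennreal (\<Psi> \<bar>\<Sum>i. g (Suc i) w\<bar>) \<partial>M)"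
      by (intro ennreal_tendsto_cmult lim[OF sg meas(2)]) simp
    show "\<exists>n0. \<forall>N\<ge>n0. (\<integral>\<^sup>+ w. ennreal (\<Psi> \<bar>\<Sum>i=1..N. f i w\<bar>) \<partial>M) \<le> ?K * (\<integral>\<^sup>+ w. ennreal (\<Psi> \<bar>\<Sum>i=1..N. g i w\<bar>) \<partial>M)"
      by (intro exI allI impI bounded[OF \<Psi>])
  qed
  have unbound: "(\<integral>\<^sup>+ w. ennreal (\<Phi> \<bar>Y w\<bar>) \<partial>M) \<le> ?K * (\<integral>\<^sup>+ w. ennreal (\<Phi> \<bar>Z w\<bar>) \<partial>M)"
    if [measurable]: "Y \<in> borel_measurable M" "Z \<in> borel_measurable M"
      and le: "\<And>k. (\<integral>\<^sup>+ w. ennreal (min (\<Phi> \<bar>Y w\<bar>) (real k)) \<partial>M) \<le> ?K * (\<integral>\<^sup>+ w. ennreal (min (\<Phi> \<bar>Z w\<bar>) (real k)) \<partial>M)" for Y Z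
  proof -
    have "(\<lambda>w. \<Phi> \<bar>Y w\<bar>) \<in> borel_measurable M" by (rule borel_measurable_class_F[OF \<Phi>(2)]) auto
    then have "(\<integral>\<^sup>+ w. ennreal (\<Phi> \<bar>Y w\<bar>) \<partial>M) = (SUP k. \<integral>\<^sup>+ w. ennreal (min (\<Phi> \<bar>Y w\<bar>) (real k)) \<partial>M)"
      by (rule nn_integral_truncate_SUP)
    also have "\<dots> \<le> ?K * (\<integral>\<^sup>+ w. ennreal (\<Phi> \<bar>Z w\<bar>) \<partial>M)"
    proof (rule SUP_least)
      fix k
      note le[of k]
      also have "?K * (\<integral>\<^sup>+ w. ennreal (min (\<Phi> \<bar>Z w\<bar>) (real k)) \<partial>M) \<le> ?K * (\<integral>\<^sup>+ w. ennreal (\<Phi> \<bar>Z w\<bar>) \<partial>M)"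
        by (intro mult_left_mono nn_integral_mono ennreal_leI) auto
      finally show "(\<integral>\<^sup>+ w. ennreal (min (\<Phi> \<bar>Y w\<bar>) (real k)) \<partial>M) \<le> ?K * (\<integral>\<^sup>+ w. ennreal (\<Phi> \<bar>Z w\<bar>) \<partial>M)" .
    qed
    finally show ?thesis .
  qed
  have trunc: "(\<lambda>x. min (\<Phi> x) (real k)) \<in> class_F q" for k
    by (rule class_F_truncate[OF \<Phi>(2,1)]) simp
  have le: "min (\<Phi> x) (real k) \<le> real k" for x k by simp
  have ser_meas: "(\<lambda>w. \<Sum>i. f (Suc i) w) \<in> borel_measurable M" "(\<lambda>w. \<Sum>i. g (Suc i) w) \<in> borel_measurable M"
    using meas by measurable
  show ?thesis
    unfolding decoupling_ineq_def
  proof (intro conjI allI impI)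
    fix N
    show "(\<integral>\<^sup>+ w. ennreal (\<Phi> \<bar>\<Sum>i=1..N. f i w\<bar>) \<partial>M) \<le> ?K * (\<integral>\<^sup>+ w. ennreal (\<Phi> \<bar>\<Sum>i=1..N. g i w\<bar>) \<partial>M)"
      by (rule unbound[OF sum_meas bounded[OF trunc le]])
  next
    assume s: "(AE w in M. summable (\<lambda>i. f (Suc i) w)) \<and> (AE w in M. summable (\<lambda>i. g (Suc i) w))"
    show "(\<integral>\<^sup>+ w. ennreal (\<Phi> \<bar>\<Sum>i. f (Suc i) w\<bar>) \<partial>M) \<le> ?K * (\<integral>\<^sup>+ w. ennreal (\<Phi> \<bar>\<Sum>i. g (Suc i) w\<bar>) \<partial>M)"
      by (rule unbound[OF ser_meas series[OF trunc le s[THEN conjunct1] s[THEN conjunct2]]])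
  qed
qed

section \<open>Transfer to the sample space \<open>nat \<Rightarrow> real\<close>\<close>

text \<open>By change of variables, set integrals of \<open>u\<close> over \<open>A'\<close> become
  set integrals of a conditional probability over sets of \<open>A\<close>, and such integrals
  characterise conditional expectations. The point is that the conditional probability factors
  through \<open>T\<close>.\<close>

lemma (in prob_space) cond_prob_distr:
  assumes T [measurable]: "T \<in> measurable M N" and A: "subalgebra M A" and A': "subalgebra (distr M N T) A'"
    and pull: "\<And>E. E \<in> sets A' \<Longrightarrow> T -` E \<inter> space M \<in> sets A"
    and S [measurable]: "S \<in> sets N" and u: "u \<in> borel_measurable A'"
    and eq: "AE w in M. u (T w) = cond_prob_given M A (T -` S \<inter> space M) w"
  shows "AE x in distr M N T. cond_prob_given (distr M N T) A' S x = u x"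
proof -
  interpret D: prob_space "distr M N T" by (rule prob_space_distr) (rule T)
  interpret A: sigma_finite_subalgebra M A by (rule sigma_finite_subalgebraI[OF A])
  interpret A': sigma_finite_subalgebra "distr M N T" A' by (rule D.sigma_finite_subalgebraI[OF A'])
  have [measurable]: "u \<in> borel_measurable N"
    using measurable_from_subalg[OF A' u] by simp
  let ?S = "T -` S \<inter> space M"
  have S' [measurable]: "?S \<in> sets M" by measurable
  have cm [measurable]: "cond_prob_given M A ?S \<in> borel_measurable M"
    by (rule measurable_from_subalg[OF A]) (rule cond_prob_measurable)
  have int: "integrable M (cond_prob_given M A ?S)"
    unfolding cond_prob_given_def by (intro A.real_cond_exp_int integrable_indicator' S')
  have "integrable M (\<lambda>w. u (T w))"
    by (rule integrable_cong_AE_imp[OF int]) (use eq in auto)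
  then have iu: "integrable (distr M N T) u" by (simp add: integrable_distr_eq)
  have "(\<integral>x\<in>E. indicator S x \<partial>distr M N T) = (\<integral>x\<in>E. u x \<partial>distr M N T)" if E: "E \<in> sets A'" for E
  proof -
    have [measurable]: "E \<in> sets N" using E A' by (auto simp: subalgebra_def)
    let ?E = "T -` E \<inter> space M"
    have [measurable]: "?E \<in> sets M" by measurable
    have "(\<integral>x\<in>E. indicat_real S x \<partial>distr M N T) = (\<integral>w. indicat_real E (T w) * indicat_real S (T w) \<partial>M)"
      by (simp add: set_lebesgue_integral_def integral_distr)
    also have "\<dots> = (\<integral>w\<in>?E. indicator ?S w \<partial>M)"
      unfolding set_lebesgue_integral_def by (rule Bochner_Integration.integral_cong) (auto simp: indicator_def)
    also have "\<dots> = (\<integral>w\<in>?E. cond_prob_given M A ?S w \<partial>M)"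
      unfolding cond_prob_given_def by (rule A.real_cond_exp_intA[OF integrable_indicator'[OF S'] pull[OF E]])
    also have "\<dots> = (\<integral>w. indicator E (T w) * u (T w) \<partial>M)"
      unfolding set_lebesgue_integral_def
      by (rule integral_cong_AE) (use eq AE_space in \<open>auto elim!: eventually_elim2 simp: indicator_def\<close>)
    also have "\<dots> = (\<integral>x\<in>E. u x \<partial>distr M N T)"
      by (simp add: set_lebesgue_integral_def integral_distr)
    finally show ?thesis .
  qed
  then show ?thesis
    unfolding cond_prob_given_def
    by (rule A'.real_cond_exp_charact[OF _ D.integrable_indicator' iu u]) simp_all
qed

text \<open>The largest \<sigma>-algebra within \<open>sets N\<close> for which \<open>T\<close> is
  measurable on \<open>A\<close>: a measurable function on \<open>N\<close> is measurable for it as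
  soon as its composition with \<open>T\<close> is measurable for \<open>A\<close>.\<close>

definition pushed_algebra :: "'a measure \<Rightarrow> ('a \<Rightarrow> 'b) \<Rightarrow> 'b measure \<Rightarrow> 'b measure" where
  "pushed_algebra A T N = sigma (space N) {E \<in> sets N. T -` E \<inter> space A \<in> sets A}"

lemma space_pushed_algebra [simp]: "space (pushed_algebra A T N) = space N"
  by (simp add: pushed_algebra_def space_measure_of_conv)

lemma sets_pushed_algebra:
  assumes "T \<in> space A \<rightarrow> space N"
  shows "sets (pushed_algebra A T N) = {E \<in> sets N. T -` E \<inter> space A \<in> sets A}"
proof -
  let ?C = "{E \<in> sets N. T -` E \<inter> space A \<in> sets A}"
  have "sigma_algebra (space N) ?C"
    unfolding sigma_algebra_iff2
  proof (intro conjI ballI allI impI)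
    show "?C \<subseteq> Pow (space N)" using sets.sets_into_space by auto
    show "{} \<in> ?C" by simp
  next
    fix E assume E: "E \<in> ?C"
    have "T -` (space N - E) \<inter> space A = space A - (T -` E \<inter> space A)" using assms by auto
    then show "space N - E \<in> ?C" using E by auto
  next
    fix E :: "nat \<Rightarrow> _" assume E: "range E \<subseteq> ?C"
    have "T -` (\<Union>i. E i) \<inter> space A = (\<Union>i. T -` E i \<inter> space A)" by auto
    moreover have "(\<Union>i. T -` E i \<inter> space A) \<in> sets A" using E by (intro sets.countable_nat_UN) auto
    moreover have "(\<Union>i. E i) \<in> sets N" using E by (intro sets.countable_nat_UN) auto
    ultimately show "(\<Union>i. E i) \<in> ?C" by simp
  qed
  then show ?thesis unfolding pushed_algebra_def by (rule sigma_algebra.sets_measure_of_eq)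
qed

text \<open>The process, its decoupled version and the finitely many relevant conditional probabilities at each
  time are the coordinates of the image space \<open>nat \<Rightarrow> real\<close>; its \<open>\<sigma>\<close>-algebras are the images
  of the given ones.\<close>

lemma transfer_to_sequences:
  fixes M :: "'a measure"
  assumes filt: "filtered_prob_space M F" and dec: "decoupled_version M F f g" and V: "finite V"
    and gV: "\<And>n w. g n w \<in> V"
  obtains M' :: "(nat \<Rightarrow> real) measure" and F' f' g' T
  where "filtered_prob_space M' F'" "decoupled_version M' F' f' g'"
    "T \<in> measurable M M'" "M' = distr M M' T"
    "\<And>n w. 1 \<le> n \<Longrightarrow> f' n (T w) = f n w" "\<And>n w. 1 \<le> n \<Longrightarrow> g' n (T w) = g n w"
proof -
  interpret prob_space M using filt by (simp add: filtered_prob_space_def)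
  have sub: "subalgebra M (F n)" for n using filt by (simp add: filtered_prob_space_def)
  have F0: "sets (F 0) = {{}, space M}" using filt by (simp add: filtered_prob_space_def)
  have "filtration (space M) F" using filt by (simp add: filtered_prob_space_def)
  then have mono: "sets (F m) \<subseteq> sets (F n)" if "m \<le> n" for m n
    using that by (rule filtration.sets_F_mono)
  obtain G where fF: "\<And>n. f (Suc n) \<in> borel_measurable (F (Suc n))" and gF: "\<And>n. g (Suc n) \<in> borel_measurable (F (Suc n))"
    and tang: "\<And>n. same_cond_law M (f (Suc n)) (F n) (g (Suc n)) (F n)"
    and G: "subalgebra M G" "\<And>n. same_cond_law M (g (Suc n)) (F n) (g (Suc n)) G" "cond_indep_seq M G g"
    using dec by (rule decoupled_versionE) blast
  define u where "u i U = cond_prob_given M (F i) {y \<in> space M. g (Suc i) y \<in> U}" for i U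
  define u' where "u' i U = cond_prob_given M G {y \<in> space M. g (Suc i) y \<in> U}" for i U
  \<comment> \<open>The conditional probabilities are made coordinates so that they factor through
    \<open>T\<close>. As \<open>V\<close> is finite, only finitely many events \<open>U\<close>
    occur at each time, and \<open>Z\<close> stays countable.\<close>
  define Z where "Z = range (\<lambda>n. f (Suc n)) \<union> range (\<lambda>n. g (Suc n))
      \<union> case_prod u ` (UNIV \<times> Pow V) \<union> case_prod u' ` (UNIV \<times> Pow V)"
  have cZ: "countable Z" unfolding Z_def using V by (intro countable_Un countable_image countable_SIGMA) (auto intro: countable_finite)
  have nZ: "Z \<noteq> {}" unfolding Z_def by blast
  have inZ: "f (Suc n) \<in> Z" "g (Suc n) \<in> Z" "U \<subseteq> V \<Longrightarrow> u n U \<in> Z" "U \<subseteq> V \<Longrightarrow> u' n U \<in> Z" for n U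
    unfolding Z_def by (blast, blast, force, force)
  have uF: "u i U \<in> borel_measurable (F i)" and u'G: "u' i U \<in> borel_measurable G" for i U
    unfolding u_def u'_def by (rule cond_prob_measurable)+
  have ZM: "h \<in> borel_measurable M" if "h \<in> Z" for h
    using that measurable_from_subalg[OF sub fF] measurable_from_subalg[OF sub gF]
      measurable_from_subalg[OF sub uF] measurable_from_subalg[OF G(1) u'G]
    unfolding Z_def by (elim UnE imageE) auto
  define T where "T w n = from_nat_into Z n w" for w n
  define coord where "coord h x = x (to_nat_on Z h)" for h :: "'a \<Rightarrow> real" and x :: "nat \<Rightarrow> real"
  have cT: "coord h (T w) = h w" if "h \<in> Z" for h w
    using from_nat_into_to_nat_on[OF cZ that] by (simp add: coord_def T_def)
  define N where "N = (\<Pi>\<^sub>M n\<in>(UNIV::nat set). (borel :: real measure))"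
  have spN: "space N = UNIV" by (simp add: N_def space_PiM)
  have TN [measurable]: "T \<in> measurable M N"
    unfolding N_def by (rule measurable_PiM_single') (use ZM[OF from_nat_into[OF nZ]] in \<open>auto simp: T_def\<close>)
  have cN [measurable]: "coord h \<in> borel_measurable N" for h
    unfolding N_def coord_def[abs_def] by measurable
  define M' where "M' = distr M N T"
  interpret M': prob_space M' unfolding M'_def by (rule prob_space_distr) measurable
  have spM: "space M' = UNIV" and seM: "sets M' = sets N" by (simp_all add: M'_def spN)
  \<comment> \<open>Time 0 is set by hand: pushing \<open>F 0\<close> forward would retain every set
    of \<open>N\<close> whose preimage is empty or everything, and that need not be a trivial
    algebra.\<close>
  define F' where "F' n = (if n = 0 then sigma UNIV {} else pushed_algebra (F n) T N)" for n
  define G' where "G' = pushed_algebra G T N"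
  have spF: "space (F n) = space M" for n using sub[of n] by (simp add: subalgebra_def)
  have spG: "space G = space M" using G(1) by (simp add: subalgebra_def)
  have TF: "T \<in> space (F n) \<rightarrow> space N" and TG: "T \<in> space G \<rightarrow> space N" for n by (auto simp: spN)
  have F'0: "sets (F' 0) = {{}, UNIV}" by (simp add: F'_def sigma_sets_empty_eq)
  have F'S: "sets (F' (Suc n)) = {E \<in> sets N. T -` E \<inter> space M \<in> sets (F (Suc n))}" for n
    using sets_pushed_algebra[OF TF] by (simp add: F'_def spF)
  have G'S: "sets G' = {E \<in> sets N. T -` E \<inter> space M \<in> sets G}"
    using sets_pushed_algebra[OF TG] by (simp add: G'_def spG)
  have spF': "space (F' n) = UNIV" for n by (simp add: F'_def spN space_measure_of_conv)
  have spG': "space G' = UNIV" by (simp add: G'_def spN)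
  have pullF: "T -` E \<inter> space M \<in> sets (F n)" and F'N: "E \<in> sets N" if "E \<in> sets (F' n)" for E n
    using that F'0 F'S F0 sets.top[of N] by (cases n; auto simp: spN)+
  have subF': "subalgebra M' (F' n)" for n
    using F'N by (auto simp: subalgebra_def spF' spM seM)
  have subG': "subalgebra M' G'" by (auto simp: subalgebra_def spG' spM seM G'S)
  have monoF': "sets (F' m) \<subseteq> sets (F' n)" if "m \<le> n" for m n
  proof (cases m)
    case 0
    then show ?thesis using F'0 sets.top[of "F' n"] by (auto simp: spF')
  next
    case (Suc k)
    then obtain l where "n = Suc l" using \<open>m \<le> n\<close> by (cases n) auto
    then show ?thesis using Suc mono[OF that] by (auto simp: F'S)
  qed
  have filt': "filtered_prob_space M' F'"
    unfolding filtered_prob_space_def filtration_def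
    using M'.prob_space_axioms subF' monoF' F'0 by (auto simp: spF' spM)
  have pre: "T -` (coord h -` B) \<inter> space M = h -` B \<inter> space M" if "h \<in> Z" for h and B :: "real set"
    using cT[OF that] by auto
  have coordF: "coord h \<in> borel_measurable (F' (Suc n))" if "h \<in> Z" "h \<in> borel_measurable (F (Suc n))" for h n
  proof (rule measurableI)
    fix B :: "real set" assume B: "B \<in> sets borel"
    have "coord h -` B \<in> sets N" using measurable_sets[OF cN B, of h] by (simp add: spN)
    moreover have "h -` B \<inter> space M \<in> sets (F (Suc n))" using measurable_sets[OF that(2) B] by (simp add: spF)
    ultimately show "coord h -` B \<inter> space (F' (Suc n)) \<in> sets (F' (Suc n))"
      by (simp add: F'S spF' pre[OF that(1)])
  qed simp
  have coordG: "coord h \<in> borel_measurable G'" if "h \<in> Z" "h \<in> borel_measurable G" for h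
  proof (rule measurableI)
    fix B :: "real set" assume B: "B \<in> sets borel"
    have "coord h -` B \<in> sets N" using measurable_sets[OF cN B, of h] by (simp add: spN)
    moreover have "h -` B \<inter> space M \<in> sets G" using measurable_sets[OF that(2) B] by (simp add: spG)
    ultimately show "coord h -` B \<inter> space G' \<in> sets G'"
      by (simp add: G'S spG' pre[OF that(1)])
  qed simp
  obtain w0 where w0: "w0 \<in> space M" using not_empty by blast
  \<comment> \<open>The image of the trivial \<open>F 0\<close> has to be trivial, which the coordinates are only almost surely.\<close>
  define r where "r i U = (if i = 0 then (\<lambda>_. u 0 U w0) else coord (u i U))" for i U
  have rF: "r i U \<in> borel_measurable (F' i)" if "U \<subseteq> V" for i U
    using that by (cases i) (simp_all add: r_def coordF inZ uF)
  have rN [measurable]: "r i U \<in> borel_measurable N" for i U by (simp add: r_def)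
  have rT: "r i U (T w) = u i U w" if "U \<subseteq> V" "w \<in> space M" for i U w
  proof (cases i)
    case 0
    have "u 0 U -` {u 0 U w0} \<inter> space M \<in> sets (F 0)"
      using measurable_sets[OF uF, of "{u 0 U w0}" 0 U] by (simp add: spF)
    then have "u 0 U -` {u 0 U w0} \<inter> space M \<in> {{}, space M}" by (simp only: F0)
    moreover have "w0 \<in> u 0 U -` {u 0 U w0} \<inter> space M" using w0 by simp
    ultimately have "u 0 U -` {u 0 U w0} \<inter> space M = space M" by (elim insertE) auto
    then have "w \<in> u 0 U -` {u 0 U w0} \<inter> space M" using that(2) by (simp only:)
    then show ?thesis by (simp add: r_def 0)
  next
    case (Suc k)
    then show ?thesis using that by (simp add: r_def cT inZ)
  qed
  define f' where "f' n = coord (f n)" for n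
  define g' where "g' n = coord (g n)" for n
  have gt: "{y \<in> space M. t < g n y} = {y \<in> space M. g n y \<in> {v \<in> V. t < v}}" for n t
    using gV by auto
  have gB: "{y \<in> space M. g n y \<in> B} = {y \<in> space M. g n y \<in> V \<inter> B}" for n B
    using gV by auto
  have condF: "AE x in M'. cond_prob_given M' (F' i) S x = r i U x"
    if "U \<subseteq> V" "S \<in> sets N" "AE w in M. u i U w = cond_prob_given M (F i) (T -` S \<inter> space M) w" for i U S
    unfolding M'_def
  proof (rule cond_prob_distr[OF TN sub _ pullF that(2) rF[OF that(1)]])
    show "subalgebra (distr M N T) (F' i)" using subF' by (simp add: M'_def)
    show "AE w in M. r i U (T w) = cond_prob_given M (F i) (T -` S \<inter> space M) w"
      using that(3) AE_space by eventually_elim (simp add: rT[OF that(1)])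
  qed
  have condG: "AE x in M'. cond_prob_given M' G' S x = h x"
    if "h \<in> borel_measurable G'" "S \<in> sets N" "AE w in M. h (T w) = cond_prob_given M G (T -` S \<inter> space M) w" for h S
    unfolding M'_def
  proof (rule cond_prob_distr[OF TN G(1) _ _ that(2,1,3)])
    show "subalgebra (distr M N T) G'" using subG' by (simp add: M'_def)
    show "T -` E \<inter> space M \<in> sets G" if "E \<in> sets G'" for E using that by (simp add: G'S)
  qed
  have preS: "T -` {x \<in> space M'. coord h x \<in> B} \<inter> space M = {w \<in> space M. h w \<in> B}" if "h \<in> Z" for h B
    using cT[OF that] by (auto simp: spM)
  have Sset: "{x \<in> space M'. coord h x \<in> B} \<in> sets N" if "B \<in> sets borel" for h B
    using measurable_sets[OF cN that, of h] by (simp add: spM spN vimage_def)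
  have lawF: "AE x in M'. cond_prob_given M' (F' i) {x \<in> space M'. t < coord h x} x = r i {v \<in> V. t < v} x"
    if h: "h \<in> Z" "same_cond_law M h (F i) (g (Suc i)) (F i)" for h i t
  proof -
    have "AE x in M'. cond_prob_given M' (F' i) {x \<in> space M'. coord h x \<in> {t<..}} x = r i {v \<in> V. t < v} x"
    proof (rule condF)
      show "AE w in M. u i {v \<in> V. t < v} w = cond_prob_given M (F i) (T -` {x \<in> space M'. coord h x \<in> {t<..}} \<inter> space M) w"
        unfolding preS[OF h(1)] u_def gt[symmetric]
        using h(2)[unfolded same_cond_law_def, rule_format, of t] by eventually_elim simp
      show "{x \<in> space M'. coord h x \<in> {t<..}} \<in> sets N" by (rule Sset) simp
    qed auto
    then show ?thesis by simp
  qed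
  have lawG: "AE x in M'. cond_prob_given M' G' {x \<in> space M'. g' (Suc i) x \<in> B} x = coord (u' i (V \<inter> B)) x"
    if "B \<in> sets borel" for i B
    unfolding g'_def
  proof (rule condG)
    show "coord (u' i (V \<inter> B)) \<in> borel_measurable G'" by (intro coordG inZ u'G Int_lower1)
    show "{x \<in> space M'. coord (g (Suc i)) x \<in> B} \<in> sets N" by (rule Sset[OF that])
    have "coord (u' i (V \<inter> B)) (T w) = cond_prob_given M G (T -` {x \<in> space M'. coord (g (Suc i)) x \<in> B} \<inter> space M) w" for w
      unfolding preS[OF inZ(2)] cT[OF inZ(4)[OF Int_lower1]] unfolding gB[of "Suc i" B] u'_def ..
    then show "AE w in M. coord (u' i (V \<inter> B)) (T w) = cond_prob_given M G (T -` {x \<in> space M'. coord (g (Suc i)) x \<in> B} \<inter> space M) w"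
      by simp
  qed
  have "decoupled_version M' F' f' g'"
  proof (rule decoupled_versionI[where G = G'])
    fix n
    show "f' (Suc n) \<in> borel_measurable (F' (Suc n))" "g' (Suc n) \<in> borel_measurable (F' (Suc n))"
      unfolding f'_def g'_def by (intro coordF inZ fF gF)+
    show "same_cond_law M' (f' (Suc n)) (F' n) (g' (Suc n)) (F' n)"
      unfolding same_cond_law_def f'_def g'_def
    proof
      fix t
      \<comment> \<open>Reflexivity lets \<open>lawF\<close> treat \<open>g\<close> like
        \<open>f\<close>. Both conditional laws on the image space are the same function
        \<open>r\<close>, which is tangency.\<close>
      have "same_cond_law M (g (Suc n)) (F n) (g (Suc n)) (F n)" by (simp add: same_cond_law_def)
      from lawF[OF inZ(1) tang, of n t] lawF[OF inZ(2) this, of t]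
      show "AE x in M'. cond_prob_given M' (F' n) {y \<in> space M'. t < coord (f (Suc n)) y} x
        = cond_prob_given M' (F' n) {y \<in> space M'. t < coord (g (Suc n)) y} x"
        by eventually_elim simp
    qed
    show "same_cond_law M' (g' (Suc n)) (F' n) (g' (Suc n)) G'"
      unfolding same_cond_law_def
    proof
      fix t
      have 0: "same_cond_law M (g (Suc n)) (F n) (g (Suc n)) (F n)" by (simp add: same_cond_law_def)
      have VB: "V \<inter> {t<..} = {v \<in> V. t < v}" by auto
      have 1: "AE x in M'. cond_prob_given M' G' {y \<in> space M'. t < g' (Suc n) y} x = coord (u' n {v \<in> V. t < v}) x"
        using lawG[of "{t<..}" n] by (simp add: VB)
      \<comment> \<open>On the original space, condition (CI) equates \<open>u\<close> and
        \<open>u'\<close> almost surely; as both factor through \<open>T\<close>, the equality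
        passes to the image measure.\<close>
      have "AE w in M. u n {v \<in> V. t < v} w = u' n {v \<in> V. t < v} w"
        using G(2)[of n, unfolded same_cond_law_def, rule_format, of t] unfolding u_def u'_def gt .
      then have "AE w in M. r n {v \<in> V. t < v} (T w) = coord (u' n {v \<in> V. t < v}) (T w)"
        using AE_space by eventually_elim (simp add: rT cT inZ)
      then have 2: "AE x in M'. r n {v \<in> V. t < v} x = coord (u' n {v \<in> V. t < v}) x"
        unfolding M'_def by (subst AE_distr_iff) auto
      from lawF[OF inZ(2) 0, of t] 1 2
      show "AE x in M'. cond_prob_given M' (F' n) {y \<in> space M'. t < g' (Suc n) y} x
        = cond_prob_given M' G' {y \<in> space M'. t < g' (Suc n) y} x"
        unfolding g'_def by eventually_elim simp
    qed
    show "subalgebra M' G'" by (rule subG')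
    show "cond_indep_seq M' G' g'"
      unfolding cond_indep_seq_def
    proof (intro allI impI)
      fix J :: "nat set" and B :: "nat \<Rightarrow> real set"
      assume J: "finite J \<and> J \<noteq> {} \<and> J \<subseteq> {1..} \<and> (\<forall>j\<in>J. B j \<in> sets borel)"
      have pred: "Suc (j - 1) = j" if "j \<in> J" for j using J that by force
      have gJ: "g j \<in> Z" if "j \<in> J" for j using inZ(2)[of "j - 1"] pred[OF that] by simp
      let ?h = "\<lambda>j. coord (u' (j - 1) (V \<inter> B j))"
      have each: "AE x in M'. cond_prob_given M' G' {x \<in> space M'. g' j x \<in> B j} x = ?h j x" if "j \<in> J" for j
        using lawG[of "B j" "j - 1"] J that pred[OF that] by simp
      then have all: "AE x in M'. \<forall>j\<in>J. cond_prob_given M' G' {x \<in> space M'. g' j x \<in> B j} x = ?h j x"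
        using J by (intro AE_finite_allI) auto
      \<comment> \<open>The product of coordinates is measurable for \<open>G'\<close>, and along
        \<open>T\<close> it equals the conditional probability of the joint event almost surely, so
        it is a version of that probability on the image space.\<close>
      have "AE x in M'. cond_prob_given M' G' {x \<in> space M'. \<forall>j\<in>J. g' j x \<in> B j} x = (\<Prod>j\<in>J. ?h j x)"
      proof (rule condG)
        show "(\<lambda>x. \<Prod>j\<in>J. ?h j x) \<in> borel_measurable G'"
          by (intro borel_measurable_prod coordG inZ u'G) simp
        have "{x \<in> space M'. \<forall>j\<in>J. g' j x \<in> B j} = (\<Inter>j\<in>J. {x \<in> space M'. coord (g j) x \<in> B j})"
          using J by (auto simp: g'_def spM)
        also have "\<dots> \<in> sets N" using J by (intro sets.finite_INT Sset) auto
        finally show "{x \<in> space M'. \<forall>j\<in>J. g' j x \<in> B j} \<in> sets N" .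
        have "T -` {x \<in> space M'. \<forall>j\<in>J. g' j x \<in> B j} \<inter> space M = {y \<in> space M. \<forall>j\<in>J. g j y \<in> B j}"
          using cT[OF gJ] by (auto simp: g'_def spM)
        moreover have "AE w in M. cond_prob_given M G {y \<in> space M. \<forall>j\<in>J. g j y \<in> B j} w
            = (\<Prod>j\<in>J. cond_prob_given M G {y \<in> space M. g j y \<in> B j} w)"
          using J by (intro G(3)[unfolded cond_indep_seq_def, rule_format]) simp
        moreover have "(\<Prod>j\<in>J. cond_prob_given M G {y \<in> space M. g j y \<in> B j} w) = (\<Prod>j\<in>J. ?h j (T w))" for w
        proof (rule prod.cong[OF refl])
          fix j assume "j \<in> J"
          show "cond_prob_given M G {y \<in> space M. g j y \<in> B j} w = ?h j (T w)"
            unfolding cT[OF inZ(4)[OF Int_lower1]] unfolding u'_def pred[OF \<open>j \<in> J\<close>] gB[of j "B j"] ..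
        qed
        ultimately show "AE w in M. (\<Prod>j\<in>J. ?h j (T w))
            = cond_prob_given M G (T -` {x \<in> space M'. \<forall>j\<in>J. g' j x \<in> B j} \<inter> space M) w"
          by (auto elim!: eventually_mono)
      qed
      then show "AE x in M'. cond_prob_given M' G' {y \<in> space M'. \<forall>j\<in>J. g' j y \<in> B j} x
          = (\<Prod>j\<in>J. cond_prob_given M' G' {y \<in> space M'. g' j y \<in> B j} x)"
        using all by eventually_elim simp
    qed
  qed
  moreover have "f' n (T w) = f n w" "g' n (T w) = g n w" if "1 \<le> n" for n w
    using that inZ(1,2)[of "n - 1"] by (simp_all add: f'_def g'_def cT)
  moreover have "T \<in> measurable M M'" using TN by (simp add: measurable_cong_sets[OF refl seM])
  moreover have "M' = distr M M' T" unfolding M'_def by (rule distr_cong) auto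
  ultimately show thesis by (intro that[OF filt'])
qed

text \<open>Composed with \<open>T\<close>, the processes \<open>f'\<close> and \<open>g'\<close>
  are \<open>f\<close> and \<open>g\<close>, so by change of variables both expectations agree on
  the two spaces and the inequality is inherited with the same \<open>C\<close>.\<close>

lemma finite_valued_transfer:
  fixes M :: "'a measure"
  assumes P: "\<And>(M' :: (nat \<Rightarrow> real) measure) F' f' g'.
        filtered_prob_space M' F' \<Longrightarrow> decoupled_version M' F' f' g' \<Longrightarrow> decoupling_ineq C q \<Phi> M' f' g'"
    and filt: "filtered_prob_space M F" and dec: "decoupled_version M F f g" and V: "finite V"
    and gV: "\<And>n w. g n w \<in> V" and \<Phi>: "\<Phi> \<in> class_F q"
  shows "(\<integral>\<^sup>+ w. ennreal (\<Phi> \<bar>\<Sum>i=1..N. f i w\<bar>) \<partial>M)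
    \<le> ennreal (C powr (1 + q)) * (\<integral>\<^sup>+ w. ennreal (\<Phi> \<bar>\<Sum>i=1..N. g i w\<bar>) \<partial>M)"
proof -
  obtain M' :: "(nat \<Rightarrow> real) measure" and F' f' g' T
    where M': "filtered_prob_space M' F'" "decoupled_version M' F' f' g'"
      "T \<in> measurable M M'" "M' = distr M M' T"
      "\<And>n w. 1 \<le> n \<Longrightarrow> f' n (T w) = f n w" "\<And>n w. 1 \<le> n \<Longrightarrow> g' n (T w) = g n w"
    by (rule transfer_to_sequences[OF filt dec V gV]) blast
  have sub: "subalgebra M' (F' n)" for n using M'(1) by (simp add: filtered_prob_space_def)
  obtain G where "\<And>n. f' (Suc n) \<in> borel_measurable (F' (Suc n))" "\<And>n. g' (Suc n) \<in> borel_measurable (F' (Suc n))"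
    using M'(2) by (rule decoupled_versionE) blast
  then have meas: "f' (Suc n) \<in> borel_measurable M'" "g' (Suc n) \<in> borel_measurable M'" for n
    using measurable_from_subalg[OF sub] by blast+
  have eq: "(\<integral>\<^sup>+ x. ennreal (\<Phi> \<bar>\<Sum>i=1..N. h' i x\<bar>) \<partial>M') = (\<integral>\<^sup>+ w. ennreal (\<Phi> \<bar>\<Sum>i=1..N. h i w\<bar>) \<partial>M)"
    if h': "\<And>n. h' (Suc n) \<in> borel_measurable M'" "\<And>n w. 1 \<le> n \<Longrightarrow> h' n (T w) = h n w" for h h'
  proof -
    have "h' i \<in> borel_measurable M'" if "1 \<le> i" for i using h'(1)[of "i - 1"] that by simp
    then have "(\<lambda>x. \<Sum>i=1..N. h' i x) \<in> borel_measurable M'" by (intro borel_measurable_sum) simp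
    then have m: "(\<lambda>x. \<Phi> \<bar>\<Sum>i=1..N. h' i x\<bar>) \<in> borel_measurable M'"
      by (intro borel_measurable_class_F[OF \<Phi>] borel_measurable_abs) auto
    have "(\<integral>\<^sup>+ x. ennreal (\<Phi> \<bar>\<Sum>i=1..N. h' i x\<bar>) \<partial>M') = (\<integral>\<^sup>+ x. ennreal (\<Phi> \<bar>\<Sum>i=1..N. h' i x\<bar>) \<partial>distr M M' T)"
      using M'(4) by simp
    also have "\<dots> = (\<integral>\<^sup>+ w. ennreal (\<Phi> \<bar>\<Sum>i=1..N. h' i (T w)\<bar>) \<partial>M)"
      by (rule nn_integral_distr[OF M'(3)]) (use m in simp)
    also have "\<dots> = (\<integral>\<^sup>+ w. ennreal (\<Phi> \<bar>\<Sum>i=1..N. h i w\<bar>) \<partial>M)"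
      using h'(2) by simp
    finally show ?thesis .
  qed
  have "(\<integral>\<^sup>+ x. ennreal (\<Phi> \<bar>\<Sum>i=1..N. f' i x\<bar>) \<partial>M')
    \<le> ennreal (C powr (1 + q)) * (\<integral>\<^sup>+ x. ennreal (\<Phi> \<bar>\<Sum>i=1..N. g' i x\<bar>) \<partial>M')"
    using P[OF M'(1,2)] unfolding decoupling_ineq_def by blast
  moreover have "(\<integral>\<^sup>+ x. ennreal (\<Phi> \<bar>\<Sum>i=1..N. f' i x\<bar>) \<partial>M') = (\<integral>\<^sup>+ w. ennreal (\<Phi> \<bar>\<Sum>i=1..N. f i w\<bar>) \<partial>M)"
    by (rule eq) (rule meas M'(5), assumption?)+
  moreover have "(\<integral>\<^sup>+ x. ennreal (\<Phi> \<bar>\<Sum>i=1..N. g' i x\<bar>) \<partial>M') = (\<integral>\<^sup>+ w. ennreal (\<Phi> \<bar>\<Sum>i=1..N. g i w\<bar>) \<partial>M)"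
    by (rule eq) (rule meas M'(6), assumption?)+
  ultimately show ?thesis by simp
qed

theorem theorem1p1:
  "universal_const > 0 \<and>
   (\<forall>q>0. \<forall>\<Phi>\<in>class_F q. \<forall>(M :: 'a measure) F f g.
      filtered_prob_space M F \<longrightarrow> adapted_seq F f \<longrightarrow> decoupled_version M F f g \<longrightarrow>
      decoupling_ineq universal_const q \<Phi> M f g)"
proof -
  let ?P = "\<lambda>C. C > 0 \<and> (\<forall>q>0. \<forall>\<Phi>\<in>class_F q. \<forall>(M :: (nat \<Rightarrow> real) measure) F f g.
        filtered_prob_space M F \<longrightarrow> adapted_seq F f \<longrightarrow> decoupled_version M F f g \<longrightarrow>
        decoupling_ineq C q \<Phi> M f g)"
  have "?P 4000"
  proof (intro conjI allI ballI impI)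
    fix q :: real and \<Phi> and M :: "(nat \<Rightarrow> real) measure" and F f g
    assume q: "0 < q" and \<Phi>: "\<Phi> \<in> class_F q" and M: "filtered_prob_space M F" and d: "decoupled_version M F f g"
    show "decoupling_ineq 4000 q \<Phi> M f g"
      by (rule reduction_to_finite_valued[OF M d q \<Phi>]) (rule finite_valued_inequality[OF M _ _ _ _ q])
  qed simp
  \<comment> \<open>The choice operator need not return 4000. All that is known of the constant is
    its property on \<open>nat \<Rightarrow> real\<close>, so every other sample space has to
    inherit the inequality from there.\<close>
  then have P: "?P universal_const" unfolding universal_const_def by (rule someI)
  then have seq: "decoupling_ineq universal_const q \<Phi> M f g"
    if "0 < q" "\<Phi> \<in> class_F q" "filtered_prob_space M F" "decoupled_version M F f g"
    for q \<Phi> and M :: "(nat \<Rightarrow> real) measure" and F f g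
    using that by (auto simp: decoupled_version_def tangent_seqs_def)
  have "decoupling_ineq universal_const q \<Phi> M f g"
    if q: "0 < q" and \<Phi>: "\<Phi> \<in> class_F q" and M: "filtered_prob_space M F" and d: "decoupled_version M F f g"
    for q \<Phi> and M :: "'a measure" and F f g
    by (rule reduction_to_finite_valued[OF M d q \<Phi>]) (rule finite_valued_transfer[OF seq[OF q] M])
  then show ?thesis using P by blast
qed

end
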